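(* Let $N\ge3$. For any smooth domain $D\subset\mathbb S^{N-1}_+$, with $D_\alpha=\phi_\alpha(D)$ for $\alpha\in(0,2)$, we have $$\lim_{\alpha\to0^+}\lambda_j(D_\alpha)=+\infty\qquad\text{for all } j\ge 1.$$
   Context: $\mathbb S^{N-1}_+=\mathbb S^{N-1}\cap\{x_N>0\}$. For a smooth domain $D\subset\mathbb S^{N-1}$, $0=\lambda_0(D)<\lambda_1(D)\le\lambda_2(D)\le\cdots$ are the eigenvalues (repeated with multiplicity) of $-\Delta_{\mathbb S^{N-1}}$ (round metric) on $D$ with Neumann boundary conditions. In geodesic polar coordinates $(r,\omega)$ on $\mathbb S^{N-1}$ centered at the north pole ($r$ the geodesic distance from the north pole, $\omega\in\mathbb S^{N-2}$), for $\alpha\in(0,2)$ the map $\phi_\alpha$ is defined on $\mathbb S^{N-1}_+$ by $\phi_\alpha(r,\omega)=(\alpha r,\omega)$; it is a diffeomorphism onto the geodesic disk of radius $\alpha\pi/2$ centered at the north pole. *)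

theory Defs
  imports "HOL-Analysis.Analysis"
begin

text \<open>
  The round sphere is \<open>sphere 0 1\<close> in a Euclidean space. A function on (an open part of) it is
  represented by a function on the ambient space, of which only the values on the sphere matter.
\<close>

subsection \<open>Functions of class \<open>C\<^sup>k\<close>\<close>

text \<open>Meant for open sets \<open>S\<close>.\<close>

primrec Ck_on :: "nat \<Rightarrow> 'a::real_normed_vector set \<Rightarrow> ('a \<Rightarrow> 'b::real_normed_vector) \<Rightarrow> bool" where
  "Ck_on 0 S f \<longleftrightarrow> continuous_on S f"
| "Ck_on (Suc k) S f \<longleftrightarrow> (\<forall>x\<in>S. f differentiable (at x)) \<and>
     (\<forall>v. Ck_on k S (\<lambda>x. frechet_derivative f (at x) v))"

definition smooth_on :: "'a::real_normed_vector set \<Rightarrow> ('a \<Rightarrow> 'b::real_normed_vector) \<Rightarrow> bool" where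
  "smooth_on S f \<longleftrightarrow> (\<forall>k. Ck_on k S f)"

subsection \<open>Differential operators of the round metric\<close>

text \<open>
  At a point of the unit sphere, the Riemannian gradient and the Laplace--Beltrami operator of \<open>f\<close>
  are the Euclidean gradient and Laplacian of the extension \<open>x \<mapsto> f (x / |x|)\<close> that is constant along
  rays: in Euclidean polar coordinates the Laplacian is
  \<open>\<partial>\<^sub>t\<^sup>2 + (N - 1) / t \<partial>\<^sub>t + t\<^sup>-\<^sup>2 \<Delta>\<close>, with \<open>\<Delta>\<close> the spherical one, and the \<open>t\<close>-derivatives vanish.
  Note that \<open>sgn x = x /\<^sub>R norm x\<close>.
\<close>

definition sphere_grad :: "('a::euclidean_space \<Rightarrow> real) \<Rightarrow> 'a \<Rightarrow> 'a" where
  "sphere_grad f x = (\<Sum>b\<in>Basis. frechet_derivative (\<lambda>y. f (sgn y)) (at x) b *\<^sub>R b)"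

definition sphere_laplacian :: "('a::euclidean_space \<Rightarrow> real) \<Rightarrow> 'a \<Rightarrow> real" where
  "sphere_laplacian f x =
     (\<Sum>b\<in>Basis. frechet_derivative (\<lambda>y. frechet_derivative (\<lambda>z. f (sgn z)) (at y) b) (at x) b)"

subsection \<open>Smooth domains in the sphere\<close>

text \<open>
  For \<open>D\<close> open in the sphere, the boundary of \<open>D\<close> relative to the sphere is \<open>closure D - D\<close>.
\<close>

definition boundary_function ::
    "'a::euclidean_space set \<Rightarrow> 'a \<Rightarrow> 'a set \<Rightarrow> ('a \<Rightarrow> real) \<Rightarrow> bool" where
  "boundary_function D p V \<rho> \<longleftrightarrow> open V \<and> p \<in> V \<and> Ck_on 1 V \<rho> \<and> sphere_grad \<rho> p \<noteq> 0 \<and>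
     D \<inter> V = {x \<in> sphere 0 1 \<inter> V. \<rho> x < 0}"

definition smooth_domain :: "'a::euclidean_space set \<Rightarrow> bool" where
  "smooth_domain D \<longleftrightarrow> D \<noteq> {} \<and> connected D \<and> openin (top_of_set (sphere 0 1)) D \<and>
     (\<forall>p \<in> closure D - D. \<exists>V \<rho>. boundary_function D p V \<rho> \<and> smooth_on V \<rho>)"

definition outward_unit_normal :: "'a::euclidean_space set \<Rightarrow> 'a \<Rightarrow> 'a \<Rightarrow> bool" where
  "outward_unit_normal D p \<nu> \<longleftrightarrow> (\<exists>V \<rho>. boundary_function D p V \<rho> \<and> \<nu> = sgn (sphere_grad \<rho> p))"

subsection \<open>Neumann eigenvalues\<close>

text \<open>
  Regularity \<open>C\<^sup>2\<close> up to the boundary is expressed by a \<open>C\<^sup>2\<close> extension to an ambient neighbourhood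
  of \<open>closure D\<close>; on a smooth domain every eigenfunction is of this kind.
\<close>

definition neumann_eigenfunction ::
    "'a::euclidean_space set \<Rightarrow> real \<Rightarrow> ('a \<Rightarrow> real) \<Rightarrow> bool" where
  "neumann_eigenfunction D \<mu> u \<longleftrightarrow>
     (\<exists>V. open V \<and> closure D \<subseteq> V \<and> Ck_on 2 V u) \<and>
     (\<exists>x\<in>D. u x \<noteq> 0) \<and>
     (\<forall>x\<in>D. - sphere_laplacian u x = \<mu> * u x) \<and>
     (\<forall>p \<in> closure D - D. \<forall>\<nu>. outward_unit_normal D p \<nu> \<longrightarrow> sphere_grad u p \<bullet> \<nu> = 0)"

definition lin_indep_on :: "'a set \<Rightarrow> nat set \<Rightarrow> (nat \<Rightarrow> 'a \<Rightarrow> real) \<Rightarrow> bool" where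
  "lin_indep_on D I u \<longleftrightarrow>
     (\<forall>c. (\<forall>x\<in>D. (\<Sum>i\<in>I. c i * u i x) = 0) \<longrightarrow> (\<forall>i\<in>I. c i = 0))"

text \<open>
  The eigenvalue with index \<open>j\<close> (counting from 0, with multiplicity) is the least \<open>\<mu>\<close> such that the
  eigenvalues \<open>\<le> \<mu>\<close> have total multiplicity at least \<open>j + 1\<close>. The type \<open>ereal\<close> makes this a total
  function; the value is finite whenever \<open>j + 1\<close> eigenvalues exist, as they do on a smooth domain.
  See \<open>neumann_eigenvalue_eq\<close> for the agreement with an enumeration of the eigenvalues.
\<close>

definition neumann_eigenvalue :: "'a::euclidean_space set \<Rightarrow> nat \<Rightarrow> ereal" where
  "neumann_eigenvalue D j = Inf (ereal ` {\<mu>. \<exists>m u.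
     (\<forall>i\<le>j. m i \<le> \<mu> \<and> neumann_eigenfunction D (m i) (u i)) \<and> lin_indep_on D {..j} u})"

text \<open>\<open>\<Lambda>\<close> lists the eigenvalues in increasing order, each as often as its multiplicity.\<close>

definition neumann_spectrum :: "'a::euclidean_space set \<Rightarrow> (nat \<Rightarrow> real) \<Rightarrow> bool" where
  "neumann_spectrum D \<Lambda> \<longleftrightarrow> mono \<Lambda> \<and> (\<exists>u.
     (\<forall>i. neumann_eigenfunction D (\<Lambda> i) (u i)) \<and>
     (\<forall>n. lin_indep_on D {..n} u) \<and>
     (\<forall>\<mu> w. neumann_eigenfunction D \<mu> w \<longrightarrow>
        (\<exists>I c. finite I \<and> I \<subseteq> {i. \<Lambda> i = \<mu>} \<and> (\<forall>x\<in>D. w x = (\<Sum>i\<in>I. c i * u i x)))))"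

lemma homogeneous_system_nontrivial:
  fixes a :: "nat \<Rightarrow> nat \<Rightarrow> real"
  shows "\<exists>c. (\<exists>i\<le>j. c i \<noteq> 0) \<and> (\<forall>k<j. (\<Sum>i\<le>j. c i * a i k) = 0)"
proof (induction j arbitrary: a)
  case 0
  show ?case by (rule exI[of _ "\<lambda>_. 1"]) simp
next
  case (Suc j)
  show ?case
  proof (cases "\<exists>p\<le>Suc j. a p j \<noteq> 0")
    case False
    obtain c where c: "\<exists>i\<le>j. c i \<noteq> 0" "\<forall>k<j. (\<Sum>i\<le>j. c i * a i k) = 0"
      using Suc.IH[of a] by blast
    define d where "d = (\<lambda>i. if i \<le> j then c i else 0)"
    have "(\<Sum>i\<le>Suc j. d i * a i k) = (\<Sum>i\<le>j. c i * a i k)" for k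
      by (simp add: d_def)
    moreover have "(\<Sum>i\<le>Suc j. d i * a i j) = 0"
      using False by (intro sum.neutral) auto
    moreover have "\<exists>i\<le>Suc j. d i \<noteq> 0"
      using c(1) by (auto simp: d_def intro: le_SucI)
    ultimately show ?thesis
      using c(2) by (intro exI[of _ d]) (auto simp: less_Suc_eq)
  next
    case True
    then obtain p where p: "p \<le> Suc j" "a p j \<noteq> 0" by blast
    define s where "s = (\<lambda>i. if i < p then i else Suc i)"
    have inj: "inj_on s {..j}" by (auto simp: inj_on_def s_def split: if_splits)
    have img: "s ` {..j} = {..Suc j} - {p}"
    proof
      show "{..Suc j} - {p} \<subseteq> s ` {..j}"
      proof
        fix x assume x: "x \<in> {..Suc j} - {p}"
        show "x \<in> s ` {..j}"
          by (rule image_eqI[of _ _ "if x < p then x else x - 1"])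
            (use x p in \<open>auto simp: s_def\<close>)
      qed
    qed (use p in \<open>auto simp: s_def\<close>)
    define b where "b = (\<lambda>i k. a (s i) k - a (s i) j / a p j * a p k)"
    obtain c where c: "\<exists>i\<le>j. c i \<noteq> 0" "\<forall>k<j. (\<Sum>i\<le>j. c i * b i k) = 0"
      using Suc.IH[of b] by blast
    define g where "g = the_inv_into {..j} s"
    have g: "g (s i) = i" if "i \<le> j" for i
      using that inj by (simp add: g_def the_inv_into_f_f)
    define d where "d = (\<lambda>i. if i = p then - (\<Sum>l\<le>j. c l * (a (s l) j / a p j)) else c (g i))"
    have sp: "s i \<noteq> p" for i by (auto simp: s_def)
    have eq: "(\<Sum>i\<le>Suc j. d i * a i k) = (\<Sum>i\<le>j. c i * b i k)" for k
    proof -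
      have "(\<Sum>i\<le>Suc j. d i * a i k) = d p * a p k + (\<Sum>i\<in>{..Suc j} - {p}. d i * a i k)"
        using p by (intro sum.remove) auto
      also have "(\<Sum>i\<in>{..Suc j} - {p}. d i * a i k) = (\<Sum>i\<le>j. d (s i) * a (s i) k)"
        unfolding img[symmetric] using inj by (simp add: sum.reindex)
      also have "\<dots> = (\<Sum>i\<le>j. c i * a (s i) k)"
        using sp g by (intro sum.cong) (auto simp: d_def)
      also have "d p * a p k + \<dots> = (\<Sum>i\<le>j. c i * b i k)"
        unfolding b_def right_diff_distrib sum_subtractf
        by (simp add: d_def sum_distrib_right mult.assoc)
      finally show ?thesis .
    qed
    have "(\<Sum>i\<le>Suc j. d i * a i k) = 0" if "k < Suc j" for k
      using that c(2) p(2) unfolding eq by (cases "k = j") (auto simp: b_def)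
    moreover obtain i where "i \<le> j" "c i \<noteq> 0" using c(1) by blast
    then have "d (s i) \<noteq> 0" "s i \<le> Suc j" using sp g by (auto simp: d_def s_def)
    ultimately show ?thesis by blast
  qed
qed

lemma neumann_eigenvalue_eq:
  assumes "neumann_spectrum D \<Lambda>"
  shows "neumann_eigenvalue D j = ereal (\<Lambda> j)"
proof -
  obtain u where mono: "mono \<Lambda>"
    and ev: "\<And>i. neumann_eigenfunction D (\<Lambda> i) (u i)"
    and ind: "\<And>n. lin_indep_on D {..n} u"
    and span: "\<And>\<mu> w. neumann_eigenfunction D \<mu> w \<Longrightarrow>
        \<exists>I c. finite I \<and> I \<subseteq> {i. \<Lambda> i = \<mu>} \<and> (\<forall>x\<in>D. w x = (\<Sum>i\<in>I. c i * u i x))"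
    using assms unfolding neumann_spectrum_def by blast
  have "\<Lambda> j \<le> \<mu>" if m: "\<forall>i\<le>j. m i \<le> \<mu> \<and> neumann_eigenfunction D (m i) (w i)"
    and indw: "lin_indep_on D {..j} w" for \<mu> m w
  proof (rule ccontr)
    assume "\<not> \<Lambda> j \<le> \<mu>"
    then have lt: "i < j" if "\<Lambda> i \<le> \<mu>" for i
      using that monoD[OF mono, of j i] by (cases "i < j") auto
    have "\<forall>i. \<exists>a. i \<le> j \<longrightarrow> (\<forall>x\<in>D. w i x = (\<Sum>k<j. a k * u k x))"
    proof
      fix i
      show "\<exists>a. i \<le> j \<longrightarrow> (\<forall>x\<in>D. w i x = (\<Sum>k<j. a k * u k x))"
      proof (cases "i \<le> j")
        case True
        then have w: "neumann_eigenfunction D (m i) (w i)" and mi: "m i \<le> \<mu>" using m by auto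
        from span[OF w] obtain I c where I: "finite I" "I \<subseteq> {k. \<Lambda> k = m i}"
          and c: "\<forall>x\<in>D. w i x = (\<Sum>k\<in>I. c k * u k x)"
          by blast
        have "I \<subseteq> {..<j}" using I lt mi by auto
        then have "(\<Sum>k<j. (if k \<in> I then c k else 0) * u k x) = (\<Sum>k\<in>I. c k * u k x)" for x
          by (intro sum.mono_neutral_cong_right) auto
        then show ?thesis using c by (intro exI[of _ "\<lambda>k. if k \<in> I then c k else 0"]) simp
      qed auto
    qed
    then obtain a where a: "\<And>i x. i \<le> j \<Longrightarrow> x \<in> D \<Longrightarrow> w i x = (\<Sum>k<j. a i k * u k x)"
      by metis
    obtain c where c: "\<exists>i\<le>j. c i \<noteq> 0" "\<forall>k<j. (\<Sum>i\<le>j. c i * a i k) = 0"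
      using homogeneous_system_nontrivial[of j a] by blast
    have "(\<Sum>i\<le>j. c i * w i x) = 0" if "x \<in> D" for x
    proof -
      have "(\<Sum>i\<le>j. c i * w i x) = (\<Sum>i\<le>j. \<Sum>k<j. c i * a i k * u k x)"
        using a that by (intro sum.cong) (auto simp: sum_distrib_left mult.assoc)
      also have "\<dots> = (\<Sum>k<j. (\<Sum>i\<le>j. c i * a i k) * u k x)"
        by (subst sum.swap) (simp add: sum_distrib_right)
      also have "\<dots> = 0" using c(2) by simp
      finally show ?thesis .
    qed
    then have "\<forall>i\<le>j. c i = 0"
      using indw unfolding lin_indep_on_def by auto
    then show False using c(1) by blast
  qed
  moreover have "\<Lambda> j \<in> {\<mu>. \<exists>m u. (\<forall>i\<le>j. m i \<le> \<mu> \<and> neumann_eigenfunction D (m i) (u i)) \<and>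
      lin_indep_on D {..j} u}"
    using ev monoD[OF mono, of _ j] ind[of j]
    by (intro CollectI exI[of _ \<Lambda>] exI[of _ u]) simp
  ultimately show ?thesis
    unfolding neumann_eigenvalue_def
    by (intro antisym[OF Inf_lower Inf_greatest] imageI) auto
qed

subsection \<open>The radial dilation in geodesic polar coordinates\<close>

text \<open>The pole is a unit vector \<open>e\<close>; the directions \<open>\<omega>\<close> are the unit vectors orthogonal to \<open>e\<close>.\<close>

definition geodesic_polar :: "'a::euclidean_space \<Rightarrow> real \<Rightarrow> 'a \<Rightarrow> 'a" where
  "geodesic_polar e r \<omega> = cos r *\<^sub>R e + sin r *\<^sub>R \<omega>"

definition polar_dilation :: "'a::euclidean_space \<Rightarrow> real \<Rightarrow> 'a \<Rightarrow> 'a" where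
  "polar_dilation e \<alpha> x =
     geodesic_polar e (\<alpha> * arccos (x \<bullet> e)) (sgn (x - (x \<bullet> e) *\<^sub>R e))"

lemma polar_dilation_geodesic_polar:
  assumes e: "norm e = 1" and w: "norm \<omega> = 1" "\<omega> \<bullet> e = 0" and r: "0 \<le> r" "r < pi"
  shows "polar_dilation e \<alpha> (geodesic_polar e r \<omega>) = geodesic_polar e (\<alpha> * r) \<omega>"
proof -
  have ee: "e \<bullet> e = 1" using e by (simp add: dot_square_norm)
  have c: "geodesic_polar e r \<omega> \<bullet> e = cos r"
    using ee w by (simp add: geodesic_polar_def inner_add_left)
  have s: "geodesic_polar e r \<omega> - cos r *\<^sub>R e = sin r *\<^sub>R \<omega>"
    by (simp add: geodesic_polar_def)
  have a: "arccos (cos r) = r" using r by (simp add: arccos_cos)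
  show ?thesis
  proof (cases "r = 0")
    case True
    then show ?thesis unfolding polar_dilation_def c a s by (simp add: geodesic_polar_def)
  next
    case False
    then have "sin r > 0" using r by (intro sin_gt_zero) auto
    then have "sgn (sin r *\<^sub>R \<omega>) = \<omega>" using w by (simp add: sgn_div_norm)
    then show ?thesis unfolding polar_dilation_def c a s by simp
  qed
qed

end

theory Submission
  imports Defs
begin

text \<open>
  Blow up at the pole: for a function \<open>u\<close> on the sphere, \<open>y \<mapsto> u (sgn (e + a y))\<close> is a function on a
  Euclidean domain that tends, as \<open>a \<rightarrow> 0\<close>, to the cylinder over \<open>D\<close> in normal coordinates, and an
  eigenfunction with eigenvalue \<open>\<mu>\<close> becomes a function with Neumann data zero and Laplacian
  \<open>O(a\<^sup>2 \<mu>)\<close>. The maximum principle then does the work of a Poincare inequality. By a Harnack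
  inequality in the interior and a Hopf lemma at the boundary, both uniform in \<open>a\<close>, an almost harmonic
  nonnegative function with Neumann data zero that vanishes somewhere is small everywhere. If \<open>u\<close>
  with \<open>max \<bar>u\<bar> = u x = 1\<close> had a zero, this would apply to \<open>1 - u\<close> and to \<open>u - min u\<close>, although their sum is
  at least 1. So for small \<open>a\<close> eigenfunctions with bounded eigenvalue have no zero; then the
  eigenvalue is 0, because otherwise the minimum of \<open>\<bar>u\<bar>\<close> violates the strong maximum principle.
  Two linearly independent eigenfunctions with bounded eigenvalues would thus have a nontrivial
  combination that vanishes at a point, which is impossible.
\<close>


subsection \<open>Calculus of \<open>C\<^sup>k\<close> functions\<close>

text \<open>Eigenvalues are given here by classical eigenfunctions, regular up to the boundary, and
  not by Rayleigh quotients; comparison functions can therefore be applied to the eigenfunctions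
  directly. The obstacle is uniformity: each constant has to survive \<open>a\<close> tending to 0
  although the domain moves with \<open>a\<close>. For this reason the geometry is put into maps of
  the pair \<open>(y, a)\<close> that are smooth across \<open>a = 0\<close>. A strict bound at a
  point of the limit then holds for nearby points and small \<open>a\<close>, and compactness of the
  closed slice of the limit cylinder leaves finitely many such bounds. Normal coordinates have to be
  smooth at the pole as well, which is why the trigonometric functions enter as power series in the
  squared radius. Extending functions constantly along rays turns the blown-up domain into a cone,
  and the eigenvalue equation acquires the factor \<open>(a / |e + a y|)^2\<close>. This is small
  away from the vertex only, so the Laplacian is controlled just where
  \<open>1 / 2 < 1 + a * (y \<bullet> e)\<close>. Nothing is lost: a zero of the function on the
  sphere has a representative near the slice \<open>y \<bullet> e = 0\<close>.\<close>

lemma Ck_on_Suc_D: "Ck_on (Suc k) S f \<Longrightarrow> Ck_on k S f"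
proof (induction k arbitrary: f)
  case 0
  then show ?case
    by (simp add: continuous_at_imp_continuous_on differentiable_imp_continuous_within)
next
  case (Suc k)
  then show ?case by (metis Ck_on.simps(2))
qed

lemma Ck_on_imp_continuous_on: "Ck_on k S f \<Longrightarrow> continuous_on S f"
proof (induction k)
  case (Suc k)
  then show ?case using Ck_on_Suc_D by blast
qed simp

lemma Ck_on_le: "Ck_on m S f \<Longrightarrow> k \<le> m \<Longrightarrow> Ck_on k S f"
proof (induction m)
  case (Suc m)
  then show ?case using Ck_on_Suc_D le_Suc_eq by blast
qed simp

lemma Ck_on_subset: "Ck_on k S f \<Longrightarrow> T \<subseteq> S \<Longrightarrow> Ck_on k T f"
  by (induction k arbitrary: f) (auto intro: continuous_on_subset)

lemma frechet_derivative_cong_open: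
  assumes "open S" "x \<in> S" "\<And>y. y \<in> S \<Longrightarrow> f y = g y"
  shows "frechet_derivative f (at x) = frechet_derivative g (at x)"
proof -
  have "(f has_derivative D) (at x) \<longleftrightarrow> (g has_derivative D) (at x)" for D
    using has_derivative_transform_within_open[OF _ assms(1,2)] assms(3) by metis
  then show ?thesis by (simp add: frechet_derivative_def)
qed

lemma Ck_on_cong:
  assumes "open S" "\<And>y. y \<in> S \<Longrightarrow> f y = g y" "Ck_on k S f"
  shows "Ck_on k S g"
  using assms(2,3)
proof (induction k arbitrary: f g)
  case 0
  then show ?case using continuous_on_cong by fastforce
next
  case (Suc k)
  have "g differentiable at x" if "x \<in> S" for x
    using Suc.prems that assms(1) unfolding differentiable_def
    by (metis Ck_on.simps(2) differentiable_def has_derivative_transform_within_open)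
  moreover have "Ck_on k S (\<lambda>x. frechet_derivative g (at x) v)" for v
  proof (rule Suc.IH)
    show "Ck_on k S (\<lambda>x. frechet_derivative f (at x) v)" using Suc.prems by simp
    show "frechet_derivative f (at x) v = frechet_derivative g (at x) v" if "x \<in> S" for x
      using frechet_derivative_cong_open[OF assms(1) that Suc.prems(1)] by simp
  qed
  ultimately show ?case by simp
qed

text \<open>\<open>Ck_on\<close> refers to \<open>frechet_derivative\<close>; on an open set
  uniqueness of derivatives lets any explicit formula take its place.\<close>

lemma Ck_on_Suc_I:
  assumes "open S" "\<And>x. x \<in> S \<Longrightarrow> (f has_derivative f' x) (at x)"
    "\<And>v. Ck_on k S (\<lambda>x. f' x v)"
  shows "Ck_on (Suc k) S f"
proof -
  have "frechet_derivative f (at x) = f' x" if "x \<in> S" for x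
    using assms(2)[OF that] frechet_derivative_at by metis
  then show ?thesis
    using assms by (auto simp: differentiable_def intro: Ck_on_cong[of S "\<lambda>x. f' x _"])
qed

lemma Ck_on_const [simp]: "Ck_on k S (\<lambda>x. c)"
proof (induction k arbitrary: c)
  case (Suc k)
  then show ?case by (simp add: frechet_derivative_const)
qed simp

lemma Ck_on_bounded_linear: "bounded_linear f \<Longrightarrow> Ck_on k S f"
proof (induction k)
  case 0
  then show ?case by (simp add: linear_continuous_on)
next
  case (Suc k)
  have "frechet_derivative f (at x) = f" for x
    using bounded_linear_imp_has_derivative[OF Suc.prems] frechet_derivative_at by metis
  then show ?case
    using bounded_linear_imp_differentiable[OF Suc.prems] by simp
qed

lemma Ck_on_has_derivative:
  "Ck_on (Suc k) S f \<Longrightarrow> x \<in> S \<Longrightarrow> (f has_derivative frechet_derivative f (at x)) (at x)"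
  by (simp add: frechet_derivative_works)

lemma Ck_on_deriv: "Ck_on (Suc k) S f \<Longrightarrow> Ck_on k S (\<lambda>x. frechet_derivative f (at x) v)"
  by simp

lemma Ck_on_add:
  assumes "open S" "Ck_on k S f" "Ck_on k S g"
  shows "Ck_on k S (\<lambda>x. f x + g x)"
  using assms(2,3)
proof (induction k arbitrary: f g)
  case 0
  then show ?case by (simp add: continuous_on_add)
next
  case (Suc k)
  show ?case
  proof (rule Ck_on_Suc_I[OF assms(1)])
    fix x assume "x \<in> S"
    then show "((\<lambda>x. f x + g x) has_derivative
      (\<lambda>v. frechet_derivative f (at x) v + frechet_derivative g (at x) v)) (at x)"
      using Suc.prems Ck_on_has_derivative by (intro has_derivative_add) blast+
  next
    show "Ck_on k S (\<lambda>x. frechet_derivative f (at x) v + frechet_derivative g (at x) v)" for v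
      using Suc by simp
  qed
qed

lemma Ck_on_sum:
  assumes "open S" "\<And>i. i \<in> I \<Longrightarrow> Ck_on k S (f i)"
  shows "Ck_on k S (\<lambda>x. \<Sum>i\<in>I. f i x)"
proof (cases "finite I")
  case True
  then show ?thesis using assms(2)
    by (induction I rule: finite_induct) (auto intro: Ck_on_add[OF assms(1)])
qed simp

text \<open>The product rule returns products of the same kind, so one induction serves scalar
  multiples, products and inner products.\<close>

lemma Ck_on_bilinear:
  fixes prod :: "'a::real_normed_vector \<Rightarrow> 'b::real_normed_vector \<Rightarrow> 'c::real_normed_vector"
  assumes P: "bounded_bilinear prod" and S: "open S" and "Ck_on k S f" "Ck_on k S g"
  shows "Ck_on k S (\<lambda>x. prod (f x) (g x))"
  using assms(3,4)
proof (induction k arbitrary: f g)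
  case 0
  then show ?case using bounded_bilinear.continuous_on[OF P] by simp
next
  case (Suc k)
  show ?case
  proof (rule Ck_on_Suc_I[OF S])
    fix x assume x: "x \<in> S"
    show "((\<lambda>x. prod (f x) (g x)) has_derivative
      (\<lambda>v. prod (f x) (frechet_derivative g (at x) v) + prod (frechet_derivative f (at x) v) (g x))) (at x)"
      by (rule bounded_bilinear.FDERIV[OF P Ck_on_has_derivative[OF Suc.prems(1) x]
            Ck_on_has_derivative[OF Suc.prems(2) x]])
  next
    have "Ck_on k S f" "Ck_on k S g" using Suc.prems Ck_on_Suc_D by blast+
    then show "Ck_on k S (\<lambda>x. prod (f x) (frechet_derivative g (at x) v) +
        prod (frechet_derivative f (at x) v) (g x))" for v
      using Suc by (intro Ck_on_add[OF S] Suc.IH) auto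
  qed
qed

lemmas Ck_on_scaleR = Ck_on_bilinear[OF bounded_bilinear_scaleR]
  and Ck_on_mult = Ck_on_bilinear[OF bounded_bilinear_mult]
  and Ck_on_inner = Ck_on_bilinear[OF bounded_bilinear_inner]

lemma Ck_on_minus: "open S \<Longrightarrow> Ck_on k S f \<Longrightarrow> Ck_on k S (\<lambda>x. - f x)"
  using Ck_on_scaleR[of S k "\<lambda>_. -1" f] by simp

lemma Ck_on_diff: "open S \<Longrightarrow> Ck_on k S f \<Longrightarrow> Ck_on k S g \<Longrightarrow> Ck_on k S (\<lambda>x. f x - g x)"
  using Ck_on_add[of S k f "\<lambda>x. - g x"] Ck_on_minus by fastforce

lemma Ck_on_id: "Ck_on k S (\<lambda>x. x)"
  by (simp add: Ck_on_bounded_linear bounded_linear_ident)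

lemma Ck_on_compose:
  fixes g :: "'a::real_normed_vector \<Rightarrow> 'b::euclidean_space"
    and f :: "'b \<Rightarrow> 'c::real_normed_vector"
  assumes S: "open S" and "Ck_on k T f" "Ck_on k S g" "\<And>x. x \<in> S \<Longrightarrow> g x \<in> T"
  shows "Ck_on k S (\<lambda>x. f (g x))"
  using assms(2,3)
proof (induction k arbitrary: f)
  case 0
  then show ?case using assms(4) by (auto intro: continuous_on_compose2)
next
  case (Suc k)
  \<comment> \<open>The chain rule is expanded in a basis of the middle space. Only derivatives of
    \<open>f\<close> in fixed directions remain, and the induction hypothesis covers those.\<close>
  define h where "h x v = (\<Sum>b\<in>Basis. (frechet_derivative g (at x) v \<bullet> b) *\<^sub>R frechet_derivative f (at (g x)) b)"
    for x v
  show ?case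
  proof (rule Ck_on_Suc_I[OF S])
    fix x assume x: "x \<in> S"
    have f: "(f has_derivative frechet_derivative f (at (g x))) (at (g x))"
      using Suc.prems x assms(4) Ck_on_has_derivative by blast
    have "h x v = frechet_derivative f (at (g x)) (frechet_derivative g (at x) v)" for v
      unfolding h_def
      using has_derivative_linear[OF f]
      by (subst (2) euclidean_representation[symmetric]) (simp add: linear_sum linear_scale)
    moreover have "((\<lambda>x. f (g x)) has_derivative
        (\<lambda>v. frechet_derivative f (at (g x)) (frechet_derivative g (at x) v))) (at x)"
      using f Suc.prems x Ck_on_has_derivative has_derivative_compose by blast
    ultimately show "((\<lambda>x. f (g x)) has_derivative h x) (at x)" by presburger
  next
    show "Ck_on k S (\<lambda>x. h x v)" for v
      unfolding h_def
    proof (intro Ck_on_sum[OF S] Ck_on_scaleR[OF S])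
      fix b :: 'b assume "b \<in> Basis"
      show "Ck_on k S (\<lambda>x. frechet_derivative g (at x) v \<bullet> b)"
        using Suc.prems by (intro Ck_on_inner[OF S]) auto
      show "Ck_on k S (\<lambda>x. frechet_derivative f (at (g x)) b)"
        using Suc.prems Ck_on_Suc_D[of k S g] by (intro Suc.IH) auto
    qed
  qed
qed

lemma Ck_on_real_Suc_I:
  fixes f :: "real \<Rightarrow> real"
  assumes S: "open S" and "\<And>x. x \<in> S \<Longrightarrow> (f has_real_derivative f' x) (at x)" "Ck_on k S f'"
  shows "Ck_on (Suc k) S f"
proof (rule Ck_on_Suc_I[OF S])
  show "(f has_derivative (\<lambda>v. f' x * v)) (at x)" if "x \<in> S" for x
    using assms(2)[OF that] by (simp add: has_field_derivative_def)
  show "Ck_on k S (\<lambda>x. f' x * v)" for v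
    using assms(3) by (intro Ck_on_mult[OF S]) auto
qed

text \<open>The derivative is a polynomial in the function itself, which closes the
  induction.\<close>

lemma Ck_on_inverse_real: "Ck_on k {x. x \<noteq> 0} (inverse :: real \<Rightarrow> real)"
proof (induction k)
  case 0
  then show ?case by (auto intro: continuous_on_inverse)
next
  case (Suc k)
  have S: "open {x::real. x \<noteq> 0}" by (simp add: open_Collect_neq)
  show ?case
  proof (rule Ck_on_real_Suc_I[OF S])
    show "(inverse has_real_derivative - (inverse x * inverse x)) (at x)" if "x \<in> {x. x \<noteq> 0}" for x :: real
      using that DERIV_inverse[of x UNIV] by (simp add: power2_eq_square)
    show "Ck_on k {x. x \<noteq> 0} (\<lambda>x::real. - (inverse x * inverse x))"
      using Suc by (intro Ck_on_minus[OF S] Ck_on_mult[OF S])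
  qed
qed

lemma Ck_on_sqrt: "Ck_on k {0<..} sqrt"
proof (induction k)
  case 0
  then show ?case by (simp add: continuous_on_real_sqrt)
next
  case (Suc k)
  show ?case
  proof (rule Ck_on_real_Suc_I)
    show "(sqrt has_real_derivative inverse (sqrt x) / 2) (at x)" if "x \<in> {0<..}" for x :: real
      using that DERIV_real_sqrt[of x] by simp
    have "Ck_on k {0<..} (\<lambda>x. inverse (sqrt x) * (1/2))"
      by (intro Ck_on_mult Ck_on_compose[OF _ Ck_on_inverse_real Suc]) auto
    then show "Ck_on k {0<..} (\<lambda>x. inverse (sqrt x) / 2)" by simp
  qed simp
qed

lemma Ck_on_inverse:
  "open S \<Longrightarrow> Ck_on k S f \<Longrightarrow> (\<And>x. x \<in> S \<Longrightarrow> f x \<noteq> 0) \<Longrightarrow> Ck_on k S (\<lambda>x. inverse (f x :: real))"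
  by (rule Ck_on_compose[OF _ Ck_on_inverse_real]) auto

lemma Ck_on_sgn: "Ck_on k (- {0}) (sgn :: 'a::euclidean_space \<Rightarrow> 'a)"
proof -
  have S: "open (- {0::'a})" by (simp add: open_Compl)
  have "Ck_on k (- {0}) (\<lambda>x::'a. inverse (sqrt (x \<bullet> x)) *\<^sub>R x)"
    by (intro Ck_on_scaleR Ck_on_id Ck_on_inverse Ck_on_compose[OF S Ck_on_sqrt] Ck_on_inner S) auto
  moreover have "sgn = (\<lambda>x::'a. inverse (sqrt (x \<bullet> x)) *\<^sub>R x)"
    by (auto simp: sgn_div_norm norm_eq_sqrt_inner)
  ultimately show ?thesis by simp
qed

text \<open>Expressing the derivative in \<open>y\<close> by the joint derivative in direction
  \<open>(v, 0)\<close> shows that it depends continuously on the parameter too. All uniformity in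
  \<open>a\<close> rests on this.\<close>

lemma Ck_on_grad_slice:
  assumes "Ck_on (Suc k) S F" "(x, a) \<in> S"
  shows "((\<lambda>y. F (y, a)) has_derivative (\<lambda>v. frechet_derivative F (at (x, a)) (v, 0))) (at x)"
proof -
  have "((\<lambda>y. (y, a)) has_derivative (\<lambda>v. (v, 0))) (at x)"
    by (intro derivative_eq_intros) auto
  from has_derivative_compose[OF this, of F "frechet_derivative F (at (x, a))"] show ?thesis
    using Ck_on_has_derivative[OF assms] by simp
qed


subsection \<open>Geodesic normal coordinates at the pole\<close>

text \<open>The differentiated series converges on the same disc, so the induction runs over all
  coefficient sequences. The disc is chosen pointwise to treat finite and infinite radius
  alike.\<close>

lemma Ck_on_power_series:
  fixes c :: "nat \<Rightarrow> real"
  assumes "open S" "\<And>x. x \<in> S \<Longrightarrow> \<exists>K>\<bar>x\<bar>. \<forall>y. \<bar>y\<bar> < K \<longrightarrow> summable (\<lambda>n. c n * y ^ n)"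
  shows "Ck_on k S (\<lambda>x. \<Sum>n. c n * x ^ n)"
proof -
  have d: "((\<lambda>x. \<Sum>n. c n * x ^ n) has_real_derivative (\<Sum>n. diffs c n * x ^ n)) (at x)"
    if x: "x \<in> S" and H: "\<And>x. x \<in> S \<Longrightarrow> \<exists>K>\<bar>x\<bar>. \<forall>y. \<bar>y\<bar> < K \<longrightarrow> summable (\<lambda>n. c n * y ^ n)"
    for c :: "nat \<Rightarrow> real" and x
  proof -
    obtain K where "K > \<bar>x\<bar>" "\<forall>y. \<bar>y\<bar> < K \<longrightarrow> summable (\<lambda>n. c n * y ^ n)"
      using H[OF x] by blast
    then show ?thesis using termdiffs_strong'[of K c x] by simp
  qed
  show ?thesis using assms(2)
  proof (induction k arbitrary: c)
    case 0
    then show ?case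
      using d[of _ c] by (force intro: continuous_at_imp_continuous_on DERIV_isCont)
  next
    case (Suc k)
    have "\<exists>K>\<bar>x\<bar>. \<forall>y. \<bar>y\<bar> < K \<longrightarrow> summable (\<lambda>n. diffs c n * y ^ n)" if "x \<in> S" for x
    proof -
      obtain K where K: "K > \<bar>x\<bar>" "\<forall>y. \<bar>y\<bar> < K \<longrightarrow> summable (\<lambda>n. c n * y ^ n)"
        using Suc.prems[OF \<open>x \<in> S\<close>] by blast
      then show ?thesis
        using termdiff_converges[of _ K c] by (intro exI[of _ K]) auto
    qed
    then show ?case
      using d[of _ c] Suc by (intro Ck_on_real_Suc_I[OF assms(1)]) auto
  qed
qed

text \<open>\<open>cos_root t = cos (sqrt t)\<close>, \<open>sinc_root t = sin (sqrt t) / sqrt t\<close> and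
  \<open>atan_root t = arctan (sqrt t) / sqrt t\<close>, smooth across \<open>t = 0\<close>; the last one is used for
  \<open>\<bar>t\<bar> < 1\<close> only.\<close>

definition cos_root :: "real \<Rightarrow> real" where
  "cos_root t = (\<Sum>n. (-1) ^ n / fact (2 * n) * t ^ n)"

definition sinc_root :: "real \<Rightarrow> real" where
  "sinc_root t = (\<Sum>n. (-1) ^ n / fact (2 * n + 1) * t ^ n)"

definition atan_root :: "real \<Rightarrow> real" where
  "atan_root t = (\<Sum>n. (-1) ^ n / real (2 * n + 1) * t ^ n)"

lemma summable_fact_power:
  assumes "\<And>n. n \<le> g n"
  shows "summable (\<lambda>n. (-1) ^ n / fact (g n) * (t::real) ^ n)"
proof (rule summable_comparison_test')
  show "summable (\<lambda>n. inverse (fact n) * \<bar>t\<bar> ^ n)" by (rule summable_exp)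
  show "norm ((-1) ^ n / fact (g n) * t ^ n) \<le> inverse (fact n) * \<bar>t\<bar> ^ n" if "n \<ge> 0" for n
    using assms[of n] fact_mono[of n "g n", where 'a = real]
    by (simp add: abs_mult power_abs divide_simps mult_left_mono)
qed

lemma summable_atan_root:
  assumes "\<bar>t\<bar> < 1"
  shows "summable (\<lambda>n. (-1) ^ n / real (2 * n + 1) * (t::real) ^ n)"
proof (rule summable_comparison_test')
  show "summable (\<lambda>n. \<bar>t\<bar> ^ n)" using assms by (simp add: summable_geometric)
  show "norm ((-1) ^ n / real (2 * n + 1) * t ^ n) \<le> \<bar>t\<bar> ^ n" if "n \<ge> 0" for n
  proof -
    have "\<bar>t\<bar> ^ n * 1 \<le> \<bar>t\<bar> ^ n * (1 + 2 * real n)" by (intro mult_left_mono) auto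
    then show ?thesis by (simp add: abs_mult power_abs divide_simps)
  qed
qed

lemma Ck_on_cos_root: "Ck_on k UNIV cos_root"
  unfolding cos_root_def[abs_def]
proof (rule Ck_on_power_series)
  show "\<exists>K>\<bar>x\<bar>. \<forall>y. \<bar>y\<bar> < K \<longrightarrow> summable (\<lambda>n. (-1) ^ n / fact (2 * n) * y ^ n)" for x :: real
    using summable_fact_power[of "\<lambda>n. 2 * n"] by (intro exI[of _ "\<bar>x\<bar> + 1"]) auto
qed simp

lemma Ck_on_sinc_root: "Ck_on k UNIV sinc_root"
  unfolding sinc_root_def[abs_def]
proof (rule Ck_on_power_series)
  show "\<exists>K>\<bar>x\<bar>. \<forall>y. \<bar>y\<bar> < K \<longrightarrow> summable (\<lambda>n. (-1) ^ n / fact (2 * n + 1) * y ^ n)" for x :: real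
    using summable_fact_power[of "\<lambda>n. 2 * n + 1"] by (intro exI[of _ "\<bar>x\<bar> + 1"]) auto
qed simp

lemma Ck_on_atan_root: "Ck_on k {-1<..<1} atan_root"
  unfolding atan_root_def[abs_def]
  by (intro Ck_on_power_series)
    (auto intro!: exI[of _ "1::real"] summable_atan_root[simplified] simp: abs_less_iff)

lemma cos_root_square: "cos_root (x\<^sup>2) = cos x"
  using sums_unique[OF cos_paired[of x]] by (simp add: cos_root_def power_mult)

lemma sinc_root_square: "x * sinc_root (x\<^sup>2) = sin x"
proof -
  have "x * sinc_root (x\<^sup>2) = (\<Sum>n. x * ((-1) ^ n / fact (2 * n + 1) * (x\<^sup>2) ^ n))"
    unfolding sinc_root_def
    by (rule suminf_mult[symmetric]) (rule summable_fact_power, simp)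
  also have "\<dots> = sin x"
    using sums_unique[OF sin_paired[of x]] by (simp flip: power_mult add: mult_ac)
  finally show ?thesis .
qed

lemma atan_root_square:
  assumes "\<bar>x\<bar> < 1"
  shows "x * atan_root (x\<^sup>2) = arctan x"
proof -
  have "\<bar>x\<^sup>2\<bar> < 1" using assms by (simp add: abs_square_less_1)
  then have "x * atan_root (x\<^sup>2) = (\<Sum>n. x * ((-1) ^ n / real (2 * n + 1) * (x\<^sup>2) ^ n))"
    unfolding atan_root_def by (intro suminf_mult[symmetric] summable_atan_root)
  also have "\<dots> = arctan x"
    using arctan_series[of x] assms by (simp flip: power_mult add: mult_ac)
  finally show ?thesis .
qed

lemma sinc_root_0 [simp]: "sinc_root 0 = 1"
  using powser_zero[of "\<lambda>n. (-1) ^ n / fact (2 * n + 1) :: real"] by (simp add: sinc_root_def)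

lemma cos_root_0 [simp]: "cos_root 0 = 1"
  using cos_root_square[of 0] by simp

section \<open>Exponential map, its inverse, and the dilation in these coordinates\<close>

locale pole =
  fixes e :: "'a::euclidean_space"
  assumes norm_e: "norm e = 1"
begin

lemma e_e [simp]: "e \<bullet> e = 1"
  using norm_e by (simp add: dot_square_norm)

definition hproj :: "'a \<Rightarrow> 'a" where
  "hproj y = y - (y \<bullet> e) *\<^sub>R e"

text \<open>The Riemannian exponential map at the pole, on the hyperplane orthogonal to \<open>e\<close>.\<close>

definition sexp :: "'a \<Rightarrow> 'a" where
  "sexp z = cos_root (z \<bullet> z) *\<^sub>R e + sinc_root (z \<bullet> z) *\<^sub>R z"

text \<open>The inverse of \<open>sexp\<close>, extended constantly along rays, for angles below \<open>pi / 4\<close>.\<close>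

definition cone_log :: "'a \<Rightarrow> 'a" where
  "cone_log Y = (atan_root ((hproj Y \<bullet> hproj Y) / (Y \<bullet> e)\<^sup>2) / (Y \<bullet> e)) *\<^sub>R hproj Y"

text \<open>Bisecting the angle to the pole twice extends the range of \<open>cone_log\<close> to all angles
  below \<open>pi\<close>.\<close>

definition slog :: "'a \<Rightarrow> 'a" where
  "slog Y = 4 *\<^sub>R cone_log (sgn (sgn Y + e) + e)"

lemma hproj_e [simp]: "hproj y \<bullet> e = 0"
  by (simp add: hproj_def inner_diff_left)

lemma hproj_bounded_linear: "bounded_linear hproj"
  unfolding hproj_def[abs_def]
  by (intro bounded_linear_sub bounded_linear_ident bounded_linear_scaleR_const bounded_linear_inner_left)

lemma hproj_decomp: "y = (y \<bullet> e) *\<^sub>R e + hproj y"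
  by (simp add: hproj_def)

lemma hproj_add: "hproj (x + y) = hproj x + hproj y"
  by (simp add: hproj_def inner_add_left algebra_simps)

lemma hproj_scaleR: "hproj (c *\<^sub>R y) = c *\<^sub>R hproj y"
  by (simp add: hproj_def algebra_simps)

lemma hproj_pole [simp]: "hproj e = 0"
  by (simp add: hproj_def)

lemma hproj_orth: "z \<bullet> e = 0 \<Longrightarrow> hproj z = z"
  by (simp add: hproj_def)

lemma norm_decomp: "(norm y)\<^sup>2 = (y \<bullet> e)\<^sup>2 + hproj y \<bullet> hproj y"
  unfolding power2_norm_eq_inner
  by (simp add: hproj_def inner_diff_left inner_diff_right inner_commute power2_eq_square)

lemma sexp_cos_sin:
  "sexp z = cos (norm z) *\<^sub>R e + sin (norm z) *\<^sub>R sgn z"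
proof (cases "z = 0")
  case False
  have "sin (norm z) *\<^sub>R sgn z = sinc_root ((norm z)\<^sup>2) *\<^sub>R z"
    using False by (simp flip: sinc_root_square add: sgn_div_norm)
  then show ?thesis
    using cos_root_square[of "norm z"] by (simp add: sexp_def power2_norm_eq_inner)
qed (simp add: sexp_def)

lemma sexp_scaleR_sgn: "sexp (r *\<^sub>R sgn z) = cos r *\<^sub>R e + sin r *\<^sub>R sgn z" if "z \<noteq> 0"
proof -
  have "(r *\<^sub>R sgn z) \<bullet> (r *\<^sub>R sgn z) = r\<^sup>2"
    using that norm_sgn[of z] by (simp add: power2_eq_square dot_square_norm)
  then show ?thesis
    using cos_root_square[of r] sinc_root_square[of r] by (simp add: sexp_def mult.commute)
qed

lemma sexp_inner: "z \<bullet> e = 0 \<Longrightarrow> sexp z \<bullet> e = cos (norm z)"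
  by (simp add: sexp_cos_sin inner_add_left sgn_div_norm)

lemma hproj_sexp: "z \<bullet> e = 0 \<Longrightarrow> hproj (sexp z) = sinc_root (z \<bullet> z) *\<^sub>R z"
  by (simp add: sexp_def hproj_add hproj_scaleR hproj_orth)

lemma norm_sexp: "z \<bullet> e = 0 \<Longrightarrow> norm (sexp z) = 1"
proof -
  assume z: "z \<bullet> e = 0"
  have "(norm (sexp z))\<^sup>2 = (cos (norm z))\<^sup>2 + (sinc_root (z \<bullet> z))\<^sup>2 * (z \<bullet> z)"
    unfolding norm_decomp sexp_inner[OF z] hproj_sexp[OF z] by (simp add: power2_eq_square)
  also have "\<dots> = (cos (norm z))\<^sup>2 + (norm z * sinc_root ((norm z)\<^sup>2))\<^sup>2"
    unfolding power2_norm_eq_inner[symmetric] by (simp add: power_mult_distrib)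
  finally have "(norm (sexp z))\<^sup>2 = (cos (norm z))\<^sup>2 + (norm z * sinc_root ((norm z)\<^sup>2))\<^sup>2" .
  then have "(norm (sexp z))\<^sup>2 = 1" by (simp add: sinc_root_square)
  then show ?thesis by (simp add: power2_eq_1_iff) (smt (verit) norm_ge_zero)
qed

lemma cone_log_orth [simp]: "cone_log Y \<bullet> e = 0"
  by (simp add: cone_log_def)

lemma cone_log_scaleR:
  assumes "c > 0" shows "cone_log (c *\<^sub>R Y) = cone_log Y"
proof -
  have "(hproj (c *\<^sub>R Y) \<bullet> hproj (c *\<^sub>R Y)) / (c *\<^sub>R Y \<bullet> e)\<^sup>2 = (hproj Y \<bullet> hproj Y) / (Y \<bullet> e)\<^sup>2"
    using assms by (simp add: hproj_scaleR power2_eq_square)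
  then show ?thesis using assms by (simp add: cone_log_def hproj_scaleR)
qed

text \<open>The hypothesis says that the angle between \<open>Y\<close> and the pole is below
  \<open>pi / 4\<close>, i.e. its tangent is below 1, where the arctangent series represents
  \<open>arctan\<close>.\<close>

lemma norm_cone_log:
  assumes "norm (hproj Y) < Y \<bullet> e"
  shows "norm (cone_log Y) = arctan (norm (hproj Y) / (Y \<bullet> e))"
proof -
  define u where "u = norm (hproj Y) / (Y \<bullet> e)"
  have w: "Y \<bullet> e > 0" using assms norm_ge_zero by (rule le_less_trans[rotated])
  have u: "0 \<le> u" "u < 1" using assms w by (auto simp: u_def)
  have "u\<^sup>2 = (hproj Y \<bullet> hproj Y) / (Y \<bullet> e)\<^sup>2"
    by (simp add: u_def power_divide power2_norm_eq_inner)
  then have "norm (cone_log Y) = \<bar>u * atan_root (u\<^sup>2)\<bar>"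
    using w by (simp add: cone_log_def u_def abs_mult)
  then show ?thesis
    using u atan_root_square[of u] by (simp add: u_def[symmetric])
qed

text \<open>With \<open>u\<close> the tangent of the angle, \<open>norm Y\<close> is
  \<open>(Y \<bullet> e) * sqrt (1 + u\<^sup>2)\<close>; the formulas for sine and cosine of
  \<open>arctan u\<close> then reproduce the two components of \<open>sgn Y\<close>.\<close>

lemma sexp_cone_log:
  assumes "norm (hproj Y) < Y \<bullet> e"
  shows "sexp (cone_log Y) = sgn Y"
proof -
  define u where "u = norm (hproj Y) / (Y \<bullet> e)"
  have w: "Y \<bullet> e > 0" using assms norm_ge_zero by (rule le_less_trans[rotated])
  have u: "0 \<le> u" "u < 1" using assms w by (auto simp: u_def)
  have u2: "u\<^sup>2 = (hproj Y \<bullet> hproj Y) / (Y \<bullet> e)\<^sup>2"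
    by (simp add: u_def power_divide power2_norm_eq_inner)
  have n: "norm (cone_log Y) = arctan u" using norm_cone_log[OF assms] by (simp add: u_def)
  have "(norm Y)\<^sup>2 = ((Y \<bullet> e) * sqrt (1 + u\<^sup>2))\<^sup>2"
    using w by (simp add: norm_decomp power_mult_distrib u2 field_simps)
  then have Y: "norm Y = (Y \<bullet> e) * sqrt (1 + u\<^sup>2)"
    using w by (subst (asm) power2_eq_iff_nonneg) auto
  have "sin (arctan u) *\<^sub>R sgn (cone_log Y) = (1 / norm Y) *\<^sub>R hproj Y"
  proof (cases "u = 0")
    case True
    then have "hproj Y = 0" using w by (simp add: u_def)
    then show ?thesis using True by simp
  next
    case False
    have "u * atan_root (u\<^sup>2) = arctan u" using u by (intro atan_root_square) auto
    then have a: "atan_root (u\<^sup>2) = arctan u / u" using False by (simp add: field_simps)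
    have "cone_log Y = (arctan u / (u * (Y \<bullet> e))) *\<^sub>R hproj Y"
      by (simp add: cone_log_def flip: u2) (simp add: a)
    then have "sgn (cone_log Y) = (1 / (u * (Y \<bullet> e))) *\<^sub>R hproj Y"
      using False n by (simp add: sgn_div_norm)
    then show ?thesis using False by (simp add: sin_arctan Y)
  qed
  moreover have "cos (arctan u) = (Y \<bullet> e) / norm Y"
    using w by (simp add: cos_arctan Y)
  ultimately have "sexp (cone_log Y) = (1 / norm Y) *\<^sub>R ((Y \<bullet> e) *\<^sub>R e + hproj Y)"
    by (simp add: sexp_cos_sin n algebra_simps)
  then show ?thesis using hproj_decomp[of Y] by (simp add: sgn_div_norm divide_inverse_commute)
qed

lemma sinc_root_pos: "0 \<le> r \<Longrightarrow> r < pi \<Longrightarrow> sinc_root (r\<^sup>2) > 0"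
  using sinc_root_square[of r] sin_gt_zero[of r]
  by (cases "r = 0") (auto simp: zero_less_mult_iff dest: sym)

text \<open>Away from the pole the scalar factors are \<open>sin r / r\<close> and
  \<open>r / tan r\<close>, divided by \<open>cos r\<close>; their product is 1.\<close>

lemma cone_log_sexp:
  assumes "z \<bullet> e = 0" "norm z < pi / 4"
  shows "cone_log (sexp z) = z" and "norm (hproj (sexp z)) < sexp z \<bullet> e"
proof -
  define r where "r = norm z"
  have r: "0 \<le> r" "r < pi / 4" using assms by (auto simp: r_def)
  have rr: "z \<bullet> z = r\<^sup>2" by (simp add: r_def power2_norm_eq_inner)
  have c: "cos r > 0" using r pi_gt_zero by (intro cos_gt_zero_pi) linarith+
  have "tan r < tan (pi / 4)" using r by (intro tan_monotone) auto
  then have t: "tan r < 1" by (simp add: tan_45)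
  have s: "norm (hproj (sexp z)) = sin r"
    using sinc_root_pos[of r] r pi_gt_zero assms(1)
    by (simp add: hproj_sexp rr flip: sinc_root_square) (simp add: r_def mult.commute)
  show l: "norm (hproj (sexp z)) < sexp z \<bullet> e"
    using t c by (simp add: s sexp_inner[OF assms(1)] r_def[symmetric] tan_def)
  have "tan r \<ge> 0" using r c sin_ge_zero[of r] pi_gt_zero by (simp add: tan_def)
  have "atan_root ((tan r)\<^sup>2) * tan r = r"
    using atan_root_square[of "tan r"] t \<open>tan r \<ge> 0\<close> r arctan_tan[of r] by (simp add: mult.commute)
  moreover have "sinc_root (r\<^sup>2) * r = sin r" using sinc_root_square[of r] by (simp add: mult.commute)
  moreover have "sin r > 0" if "r \<noteq> 0" using that r pi_gt_zero by (intro sin_gt_zero) linarith+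
  ultimately have "sinc_root (r\<^sup>2) = sin r / r" "atan_root ((tan r)\<^sup>2) = r / tan r" "sin r \<noteq> 0" if "r \<noteq> 0"
    using c that by (auto simp: eq_divide_eq tan_def) (simp add: divide_eq_eq)
  then have "sinc_root (r\<^sup>2) * atan_root ((tan r)\<^sup>2) / cos r = 1" if "r \<noteq> 0"
    using c that by (simp add: tan_def)
  moreover have "(hproj (sexp z) \<bullet> hproj (sexp z)) / (sexp z \<bullet> e)\<^sup>2 = (tan r)\<^sup>2"
    by (simp flip: power2_norm_eq_inner add: s sexp_inner[OF assms(1)] r_def[symmetric] tan_def power_divide)
  then have "cone_log (sexp z) = (sinc_root (r\<^sup>2) * atan_root ((tan r)\<^sup>2) / cos r) *\<^sub>R z"
    by (simp add: cone_log_def) (simp add: sexp_inner[OF assms(1)] hproj_sexp[OF assms(1)] r_def[symmetric] rr)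
  ultimately show "cone_log (sexp z) = z"
    using r_def by (cases "r = 0") auto
qed

text \<open>The sum of two unit vectors points along the bisector of their angle, with length twice
  the cosine of half the angle.\<close>

lemma sexp_plus_pole:
  assumes "z \<bullet> e = 0"
  shows "sexp z + e = (2 * cos (norm z / 2)) *\<^sub>R sexp ((1/2) *\<^sub>R z)"
proof (cases "z = 0")
  case True
  then show ?thesis by (simp add: sexp_def scaleR_2)
next
  case False
  define r where "r = norm z"
  have z: "z = r *\<^sub>R sgn z" "(1/2) *\<^sub>R z = (r/2) *\<^sub>R sgn z" using False by (auto simp: r_def sgn_div_norm)
  have "cos r = 2 * cos (r/2) * cos (r/2) - 1" using cos_double_cos[of "r/2"] by (simp add: power2_eq_square)
  then have "(cos r + 1) *\<^sub>R e = (2 * cos (r/2) * cos (r/2)) *\<^sub>R e" by simp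
  then have e2: "cos r *\<^sub>R e + e = (2 * cos (r/2)) *\<^sub>R cos (r/2) *\<^sub>R e" by (simp add: scaleR_add_left)
  moreover have "sin r = 2 * cos (r/2) * sin (r/2)" using sin_double[of "r/2"] by simp
  ultimately show ?thesis
    unfolding z(2) sexp_scaleR_sgn[OF False] using False
    by (subst sexp_cos_sin) (simp add: r_def[symmetric] e2 scaleR_add_right add_ac)
qed

lemma sgn_sexp_plus_pole:
  assumes "z \<bullet> e = 0" "norm z < pi"
  shows "sgn (sexp z + e) = sexp ((1/2) *\<^sub>R z)"
proof -
  have "cos (norm z / 2) > 0" using assms by (intro cos_gt_zero_pi) (auto intro: less_le_trans[of _ 0])
  moreover have "norm (sexp ((1/2) *\<^sub>R z)) = 1" using assms by (intro norm_sexp) simp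
  ultimately show ?thesis
    unfolding sexp_plus_pole[OF assms(1)] by (simp add: sgn_div_norm)
qed

text \<open>Two bisections bring an angle below \<open>pi\<close> under \<open>pi / 4\<close>, the
  range of \<open>cone_log\<close>. The second claim places the point in the open set on which
  \<open>slog\<close> is smooth.\<close>

lemma slog_sexp:
  assumes "z \<bullet> e = 0" "norm z < pi"
  shows "slog (sexp z) = z"
    and "norm (hproj (sgn (sgn (sexp z) + e) + e)) < (sgn (sgn (sexp z) + e) + e) \<bullet> e"
proof -
  have s: "sgn (sexp z) = sexp z" using norm_sexp[OF assms(1)] by (simp add: sgn_div_norm)
  define v where "v = sgn (sgn (sexp z) + e) + e"
  define c where "c = 2 * cos (norm z / 4)"
  have c: "c > 0" using assms unfolding c_def
    by (intro mult_pos_pos cos_gt_zero_pi) (use norm_ge_zero[of z] pi_gt_zero in linarith)+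
  have v: "v = c *\<^sub>R sexp ((1/4) *\<^sub>R z)"
    using sexp_plus_pole[of "(1/2) *\<^sub>R z"] assms sgn_sexp_plus_pole[OF assms]
    by (simp add: v_def s c_def)
  have q: "((1/4) *\<^sub>R z) \<bullet> e = 0" "norm ((1/4) *\<^sub>R z) < pi / 4" using assms by auto
  show "slog (sexp z) = z"
    using cone_log_sexp(1)[OF q] by (simp add: slog_def flip: v_def) (simp add: v cone_log_scaleR c)
  show "norm (hproj (sgn (sgn (sexp z) + e) + e)) < (sgn (sgn (sexp z) + e) + e) \<bullet> e"
    using cone_log_sexp(2)[OF q] c by (simp flip: v_def add: v hproj_scaleR)
qed

text \<open>In normal coordinates the dilation is multiplication by \<open>a\<close>; this is the
  only access to \<open>polar_dilation\<close> in what follows.\<close>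

lemma polar_dilation_sexp:
  assumes "z \<bullet> e = 0" "norm z < pi"
  shows "polar_dilation e a (sexp z) = sexp (a *\<^sub>R z)"
proof (cases "z = 0")
  case True
  then show ?thesis by (simp add: polar_dilation_def geodesic_polar_def sexp_def)
next
  case False
  have a: "arccos (cos (norm z)) = norm z" using assms by (intro arccos_cos) auto
  have "sinc_root (z \<bullet> z) > 0" using sinc_root_pos[of "norm z"] assms by (simp add: power2_norm_eq_inner)
  then have "sgn (hproj (sexp z)) = sgn z" using assms by (simp add: hproj_sexp sgn_scaleR)
  moreover have "a *\<^sub>R z = (a * norm z) *\<^sub>R sgn z" using False by (simp add: sgn_div_norm)
  ultimately show ?thesis
    using sexp_scaleR_sgn[OF False, of "a * norm z"]
    by (simp add: polar_dilation_def sexp_inner assms a geodesic_polar_def hproj_def)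
qed

lemma sphere_eq_sexp_aux:
  assumes "norm x = 1" "x \<noteq> - e"
  obtains z where "z \<bullet> e = 0" "norm z < pi" "x = sexp z"
proof
  define r where "r = arccos (x \<bullet> e)"
  define z where "z = r *\<^sub>R sgn (hproj x)"
  have x1: "x \<bullet> e \<le> 1" "x \<bullet> e \<ge> -1" using Cauchy_Schwarz_ineq2[of x e] assms norm_e by auto
  have x2: "x \<bullet> e \<noteq> -1"
  proof
    assume xe: "x \<bullet> e = -1"
    then have "hproj x = 0" using norm_decomp[of x] assms(1) by simp
    then show False using hproj_decomp[of x] assms(2) xe by simp
  qed
  have r: "0 \<le> r" "r < pi" "cos r = x \<bullet> e"
    using x1 x2 arccos_less_arccos[of "-1" "x \<bullet> e"] arccos_lbound[of "x \<bullet> e"] by (auto simp: r_def)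
  have "(norm (hproj x))\<^sup>2 = (sin r)\<^sup>2"
    using norm_decomp[of x] assms sin_cos_squared_add[of r] by (simp add: power2_norm_eq_inner r(3))
  then have s: "norm (hproj x) = sin r"
    using r sin_ge_zero[of r] by (subst (asm) power2_eq_iff_nonneg) auto
  show "z \<bullet> e = 0" by (simp add: z_def sgn_div_norm)
  have "norm z \<le> r" using r by (simp add: z_def norm_sgn)
  then show "norm z < pi" using r by simp
  show "x = sexp z"
  proof (cases "hproj x = 0")
    case True
    then have "(x \<bullet> e)\<^sup>2 = 1" using norm_decomp[of x] assms by simp
    then have "x \<bullet> e = 1" using x2 by (simp add: power2_eq_1_iff)
    then show ?thesis using hproj_decomp[of x] True by (simp add: z_def sexp_def)
  next
    case False
    have "x = cos r *\<^sub>R e + sin r *\<^sub>R sgn (hproj x)"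
      using hproj_decomp[of x] False by (simp add: r(3) flip: s) (simp add: sgn_div_norm)
    then show ?thesis by (simp add: z_def sexp_scaleR_sgn[OF False])
  qed
qed

text \<open>The equator is included because the closure of the domain may touch it.\<close>

lemma sphere_eq_sexp:
  assumes "norm x = 1" "x \<bullet> e \<ge> 0"
  obtains z where "z \<bullet> e = 0" "norm z \<le> pi / 2" "x = sexp z" "x \<bullet> e > 0 \<longleftrightarrow> norm z < pi / 2"
proof -
  have "x \<noteq> - e" using assms by auto
  from sphere_eq_sexp_aux[OF assms(1) this]
  obtain z where z: "z \<bullet> e = 0" "norm z < pi" "x = sexp z" by blast
  have c: "x \<bullet> e = cos (norm z)" using z sexp_inner by simp
  have "norm z \<le> pi / 2"
  proof (rule ccontr)
    assume "\<not> norm z \<le> pi / 2"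
    then have "cos (norm z) < cos (pi / 2)" using z pi_gt_zero by (intro cos_monotone_0_pi) auto
    then show False using c assms by simp
  qed
  moreover from this have "x \<bullet> e > 0 \<longleftrightarrow> norm z < pi / 2"
    using c cos_gt_zero_pi[of "norm z"] norm_ge_zero[of z] pi_gt_zero cos_pi_half
    by (smt (verit, best) field_sum_of_halves)
  ultimately show ?thesis using that z by blast
qed

end


subsection \<open>Blowing up at the pole\<close>

context pole
begin

text \<open>Under \<open>y \<mapsto> e + a y\<close> the cone over the geodesic disc of radius \<open>a pi / 2\<close> becomes, as
  \<open>a \<rightarrow> 0\<close>, a cylinder with axis \<open>e\<close>. The map \<open>blog\<close> sends \<open>y\<close> to the normal coordinates of
  \<open>sgn (e + a y)\<close>, divided by \<open>a\<close>; it extends smoothly to \<open>a = 0\<close>. All conditions in \<open>bdom\<close>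
  depend on the ray of \<open>e + a y\<close> only.\<close>

definition bdom :: "('a \<times> real) set" where
  "bdom = {(y, a). 0 < 1 + a * (y \<bullet> e) \<and> norm (hproj y) < 5 / 2 * (1 + a * (y \<bullet> e)) \<and> \<bar>a\<bar> < 1 / 100}"

definition blog :: "'a \<times> real \<Rightarrow> 'a" where
  "blog = (\<lambda>(y, a). (atan_root (a\<^sup>2 * (hproj y \<bullet> hproj y) / (1 + a * (y \<bullet> e))\<^sup>2) / (1 + a * (y \<bullet> e))) *\<^sub>R hproj y)"

definition bmap :: "'a \<times> real \<Rightarrow> 'a" where
  "bmap p = sexp (blog p)"

text \<open>Right inverse of \<open>blog\<close> for fixed \<open>a\<close>, normalised so that
  \<open>e + a y\<close> lies on the unit sphere itself.\<close>

definition unblog :: "real \<Rightarrow> 'a \<Rightarrow> 'a" where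
  "unblog a z = (1 / a) *\<^sub>R (sexp (a *\<^sub>R z) - e)"

lemma Ck_on_sexp: "Ck_on k UNIV sexp"
  unfolding sexp_def[abs_def]
  by (intro Ck_on_add Ck_on_scaleR Ck_on_const Ck_on_id Ck_on_compose[OF _ Ck_on_cos_root]
      Ck_on_compose[OF _ Ck_on_sinc_root] Ck_on_inner) auto

lemma Ck_on_hproj: "open S \<Longrightarrow> Ck_on k S f \<Longrightarrow> Ck_on k S (\<lambda>x. hproj (f x))"
  by (rule Ck_on_compose[OF _ Ck_on_bounded_linear[OF hproj_bounded_linear, of _ UNIV]]) auto

lemma continuous_on_hproj [continuous_intros]:
  "continuous_on S f \<Longrightarrow> continuous_on S (\<lambda>x. hproj (f x))"
  using bounded_linear.continuous_on[OF hproj_bounded_linear] .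

lemma Ck_on_cone_log: "Ck_on k {Y. norm (hproj Y) < Y \<bullet> e} cone_log"
  and open_cone: "open {Y. norm (hproj Y) < Y \<bullet> e}"
proof -
  show S: "open {Y. norm (hproj Y) < Y \<bullet> e}"
    by (intro open_Collect_less continuous_intros)
  have w: "Y \<bullet> e > 0" "hproj Y \<bullet> hproj Y / (Y \<bullet> e)\<^sup>2 < 1" if "norm (hproj Y) < Y \<bullet> e" for Y
  proof -
    show w: "Y \<bullet> e > 0" using le_less_trans[OF norm_ge_zero that] .
    have "(norm (hproj Y))\<^sup>2 < (Y \<bullet> e)\<^sup>2" using that by (intro power_strict_mono) auto
    then show "hproj Y \<bullet> hproj Y / (Y \<bullet> e)\<^sup>2 < 1" using w by (simp add: power2_norm_eq_inner)
  qed
  have "Ck_on k {Y. norm (hproj Y) < Y \<bullet> e} (\<lambda>Y. (atan_root ((hproj Y \<bullet> hproj Y) * inverse ((Y \<bullet> e) * (Y \<bullet> e))) * inverse (Y \<bullet> e)) *\<^sub>R hproj Y)"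
  proof (intro Ck_on_scaleR[OF S] Ck_on_mult[OF S] Ck_on_inverse[OF S] Ck_on_compose[OF S Ck_on_atan_root]
      Ck_on_hproj[OF S] Ck_on_inner[OF S] Ck_on_id Ck_on_const)
    fix Y assume Y: "Y \<in> {Y. norm (hproj Y) < Y \<bullet> e}"
    then show "Y \<bullet> e * (Y \<bullet> e) \<noteq> 0" "Y \<bullet> e \<noteq> 0" using w by force+
    have "0 \<le> hproj Y \<bullet> hproj Y / (Y \<bullet> e)\<^sup>2" by simp
    moreover have "hproj Y \<bullet> hproj Y * inverse (Y \<bullet> e * (Y \<bullet> e)) = hproj Y \<bullet> hproj Y / (Y \<bullet> e)\<^sup>2"
      by (simp add: divide_inverse power2_eq_square)
    ultimately show "hproj Y \<bullet> hproj Y * inverse (Y \<bullet> e * (Y \<bullet> e)) \<in> {- 1<..<1}"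
      using w(2)[of Y] Y unfolding greaterThanLessThan_iff mem_Collect_eq by linarith
  qed
  then show "Ck_on k {Y. norm (hproj Y) < Y \<bullet> e} cone_log"
    by (simp add: cone_log_def[abs_def] divide_inverse power2_eq_square)
qed

lemma open_bdom: "open bdom"
proof -
  have "bdom = {p. 0 < 1 + snd p * (fst p \<bullet> e)} \<inter> {p. norm (hproj (fst p)) < 5 / 2 * (1 + snd p * (fst p \<bullet> e))}
      \<inter> {p. \<bar>snd p\<bar> < 1 / 100}"
    by (auto simp: bdom_def)
  also have "open \<dots>"
    by (intro open_Int open_Collect_less continuous_intros)
  finally show ?thesis .
qed

text \<open>Since \<open>5 / 2\<close> times \<open>1 / 100\<close> is far below 1, the argument of
  \<open>atan_root\<close> stays in its disc of convergence.\<close>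

lemma bdom_ratio:
  assumes "(y, a) \<in> bdom"
  shows "\<bar>a\<bar> * norm (hproj y) < 1 + a * (y \<bullet> e)"
    and "a\<^sup>2 * (hproj y \<bullet> hproj y) / (1 + a * (y \<bullet> e))\<^sup>2 < 1"
proof -
  define w where "w = 1 + a * (y \<bullet> e)"
  have w: "0 < w" "norm (hproj y) < 5 / 2 * w" "\<bar>a\<bar> < 1 / 100" using assms by (auto simp: bdom_def w_def)
  have "\<bar>a\<bar> * norm (hproj y) \<le> 1 / 100 * (5 / 2 * w)" using w by (intro mult_mono) auto
  then have l: "\<bar>a\<bar> * norm (hproj y) < w" using w by simp
  then show "\<bar>a\<bar> * norm (hproj y) < 1 + a * (y \<bullet> e)" by (simp add: w_def)
  have "(\<bar>a\<bar> * norm (hproj y))\<^sup>2 < w\<^sup>2" using l by (intro power_strict_mono) auto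
  then have "a\<^sup>2 * (hproj y \<bullet> hproj y) < w\<^sup>2" by (simp add: power_mult_distrib power2_norm_eq_inner)
  then show "a\<^sup>2 * (hproj y \<bullet> hproj y) / (1 + a * (y \<bullet> e))\<^sup>2 < 1"
    using w by (simp add: w_def[symmetric])
qed

lemma Ck_on_blog: "Ck_on k bdom blog"
proof -
  note S = open_bdom
  have "Ck_on k bdom (\<lambda>p. (atan_root ((snd p * snd p) * (hproj (fst p) \<bullet> hproj (fst p)) *
      inverse ((1 + snd p * (fst p \<bullet> e)) * (1 + snd p * (fst p \<bullet> e)))) * inverse (1 + snd p * (fst p \<bullet> e))) *\<^sub>R hproj (fst p))"
  proof (intro Ck_on_scaleR[OF S] Ck_on_mult[OF S] Ck_on_add[OF S] Ck_on_inverse[OF S] Ck_on_compose[OF S Ck_on_atan_root]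
      Ck_on_hproj[OF S] Ck_on_inner[OF S] Ck_on_const Ck_on_bounded_linear bounded_linear_fst bounded_linear_snd)
    fix p :: "'a \<times> real" assume p: "p \<in> bdom"
    obtain y a where ya: "p = (y, a)" by (cases p)
    have w: "1 + a * (y \<bullet> e) > 0" using p by (auto simp: ya bdom_def)
    then show "(1 + snd p * (fst p \<bullet> e)) * (1 + snd p * (fst p \<bullet> e)) \<noteq> 0" "1 + snd p * (fst p \<bullet> e) \<noteq> 0"
      by (auto simp: ya)
    have "0 \<le> a\<^sup>2 * (hproj y \<bullet> hproj y) / (1 + a * (y \<bullet> e))\<^sup>2" by simp
    moreover have "snd p * snd p * (hproj (fst p) \<bullet> hproj (fst p)) *
         inverse ((1 + snd p * (fst p \<bullet> e)) * (1 + snd p * (fst p \<bullet> e)))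
       = a\<^sup>2 * (hproj y \<bullet> hproj y) / (1 + a * (y \<bullet> e))\<^sup>2"
      by (simp add: ya divide_inverse power2_eq_square)
    ultimately show "snd p * snd p * (hproj (fst p) \<bullet> hproj (fst p)) *
         inverse ((1 + snd p * (fst p \<bullet> e)) * (1 + snd p * (fst p \<bullet> e))) \<in> {- 1<..<1}"
      using bdom_ratio(2)[of y a] p unfolding ya greaterThanLessThan_iff by linarith
  qed
  then show ?thesis by (simp add: blog_def case_prod_beta' divide_inverse power2_eq_square)
qed

lemma Ck_on_bmap: "Ck_on k bdom bmap"
  unfolding bmap_def[abs_def]
  by (rule Ck_on_compose[OF open_bdom Ck_on_sexp Ck_on_blog]) auto

lemma atan_root_0 [simp]: "atan_root 0 = 1"
  using powser_zero[of "\<lambda>n. (-1) ^ n / real (2 * n + 1)"] by (simp add: atan_root_def)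

lemma blog_0 [simp]: "blog (y, 0) = hproj y"
  by (simp add: blog_def)

lemma blog_orth [simp]: "blog p \<bullet> e = 0"
  by (simp add: blog_def case_prod_beta)

lemma hproj_ray: "hproj (e + a *\<^sub>R y) = a *\<^sub>R hproj y"
  by (simp add: hproj_add hproj_scaleR)

text \<open>For \<open>a \<noteq> 0\<close> facts about \<open>cone_log\<close> pass to
  \<open>blog\<close>, whose own formula does not divide by \<open>a\<close> and so makes sense at
  \<open>a = 0\<close>.\<close>

lemma blog_eq_cone_log: "a *\<^sub>R blog (y, a) = cone_log (e + a *\<^sub>R y)"
  by (simp add: blog_def cone_log_def hproj_ray inner_add_left power2_eq_square mult_ac)

lemma bdom_cone: "(y, a) \<in> bdom \<Longrightarrow> norm (hproj (e + a *\<^sub>R y)) < (e + a *\<^sub>R y) \<bullet> e"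
  using bdom_ratio(1) by (simp add: hproj_ray inner_add_left)

text \<open>\<open>arctan t \<le> t\<close> keeps the bound from \<open>bdom\<close>. The value
  \<open>5 / 2\<close> lies between \<open>pi / 2\<close>, leaving open room around the closed
  hemisphere, and \<open>pi\<close>, below which \<open>slog\<close> inverts
  \<open>sexp\<close>.\<close>

lemma norm_blog:
  assumes "(y, a) \<in> bdom" "a \<ge> 0"
  shows "norm (blog (y, a)) < 5 / 2"
proof (cases "a = 0")
  case True
  then show ?thesis using assms by (simp add: bdom_def)
next
  case False
  define w where "w = 1 + a * (y \<bullet> e)"
  have w: "0 < w" "norm (hproj y) < 5 / 2 * w" using assms by (auto simp: bdom_def w_def)
  have "a * norm (blog (y, a)) = arctan (a * norm (hproj y) / w)"
    using norm_cone_log[OF bdom_cone[OF assms(1)]] assms(2)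
    by (simp flip: blog_eq_cone_log add: hproj_ray inner_add_left w_def)
  also have "\<dots> \<le> a * norm (hproj y) / w" using assms w by (intro arctan_le_self) auto
  also have "\<dots> < a * (5 / 2)" using w assms False by (simp add: field_simps)
  finally show ?thesis using assms False by (simp add: mult_less_cancel_left)
qed

lemma norm_blog_pi: "(y, a) \<in> bdom \<Longrightarrow> a \<ge> 0 \<Longrightarrow> norm (blog (y, a)) < pi"
  using norm_blog pi_gt3 by force

lemma sgn_ray:
  assumes "(y, a) \<in> bdom"
  shows "sgn (e + a *\<^sub>R y) = sexp (a *\<^sub>R blog (y, a))"
  using sexp_cone_log[OF bdom_cone[OF assms]] by (simp flip: blog_eq_cone_log)

lemma norm_bmap: "norm (bmap p) = 1"
  by (simp add: bmap_def norm_sexp)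

lemma ray_nonzero: "(y, a) \<in> bdom \<Longrightarrow> e + a *\<^sub>R y \<noteq> 0"
  using bdom_cone[of y a] by force

text \<open>Along a ray the normal coordinates do not change; a point may thus be exchanged for the
  representative with \<open>e + a y'\<close> on the unit sphere.\<close>

lemma bdom_ray:
  assumes "(y, a) \<in> bdom" "a > 0" "c > 0"
  defines "y' \<equiv> (1 / a) *\<^sub>R (c *\<^sub>R (e + a *\<^sub>R y) - e)"
  shows "(y', a) \<in> bdom" "blog (y', a) = blog (y, a)"
proof -
  have e: "e + a *\<^sub>R y' = c *\<^sub>R (e + a *\<^sub>R y)" using assms by (simp add: y'_def)
  have w: "1 + a * (y' \<bullet> e) = c * (1 + a * (y \<bullet> e))"
    using arg_cong[OF e, of "\<lambda>x. x \<bullet> e"] by (simp add: inner_add_left algebra_simps)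
  have "a *\<^sub>R hproj y' = a *\<^sub>R (c *\<^sub>R hproj y)"
    using arg_cong[OF e, of hproj] by (simp add: hproj_ray hproj_scaleR mult.commute)
  then have h: "hproj y' = c *\<^sub>R hproj y" using assms(2) by (simp del: scaleR_scaleR)
  have "c * norm (hproj y) < c * (5 / 2 * (1 + a * (y \<bullet> e)))"
    using assms(1,3) by (intro mult_strict_left_mono) (auto simp: bdom_def)
  then have "norm (hproj y') < 5 / 2 * (1 + a * (y' \<bullet> e))"
    using assms(3) unfolding w h by (simp add: mult.left_commute)
  then show "(y', a) \<in> bdom" using assms(1,3) w by (simp add: bdom_def)
  have "a *\<^sub>R blog (y', a) = a *\<^sub>R blog (y, a)"
    using cone_log_scaleR[OF assms(3)] by (simp add: blog_eq_cone_log e)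
  then show "blog (y', a) = blog (y, a)" using assms by simp
qed

lemma unblog_ray: "a \<noteq> 0 \<Longrightarrow> e + a *\<^sub>R unblog a z = sexp (a *\<^sub>R z)"
  by (simp add: unblog_def)

text \<open>With \<open>t = a * norm z\<close> the error has the components
  \<open>(1 - cos t) / a\<close> along \<open>e\<close> and \<open>\<bar>sin t - t\<bar> / a\<close>
  across it. Each is at most \<open>t\<^sup>2 / (2 * a)\<close>, together
  \<open>a * (norm z)\<^sup>2\<close>, and \<open>norm z < 2\<close>.\<close>

lemma unblog:
  assumes "z \<bullet> e = 0" "norm z \<le> pi / 2" "0 < a" "a < 1 / 100"
  shows "(unblog a z, a) \<in> bdom" "blog (unblog a z, a) = z" "dist (unblog a z) z \<le> 4 * a"
proof -
  have z2: "norm z < 2" using assms pi_less_4 by simp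
  define t where "t = a * norm z"
  have t: "0 \<le> t" "t < 1 / 50" using assms z2 mult_strict_mono[of a "1/100" "norm z" 2] by (auto simp: t_def)
  have n: "norm (a *\<^sub>R z) = t" using assms by (simp add: t_def)
  have o: "(a *\<^sub>R z) \<bullet> e = 0" using assms by simp
  have "1 - cos t = 2 * (sin (t / 2))\<^sup>2" using cos_double_sin[of "t/2"] by simp
  also have "(sin (t / 2))\<^sup>2 \<le> (t / 2)\<^sup>2"
    using abs_sin_x_le_abs_x[of "t/2"] by (simp add: abs_le_square_iff[symmetric])
  finally have c: "1 - cos t \<le> t\<^sup>2 / 2" by (simp add: power_divide)
  have "t * t \<le> 1 / 50 * (1 / 50)" using t by (intro mult_mono) auto
  then have "cos t \<ge> 9 / 10" using c by (simp add: power2_eq_square)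
  have w: "1 + a * (unblog a z \<bullet> e) = cos t"
    using arg_cong[OF unblog_ray[of a z], of "\<lambda>x. x \<bullet> e"] assms sexp_inner[OF o] n by (simp add: inner_add_left)
  have "a *\<^sub>R hproj (unblog a z) = (sinc_root (t\<^sup>2) * a) *\<^sub>R z"
    using arg_cong[OF unblog_ray[of a z], of hproj] assms hproj_sexp[OF o] n
    by (simp add: hproj_ray flip: power2_norm_eq_inner)
  then have "a *\<^sub>R hproj (unblog a z) = a *\<^sub>R sinc_root (t\<^sup>2) *\<^sub>R z" by (simp add: mult.commute)
  then have h: "hproj (unblog a z) = sinc_root (t\<^sup>2) *\<^sub>R z" using assms by (simp del: scaleR_scaleR)
  have sn: "sinc_root (t\<^sup>2) * norm z = sin t / a" using sinc_root_square[of t] assms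
    by (simp add: t_def field_simps)
  have "norm (hproj (unblog a z)) \<le> \<bar>sin t\<bar> / a" using sn assms by (simp add: h flip: abs_mult) (metis abs_mult abs_norm_cancel abs_divide abs_of_pos order_refl)
  also have "\<dots> \<le> t / a" using t assms abs_sin_x_le_abs_x[of t] by (intro divide_right_mono) auto
  also have "\<dots> < 2" using z2 assms by (simp add: t_def)
  finally have "norm (hproj (unblog a z)) < 5 / 2 * (1 + a * (unblog a z \<bullet> e))"
    using \<open>cos t \<ge> 9 / 10\<close> unfolding w by linarith
  then show d: "(unblog a z, a) \<in> bdom"
    using \<open>cos t \<ge> 9 / 10\<close> assms w by (simp add: bdom_def)
  have "norm (a *\<^sub>R z) < pi / 4" using t n pi_gt3 by simp
  then have "a *\<^sub>R blog (unblog a z, a) = a *\<^sub>R z"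
    using o assms by (simp add: blog_eq_cone_log unblog_ray cone_log_sexp)
  then show "blog (unblog a z, a) = z" using assms by simp
  have "unblog a z = (unblog a z \<bullet> e) *\<^sub>R e + sinc_root (t\<^sup>2) *\<^sub>R z"
    using hproj_decomp[of "unblog a z"] by (simp add: h)
  moreover have "unblog a z \<bullet> e = (cos t - 1) / a" using w assms by (simp add: field_simps)
  ultimately have "unblog a z - z = ((cos t - 1) / a) *\<^sub>R e + (sinc_root (t\<^sup>2) - 1) *\<^sub>R z"
    by (simp add: algebra_simps)
  then have "dist (unblog a z) z \<le> norm (((cos t - 1) / a) *\<^sub>R e) + norm ((sinc_root (t\<^sup>2) - 1) *\<^sub>R z)"
    by (simp only: dist_norm norm_triangle_ineq)
  also have "norm (((cos t - 1) / a) *\<^sub>R e) = (1 - cos t) / a" using norm_e assms by simp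
  also have "norm ((sinc_root (t\<^sup>2) - 1) *\<^sub>R z) = \<bar>sin t / a - norm z\<bar>"
    using sn by (simp flip: abs_mult add: left_diff_distrib) (metis abs_mult abs_norm_cancel left_diff_distrib mult_1)
  also have "\<dots> = \<bar>sin t - t\<bar> / a" using assms by (simp add: t_def field_simps)
  also have "\<bar>sin t - t\<bar> \<le> t\<^sup>2 / 2"
    using Maclaurin_sin_bound[of t 2] by (simp add: numeral_2_eq_2 sin_coeff_def)
  also have "(1 - cos t) / a + t\<^sup>2 / 2 / a \<le> t\<^sup>2 / 2 / a + t\<^sup>2 / 2 / a"
    using c assms by (intro add_mono divide_right_mono) auto
  also have "\<dots> = a * (norm z * norm z)" using assms by (simp add: t_def power2_eq_square)
  also have "\<dots> \<le> a * (2 * 2)" using z2 assms by (intro mult_left_mono mult_mono) auto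
  finally show "dist (unblog a z) z \<le> 4 * a"
    using assms by (simp add: divide_right_mono)
qed

text \<open>The open set on which both bisections and the final \<open>cone_log\<close> are
  smooth.\<close>

definition sldom :: "'a set" where
  "sldom = {Y. Y \<noteq> 0 \<and> sgn Y + e \<noteq> 0 \<and>
     norm (hproj (sgn (sgn Y + e) + e)) < (sgn (sgn Y + e) + e) \<bullet> e}"

lemma open_sldom: "open sldom"
  and Ck_on_slog: "Ck_on k sldom slog"
proof -
  have o1: "open (- {0::'a})" by (simp add: open_Compl)
  define U where "U = {Y \<in> - {0}. sgn Y + e \<in> - {0}}"
  have c1: "continuous_on (- {0::'a}) sgn" using Ck_on_imp_continuous_on[OF Ck_on_sgn] .
  have "continuous_on (- {0}) (\<lambda>Y. sgn Y + e)" by (intro continuous_on_add c1 continuous_on_const)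
  from continuous_open_preimage[OF this o1 o1] have U: "open U"
    by (simp add: U_def vimage_def Int_def)
  have k1: "Ck_on j U (\<lambda>Y. sgn Y + e)" for j
    by (intro Ck_on_add U Ck_on_const Ck_on_subset[OF Ck_on_sgn]) (auto simp: U_def)
  have k2: "Ck_on j U (\<lambda>Y. sgn (sgn Y + e) + e)" for j
    by (intro Ck_on_add U Ck_on_const Ck_on_compose[OF U Ck_on_sgn k1]) (auto simp: U_def)
  have "sldom = {Y \<in> U. sgn (sgn Y + e) + e \<in> {Y. norm (hproj Y) < Y \<bullet> e}}"
    by (auto simp: sldom_def U_def)
  also have "open \<dots>"
    using continuous_open_preimage[OF Ck_on_imp_continuous_on[OF k2] U open_cone]
    by (simp add: vimage_def Int_def)
  finally show S: "open sldom" .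
  have "Ck_on k sldom (\<lambda>Y. 4 *\<^sub>R cone_log (sgn (sgn Y + e) + e))"
    by (intro Ck_on_scaleR S Ck_on_const Ck_on_compose[OF S Ck_on_cone_log Ck_on_subset[OF k2]])
      (auto simp: sldom_def U_def)
  then show "Ck_on k sldom slog" by (simp add: slog_def[abs_def])
qed

lemma sexp_sldom:
  assumes "z \<bullet> e = 0" "norm z < pi"
  shows "sexp z \<in> sldom"
proof -
  have n: "norm (sexp z) = 1" using norm_sexp[OF assms(1)] .
  then have "sgn (sexp z) = sexp z" by (simp add: sgn_div_norm)
  moreover have "norm (sgn (sexp z + e)) = 1"
    unfolding sgn_sexp_plus_pole[OF assms] using assms by (intro norm_sexp) simp
  ultimately show ?thesis using slog_sexp(2)[OF assms] n by (auto simp: sldom_def)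
qed

lemma slog_orth: "slog Y \<bullet> e = 0"
  by (simp add: slog_def)

text \<open>\<open>slog\<close> depends on \<open>sgn Y\<close> only, and the sphere without the
  antipode of the pole is covered by \<open>sexp\<close>.\<close>

lemma sexp_slog:
  assumes "Y \<in> sldom" shows "sexp (slog Y) = sgn Y"
proof -
  have Y: "Y \<noteq> 0" "sgn Y \<noteq> - e" using assms by (auto simp: sldom_def eq_neg_iff_add_eq_0)
  from sphere_eq_sexp_aux[of "sgn Y"] Y
  obtain z where z: "z \<bullet> e = 0" "norm z < pi" "sgn Y = sexp z" by (auto simp: norm_sgn)
  have "sgn (sgn Y) = sgn Y" using Y by (simp add: sgn_div_norm)
  then have "slog Y = slog (sgn Y)" by (simp add: slog_def)
  then show ?thesis using z slog_sexp by simp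
qed

end


subsection \<open>A pointwise Laplacian and barriers\<close>

text \<open>A limit of symmetric second differences is local and linear without any
  differentiability hypothesis, and it still has the right sign at a minimum. For
  \<open>C\<^sup>2\<close> functions it is the Laplacian.\<close>

definition has_lap :: "('a::euclidean_space \<Rightarrow> real) \<Rightarrow> 'a \<Rightarrow> real \<Rightarrow> bool" where
  "has_lap f x L \<longleftrightarrow>
    ((\<lambda>s. \<Sum>b\<in>Basis. (f (x + s *\<^sub>R b) + f (x - s *\<^sub>R b) - 2 * f x) / s\<^sup>2) \<longlongrightarrow> L) (at 0)"

lemma has_lap_add: "has_lap f x L \<Longrightarrow> has_lap g x M \<Longrightarrow> has_lap (\<lambda>y. f y + g y) x (L + M)"
  unfolding has_lap_def
  by (drule (1) tendsto_add, erule tendsto_cong[THEN iffD1, rotated])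
    (simp add: sum.distrib[symmetric] add_divide_distrib[symmetric] algebra_simps)

lemma has_lap_cmult: "has_lap f x L \<Longrightarrow> has_lap (\<lambda>y. c * f y) x (c * L)"
  unfolding has_lap_def
  by (drule tendsto_mult_left[of _ _ _ c], erule tendsto_cong[THEN iffD1, rotated])
    (simp add: sum_distrib_left algebra_simps)

lemma has_lap_const: "has_lap (\<lambda>y. c) x 0"
  by (simp add: has_lap_def)

lemma has_lap_diff: "has_lap f x L \<Longrightarrow> has_lap g x M \<Longrightarrow> has_lap (\<lambda>y. f y - g y) x (L - M)"
  using has_lap_add[of f x L "\<lambda>y. -1 * g y" "-1 * M"] has_lap_cmult[of g x M "-1"] by simp

lemma eventually_coordinate_lines:
  assumes "\<forall>\<^sub>F y in nhds (x::'a::euclidean_space). P y"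
  shows "\<forall>\<^sub>F s in at 0. \<forall>b\<in>Basis. P (x + s *\<^sub>R b) \<and> P (x - s *\<^sub>R b)"
proof (intro eventually_ball_finite ballI eventually_conj)
  fix b :: 'a
  have "((\<lambda>s. x + s *\<^sub>R b) \<longlongrightarrow> x + 0 *\<^sub>R b) (at 0)" "((\<lambda>s. x - s *\<^sub>R b) \<longlongrightarrow> x - 0 *\<^sub>R b) (at 0)"
    by (intro tendsto_intros)+
  then show "\<forall>\<^sub>F s in at 0. P (x + s *\<^sub>R b)" "\<forall>\<^sub>F s in at 0. P (x - s *\<^sub>R b)"
    using assms by (auto dest: eventually_compose_filterlim)
qed simp

text \<open>Each second difference is nonnegative at a minimum. Every interior comparison below ends
  with a contradiction to this.\<close>

lemma has_lap_local_min:
  assumes "\<forall>\<^sub>F y in nhds x. f x \<le> f y" "has_lap f x L"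
  shows "L \<ge> 0"
proof (rule tendsto_lowerbound[OF assms(2)[unfolded has_lap_def]])
  show "\<forall>\<^sub>F s in at 0. 0 \<le> (\<Sum>b\<in>Basis. (f (x + s *\<^sub>R b) + f (x - s *\<^sub>R b) - 2 * f x) / s\<^sup>2)"
  proof (rule eventually_mono[OF eventually_coordinate_lines[OF assms(1)]], intro sum_nonneg)
    fix s and b :: 'a assume "\<forall>b\<in>Basis. f x \<le> f (x + s *\<^sub>R b) \<and> f x \<le> f (x - s *\<^sub>R b)" "b \<in> Basis"
    then have "f x \<le> f (x + s *\<^sub>R b)" "f x \<le> f (x - s *\<^sub>R b)" by auto
    then show "0 \<le> (f (x + s *\<^sub>R b) + f (x - s *\<^sub>R b) - 2 * f x) / s\<^sup>2" by simp
  qed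
qed simp

text \<open>Substituting \<open>c * s\<close> for the step \<open>s\<close> produces the factor
  \<open>c\<^sup>2\<close>.\<close>

lemma has_lap_affine:
  assumes "has_lap F x L" "c \<noteq> 0"
  shows "has_lap (\<lambda>y. F (x + c *\<^sub>R (y - p))) p (c\<^sup>2 * L)"
proof -
  have "filterlim (\<lambda>s. c * s) (at 0) (at 0)"
    by (rule filterlim_atI) (use assms(2) in \<open>auto intro!: tendsto_eq_intros simp: eventually_at_filter\<close>)
  from tendsto_mult_left[OF filterlim_compose[OF assms(1)[unfolded has_lap_def] this], of "c\<^sup>2"]
  show ?thesis unfolding has_lap_def
    by (rule tendsto_cong[THEN iffD1, rotated])
      (use assms(2) in \<open>simp add: sum_distrib_left power_mult_distrib\<close>)
qed

lemma has_lap_inner: "has_lap (\<lambda>y. (y - p) \<bullet> b) x 0"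
  by (simp add: has_lap_def algebra_simps)

lemma has_lap_of_const:
  assumes "\<And>s b. s \<noteq> 0 \<Longrightarrow> b \<in> Basis \<Longrightarrow> f (x + s *\<^sub>R b) + f (x - s *\<^sub>R b) - 2 * f x = s\<^sup>2 * d b"
  shows "has_lap f x (\<Sum>b\<in>Basis. d b)"
  unfolding has_lap_def
  by (rule tendsto_eventually) (auto simp: eventually_at_filter assms)

lemma has_lap_inner_square:
  assumes "c \<in> Basis"
  shows "has_lap (\<lambda>y. ((y - p) \<bullet> c)\<^sup>2) x 2"
proof -
  have "has_lap (\<lambda>y. ((y - p) \<bullet> c)\<^sup>2) x (\<Sum>b\<in>Basis. 2 * (b \<bullet> c)\<^sup>2)"
    by (rule has_lap_of_const) (simp add: inner_diff_left inner_add_left power2_eq_square algebra_simps)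
  also have "(\<Sum>b\<in>Basis. 2 * (b \<bullet> c)\<^sup>2) = (\<Sum>b\<in>Basis. if b = c then 2 else 0)"
    using assms by (intro sum.cong) (auto simp: inner_Basis)
  also have "\<dots> = 2" using assms by simp
  finally show ?thesis .
qed

lemma has_lap_norm_square:
  "has_lap (\<lambda>y::'a::euclidean_space. (norm (y - p))\<^sup>2) x (2 * DIM('a))"
proof -
  have "has_lap (\<lambda>y. (norm (y - p))\<^sup>2) x (\<Sum>b\<in>(Basis::'a set). 2)"
    unfolding power2_norm_eq_inner
    by (rule has_lap_of_const)
      (simp add: inner_diff_left inner_diff_right inner_add_left inner_add_right
        power2_eq_square algebra_simps inner_commute)
  then show ?thesis by (simp add: mult.commute)
qed

section \<open>Second derivatives along lines and Laplacians of exponentials\<close>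

text \<open>\<open>a\<close> and \<open>d\<close> are the first and second derivative at 0. The
  first derivative is required near 0 only, as the functions come from open sets.\<close>

definition D2 :: "(real \<Rightarrow> real) \<Rightarrow> real \<Rightarrow> real \<Rightarrow> bool" where
  "D2 g a d \<longleftrightarrow> (\<exists>g'. (\<forall>\<^sub>F s in nhds 0. (g has_real_derivative g' s) (at s)) \<and> g' 0 = a \<and>
     (g' has_real_derivative d) (at 0))"

text \<open>The second derivative is known at 0 alone, so l'Hopital applies once; the remaining
  limit averages the difference quotients of \<open>g'\<close> at \<open>s\<close> and
  \<open>- s\<close>.\<close>

lemma D2_second_difference:
  assumes "D2 g a d"
  shows "((\<lambda>s. (g s + g (- s) - 2 * g 0) / s\<^sup>2) \<longlongrightarrow> d) (at 0)"
proof -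
  obtain g' where g': "\<forall>\<^sub>F s in nhds 0. (g has_real_derivative g' s) (at s)"
      "(g' has_real_derivative d) (at 0)"
    using assms unfolding D2_def by blast
  have m: "((\<lambda>s::real. - s) \<longlongrightarrow> 0) (nhds 0)"
    using tendsto_minus[OF filterlim_ident, of "0::real"] by simp
  have g2: "\<forall>\<^sub>F s in nhds 0. (g has_real_derivative g' (- s)) (at (- s))"
    using eventually_compose_filterlim[OF g'(1) m] .
  have "isCont g 0" using eventually_nhds_x_imp_x[OF g'(1)] DERIV_isCont by blast
  then have c: "(g \<longlongrightarrow> g 0) (at 0)" by (simp add: isCont_def)
  have m0: "filterlim (\<lambda>s::real. - s) (at 0) (at 0)"
    by (rule filterlim_atI) (auto intro!: tendsto_eq_intros simp: eventually_at_filter)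
  have q: "((\<lambda>s. (g' s - g' 0) / s) \<longlongrightarrow> d) (at 0)"
    using g'(2) by (simp add: has_field_derivative_iff)
  show ?thesis
  proof (rule lhopital)
    show "((\<lambda>s. g s + g (- s) - 2 * g 0) \<longlongrightarrow> 0) (at 0)"
      using c filterlim_compose[OF c m0] by (auto intro!: tendsto_eq_intros)
    show "((\<lambda>s::real. s\<^sup>2) \<longlongrightarrow> 0) (at 0)" by (auto intro!: tendsto_eq_intros)
    show "\<forall>\<^sub>F s in at (0::real). s\<^sup>2 \<noteq> 0" "\<forall>\<^sub>F s in at (0::real). 2 * s \<noteq> 0"
      by (auto simp: eventually_at_filter)
    show "\<forall>\<^sub>F s in at 0. ((\<lambda>s. g s + g (- s) - 2 * g 0) has_real_derivative g' s - g' (- s)) (at s)"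
      using eventually_conj[OF g'(1) g2] unfolding eventually_at_filter
    proof (rule eventually_mono, intro impI)
      fix s assume s: "(g has_real_derivative g' s) (at s) \<and> (g has_real_derivative g' (- s)) (at (- s))"
      have "((\<lambda>s. g (- s)) has_real_derivative g' (- s) * -1) (at s)"
        using s by (intro DERIV_chain2[of g]) (auto intro!: derivative_eq_intros)
      then show "((\<lambda>s. g s + g (- s) - 2 * g 0) has_real_derivative g' s - g' (- s)) (at s)"
        using s by (auto intro!: derivative_eq_intros)
    qed
    show "\<forall>\<^sub>F s in at 0. ((\<lambda>s::real. s\<^sup>2) has_real_derivative 2 * s) (at s)"
      by (auto intro!: derivative_eq_intros always_eventually)
    have "((\<lambda>s. ((g' s - g' 0) / s + (g' (- s) - g' 0) / (- s)) / 2) \<longlongrightarrow> (d + d) / 2) (at 0)"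
      by (intro tendsto_intros q filterlim_compose[OF q m0]) auto
    then have "((\<lambda>s. ((g' s - g' 0) / s + (g' (- s) - g' 0) / (- s)) / 2) \<longlongrightarrow> d) (at 0)"
      by (simp only: field_sum_of_halves add_divide_distrib)
    moreover have "\<forall>\<^sub>F s in at 0. ((g' s - g' 0) / s + (g' (- s) - g' 0) / (- s)) / 2 = (g' s - g' (- s)) / (2 * s)"
      by (auto simp: eventually_at_filter field_simps)
    ultimately show "((\<lambda>s. (g' s - g' (- s)) / (2 * s)) \<longlongrightarrow> d) (at 0)"
      by (rule Lim_transform_eventually)
  qed
qed

lemma has_lap_D2:
  assumes "\<And>b. b \<in> Basis \<Longrightarrow> D2 (\<lambda>s. f (x + s *\<^sub>R b)) (N b) (d b)"
  shows "has_lap f x (\<Sum>b\<in>Basis. d b)"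
  unfolding has_lap_def
proof (rule tendsto_sum)
  show "((\<lambda>s. (f (x + s *\<^sub>R b) + f (x - s *\<^sub>R b) - 2 * f x) / s\<^sup>2) \<longlongrightarrow> d b) (at 0)" if "b \<in> Basis" for b
    using D2_second_difference[OF assms[OF that]] by simp
qed

text \<open>The term quadratic in \<open>K\<close> makes exponentials of a defining function
  subharmonic for large \<open>K\<close>, as long as its gradient is bounded below.\<close>

lemma D2_exp:
  assumes "D2 g a d"
  shows "D2 (\<lambda>s. exp (- K * g s)) (- K * a * exp (- K * g 0)) (exp (- K * g 0) * (K\<^sup>2 * a\<^sup>2 - K * d))"
proof -
  obtain g' where g': "\<forall>\<^sub>F s in nhds 0. (g has_real_derivative g' s) (at s)" "g' 0 = a"
      "(g' has_real_derivative d) (at 0)"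
    using assms unfolding D2_def by blast
  note g0 = eventually_nhds_x_imp_x[OF g'(1)]
  show ?thesis unfolding D2_def
  proof (intro exI[of _ "\<lambda>s. - K * g' s * exp (- K * g s)"] conjI)
    show "\<forall>\<^sub>F s in nhds 0. ((\<lambda>s. exp (- K * g s)) has_real_derivative - K * g' s * exp (- K * g s)) (at s)"
      using g'(1) by (rule eventually_mono) (auto intro!: derivative_eq_intros)
    show "((\<lambda>s. - K * g' s * exp (- K * g s)) has_real_derivative
       exp (- K * g 0) * (K\<^sup>2 * a\<^sup>2 - K * d)) (at 0)"
      using g0 g'(2,3) by (auto intro!: derivative_eq_intros simp: power2_eq_square algebra_simps)
  qed (simp add: g')
qed

lemma D2_norm_square:
  assumes "b \<in> Basis"
  shows "D2 (\<lambda>s. (norm (x + s *\<^sub>R b - q))\<^sup>2) (2 * ((x - q) \<bullet> b)) 2"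
proof -
  have e: "(norm (x + s *\<^sub>R b - q))\<^sup>2 = (norm (x - q))\<^sup>2 + 2 * s * ((x - q) \<bullet> b) + s\<^sup>2" for s
    using assms unfolding power2_norm_eq_inner by (simp add: inner_diff_left inner_diff_right inner_add_left inner_add_right
        power2_eq_square algebra_simps inner_commute)
  show ?thesis unfolding D2_def e
    by (intro exI[of _ "\<lambda>s. 2 * ((x - q) \<bullet> b) + 2 * s"] conjI always_eventually allI)
      (auto intro!: derivative_eq_intros)
qed

lemma sum_Basis_inner_square: "(\<Sum>b\<in>Basis. (v \<bullet> b)\<^sup>2) = (norm v)\<^sup>2"
  unfolding power2_norm_eq_inner by (subst euclidean_inner) (simp add: power2_eq_square)

lemma has_lap_gaussian:
  fixes x q :: "'a::euclidean_space"
  shows "has_lap (\<lambda>y. exp (- K * (norm (y - q))\<^sup>2)) x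
    (exp (- K * (norm (x - q))\<^sup>2) * (4 * K\<^sup>2 * (norm (x - q))\<^sup>2 - 2 * K * DIM('a)))"
proof -
  have "has_lap (\<lambda>y. exp (- K * (norm (y - q))\<^sup>2)) x (\<Sum>b\<in>Basis.
      exp (- K * (norm (x + 0 *\<^sub>R b - q))\<^sup>2) * (K\<^sup>2 * (2 * ((x - q) \<bullet> b))\<^sup>2 - K * 2))"
    by (rule has_lap_D2) (rule D2_exp[OF D2_norm_square])
  also have "(\<Sum>b\<in>Basis. exp (- K * (norm (x + 0 *\<^sub>R b - q))\<^sup>2) * (K\<^sup>2 * (2 * ((x - q) \<bullet> b))\<^sup>2 - K * 2))
    = exp (- K * (norm (x - q))\<^sup>2) * (\<Sum>b\<in>Basis. 4 * K\<^sup>2 * ((x - q) \<bullet> b)\<^sup>2 - K * 2)"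
    by (simp add: sum_distrib_left power_mult_distrib mult_ac)
  also have "(\<Sum>b\<in>(Basis::'a set). 4 * K\<^sup>2 * ((x - q) \<bullet> b)\<^sup>2 - K * 2) = 4 * K\<^sup>2 * (norm (x - q))\<^sup>2 - 2 * K * DIM('a)"
    by (simp add: sum_subtractf sum_distrib_left[symmetric] sum_Basis_inner_square)
  finally show ?thesis .
qed

lemma D2_Ck_on:
  assumes "Ck_on 2 S F" "open S" "x \<in> S"
  shows "D2 (\<lambda>s. F (x + s *\<^sub>R v)) (frechet_derivative F (at x) v)
    (frechet_derivative (\<lambda>y. frechet_derivative F (at y) v) (at x) v)"
proof -
  have k: "Ck_on (Suc (Suc 0)) S F" using assms(1) by (simp add: numeral_2_eq_2)
  have line: "((\<lambda>s. G (x + s *\<^sub>R v)) has_real_derivative frechet_derivative G (at (x + s *\<^sub>R v)) v) (at s)"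
    if "Ck_on (Suc j) S G" "x + s *\<^sub>R v \<in> S" for G :: "'a \<Rightarrow> real" and s j
  proof -
    have d: "(G has_derivative frechet_derivative G (at (x + s *\<^sub>R v))) (at (x + s *\<^sub>R v))"
      using Ck_on_has_derivative[OF that] .
    have "((\<lambda>s. x + s *\<^sub>R v) has_derivative (\<lambda>t. t *\<^sub>R v)) (at s)"
      by (auto intro!: derivative_eq_intros)
    from has_derivative_compose[OF this d] show ?thesis
      using linear_scale[OF has_derivative_linear[OF d]]
      by (simp add: has_field_derivative_def mult_commute_abs)
  qed
  have "((\<lambda>s. x + s *\<^sub>R v) \<longlongrightarrow> x + 0 *\<^sub>R v) (nhds 0)"
    by (intro tendsto_add tendsto_scaleR filterlim_ident tendsto_const)
  then have ev: "\<forall>\<^sub>F s in nhds 0. x + s *\<^sub>R v \<in> S"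
    using assms(2,3) by (simp add: tendsto_def)
  show ?thesis unfolding D2_def
  proof (intro exI[of _ "\<lambda>s. frechet_derivative F (at (x + s *\<^sub>R v)) v"] conjI)
    show "\<forall>\<^sub>F s in nhds 0. ((\<lambda>s. F (x + s *\<^sub>R v)) has_real_derivative
        frechet_derivative F (at (x + s *\<^sub>R v)) v) (at s)"
      using ev by (rule eventually_mono) (rule line[OF k])
    show "((\<lambda>s. frechet_derivative F (at (x + s *\<^sub>R v)) v) has_real_derivative
       frechet_derivative (\<lambda>y. frechet_derivative F (at y) v) (at x) v) (at 0)"
      using line[where s = 0, OF Ck_on_deriv[OF k, of v]] assms(3) by simp
  qed simp
qed


subsection \<open>A Harnack inequality for almost harmonic functions\<close>

lemma scaleR_add_self: "(s * 2) *\<^sub>R c = s *\<^sub>R c + s *\<^sub>R (c::'a::real_vector)"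
  by (simp flip: scaleR_add_left)

text \<open>Reflecting in a coordinate hyperplane permutes the points of the second differences: it
  swaps the pair in direction \<open>b\<close> and keeps all others.\<close>

lemma has_lap_reflect:
  fixes p :: "'a::euclidean_space"
  assumes b: "b \<in> Basis" and h: "has_lap h (x - (2 * ((x - p) \<bullet> b)) *\<^sub>R b) L"
  shows "has_lap (\<lambda>x. h (x - (2 * ((x - p) \<bullet> b)) *\<^sub>R b)) x L"
proof -
  define \<sigma> where "\<sigma> x = x - (2 * ((x - p) \<bullet> b)) *\<^sub>R b" for x
  have "\<sigma> (x + s *\<^sub>R c) = (if c = b then \<sigma> x - s *\<^sub>R c else \<sigma> x + s *\<^sub>R c)"
    "\<sigma> (x - s *\<^sub>R c) = (if c = b then \<sigma> x + s *\<^sub>R c else \<sigma> x - s *\<^sub>R c)"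
    if "c \<in> Basis" for s and c :: 'a
    using that b scaleR_add_self[of s c] by (auto simp: \<sigma>_def inner_add_left inner_diff_left inner_Basis algebra_simps)
  then have "(\<Sum>c\<in>Basis. (h (\<sigma> (x + s *\<^sub>R c)) + h (\<sigma> (x - s *\<^sub>R c)) - 2 * h (\<sigma> x)) / s\<^sup>2)
      = (\<Sum>c\<in>Basis. (h (\<sigma> x + s *\<^sub>R c) + h (\<sigma> x - s *\<^sub>R c) - 2 * h (\<sigma> x)) / s\<^sup>2)" for s
    by (intro sum.cong) auto
  then show ?thesis using h by (simp add: has_lap_def \<sigma>_def[symmetric])
qed

text \<open>The difference of \<open>h\<close> and its mirror image vanishes on the mirror, so a barrier bounds it by the
  distance to the mirror.\<close>

lemma difference_across_mirror:
  fixes p b :: "'a::euclidean_space"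
  assumes R: "R > 0" and b: "b \<in> Basis" and c: "continuous_on (cball p R) h"
    and h: "\<And>x. x \<in> cball p R \<Longrightarrow> 0 \<le> h x \<and> h x \<le> 2"
    and lap: "\<And>x. x \<in> ball p R \<Longrightarrow> \<exists>L. \<bar>L\<bar> \<le> 1 \<and> has_lap h x L"
    and t: "0 \<le> t" "t \<le> R"
  shows "h (p + t *\<^sub>R b) - h (p - t *\<^sub>R b) \<le> ((2 * DIM('a) / R\<^sup>2 + 2) * R + 2 / R) * t"
proof -
  define n where "n = real DIM('a)"
  define \<sigma> where "\<sigma> x = x - (2 * ((x - p) \<bullet> b)) *\<^sub>R b" for x
  define B where "B = 2 * n / R\<^sup>2 + 2"
  \<comment> \<open>Laplacian -4, against at most 2 in absolute value for \<open>h\<close> minus its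
    mirror image. On the outer sphere the quadratic term alone reaches 2, the bound for
    \<open>h\<close>; on the mirror the barrier is nonnegative. A negative minimum of
    \<open>\<Phi>\<close> would therefore be interior.\<close>
  define \<beta> where "\<beta> x = B * R * ((x - p) \<bullet> b) - B * ((x - p) \<bullet> b)\<^sup>2 + 2 / R\<^sup>2 * (norm (x - p))\<^sup>2" for x
  define \<Phi> where "\<Phi> x = \<beta> x - (h x - h (\<sigma> x))" for x
  define Q where "Q = cball p R \<inter> {x. 0 \<le> (x - p) \<bullet> b}"
  have B: "B \<ge> 0" using R by (simp add: B_def n_def)
  have bb: "b \<bullet> b = 1" using b by (simp add: inner_Basis)
  have "(norm (\<sigma> x - p))\<^sup>2 = (norm (x - p))\<^sup>2" for x
    unfolding power2_norm_eq_inner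
    by (simp add: \<sigma>_def inner_diff_left inner_diff_right bb inner_commute algebra_simps)
  then have \<sigma>: "norm (\<sigma> x - p) = norm (x - p)" for x by (simp add: power2_eq_iff_nonneg)
  then have \<sigma>b: "\<sigma> x \<in> ball p R \<longleftrightarrow> x \<in> ball p R" "\<sigma> x \<in> cball p R \<longleftrightarrow> x \<in> cball p R" for x
    by (simp_all add: dist_norm norm_minus_commute)
  have pos: "\<Phi> x \<ge> 0" if xQ: "x \<in> Q" for x
  proof (rule ccontr)
    assume neg: "\<not> \<Phi> x \<ge> 0"
    have "compact Q" unfolding Q_def
      by (intro compact_Int_closed closed_Collect_le continuous_intros) auto
    moreover have "continuous_on Q \<Phi>"
    proof -
      have "continuous_on (cball p R) (\<lambda>x. h (\<sigma> x))"
      proof (rule continuous_on_compose2[OF c])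
        show "continuous_on (cball p R) \<sigma>" unfolding \<sigma>_def[abs_def] by (intro continuous_intros)
      qed (auto simp: \<sigma>b(2) simp del: mem_cball)
      then have "continuous_on (cball p R) \<Phi>"
        unfolding \<Phi>_def[abs_def] \<beta>_def by (intro continuous_intros c)
      then show ?thesis by (rule continuous_on_subset) (auto simp: Q_def)
    qed
    ultimately obtain y where y: "y \<in> Q" "\<And>z. z \<in> Q \<Longrightarrow> \<Phi> y \<le> \<Phi> z"
      using continuous_attains_inf[of Q \<Phi>] xQ by blast
    have yneg: "\<Phi> y < 0" using y(2)[OF xQ] neg by simp
    define \<xi> where "\<xi> = (y - p) \<bullet> b"
    have \<xi>: "0 \<le> \<xi>" "\<xi> \<le> norm (y - p)" "norm (y - p) \<le> R"
      using y(1) Basis_le_norm[OF b, of "y - p"] by (auto simp: Q_def \<xi>_def dist_norm norm_minus_commute)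
    have "B * \<xi> * \<xi> \<le> B * \<xi> * R" using \<xi> B by (intro mult_left_mono) auto
    then have \<beta>y: "\<beta> y \<ge> 2 / R\<^sup>2 * (norm (y - p))\<^sup>2"
      by (simp add: \<beta>_def \<xi>_def[symmetric] power2_eq_square mult_ac)
    have "\<xi> \<noteq> 0"
    proof
      assume "\<xi> = 0"
      then have "\<sigma> y = y" by (simp add: \<sigma>_def \<xi>_def)
      moreover have "0 \<le> \<beta> y" using order_trans[OF _ \<beta>y] by simp
      ultimately show False using yneg by (simp add: \<Phi>_def)
    qed
    moreover have "norm (y - p) \<noteq> R"
    proof
      assume "norm (y - p) = R"
      then have "\<beta> y \<ge> 2" using \<beta>y R by simp
      moreover have "h y \<le> 2" "h (\<sigma> y) \<ge> 0" using h y(1) \<sigma>b by (auto simp: Q_def simp del: mem_cball)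
      ultimately show False using yneg by (simp add: \<Phi>_def)
    qed
    ultimately have yi: "y \<in> ball p R" "0 < (y - p) \<bullet> b"
      using \<xi> by (auto simp: \<xi>_def dist_norm norm_minus_commute)
    have "open (ball p R \<inter> {x. 0 < (x - p) \<bullet> b})"
      by (intro open_Int open_Collect_less continuous_intros) auto
    then have "\<forall>\<^sub>F z in nhds y. z \<in> ball p R \<inter> {x. 0 < (x - p) \<bullet> b}"
      using yi by (intro eventually_nhds_in_open) auto
    then have m: "\<forall>\<^sub>F z in nhds y. \<Phi> y \<le> \<Phi> z"
      by (rule eventually_mono) (rule y(2), auto simp: Q_def)
    obtain L1 where L1: "\<bar>L1\<bar> \<le> 1" "has_lap h y L1" using lap[OF yi(1)] by blast
    obtain L2 where L2: "\<bar>L2\<bar> \<le> 1" "has_lap h (\<sigma> y) L2" using lap yi(1) \<sigma>b by blast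
    have "has_lap \<Phi> y ((B * R * 0 - B * 2 + 2 / R\<^sup>2 * (2 * DIM('a))) - (L1 - L2))"
      unfolding \<Phi>_def[abs_def] \<beta>_def
      using has_lap_reflect[OF b, of h y p L2] L1(2) L2(2) b
      by (intro has_lap_diff has_lap_add has_lap_cmult has_lap_inner has_lap_inner_square
          has_lap_norm_square) (auto simp: \<sigma>_def[abs_def])
    from has_lap_local_min[OF m this] show False
      using L1(1) L2(1) by (simp add: B_def n_def)
  qed
  define y where "y = p + t *\<^sub>R b"
  have y: "(y - p) \<bullet> b = t" "norm (y - p) = t" "y \<in> Q" "\<sigma> y = p - t *\<^sub>R b"
    using t b by (auto simp: y_def bb Q_def \<sigma>_def dist_norm algebra_simps scaleR_add_self)
  have "h y - h (\<sigma> y) \<le> \<beta> y" using pos[OF y(3)] by (simp add: \<Phi>_def)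
  also have "\<dots> \<le> B * R * t + 2 / R\<^sup>2 * t\<^sup>2" using B by (simp add: \<beta>_def y)
  also have "2 / R\<^sup>2 * t\<^sup>2 \<le> 2 / R\<^sup>2 * (R * t)" using t R by (intro mult_left_mono) (auto simp: power2_eq_square mult_right_mono)
  also have "2 / R\<^sup>2 * (R * t) = 2 / R * t" using R by (simp add: power2_eq_square)
  finally show ?thesis by (simp add: y(4)) (simp add: y_def B_def n_def algebra_simps)
qed

text \<open>A gradient bound by reflection: \<open>x\<close> and \<open>y\<close> are joined by
  changing one coordinate at a time, and the ends of each segment are mirror images in the
  hyperplane through its midpoint.\<close>

lemma interior_lipschitz:
  assumes R: "R > 0"
  shows "\<exists>C>0. \<forall>(p::'a::euclidean_space) h x y.
    continuous_on (cball p R) h \<longrightarrow> (\<forall>x\<in>cball p R. 0 \<le> h x \<and> h x \<le> 2) \<longrightarrow>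
    (\<forall>x\<in>ball p R. \<exists>L. \<bar>L\<bar> \<le> 1 \<and> has_lap h x L) \<longrightarrow>
    x \<in> cball p (R / 4) \<longrightarrow> norm (y - x) \<le> R / 4 \<longrightarrow> \<bar>h y - h x\<bar> \<le> C * norm (y - x)"
proof -
  define r where "r = R / 2"
  define C where "C = (2 * DIM('a) / r\<^sup>2 + 2) * r + 2 / r"
  have r: "r > 0" using R by (simp add: r_def)
  have C: "C > 0" using r by (auto simp: C_def intro!: add_pos_pos mult_pos_pos add_nonneg_pos)
  show ?thesis
  proof (intro exI[of _ "C * DIM('a)"] conjI allI impI)
    show "C * DIM('a) > 0" using C by simp
    fix p x y :: 'a and h
    assume cont: "continuous_on (cball p R) h" and h: "\<forall>x\<in>cball p R. 0 \<le> h x \<and> h x \<le> 2"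
      and lap: "\<forall>x\<in>ball p R. \<exists>L. \<bar>L\<bar> \<le> 1 \<and> has_lap h x L"
      and x: "x \<in> cball p (R / 4)" and y: "norm (y - x) \<le> R / 4"
    have step: "\<bar>h (m + t *\<^sub>R b) - h (m - t *\<^sub>R b)\<bar> \<le> C * \<bar>t\<bar>"
      if m: "m \<in> cball p r" and b: "b \<in> Basis" and t: "\<bar>t\<bar> \<le> r" for m b t
    proof -
      have sub: "cball m r \<subseteq> cball p R" "ball m r \<subseteq> ball p R"
      proof -
        have "dist m p \<le> r" using m by (simp add: dist_commute)
        then have "dist m p + r \<le> R" unfolding r_def by linarith
        then show "cball m r \<subseteq> cball p R" "ball m r \<subseteq> ball p R"
          unfolding cball_subset_cball_iff ball_subset_ball_iff by blast+
      qed
      have *: "h (m + t *\<^sub>R b) - h (m - t *\<^sub>R b) \<le> C * t" if "0 \<le> t" "t \<le> r" for t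
        unfolding C_def
      proof (rule difference_across_mirror[OF r b continuous_on_subset[OF cont sub(1)] _ _ that])
        show "0 \<le> h x \<and> h x \<le> 2" if "x \<in> cball m r" for x
          using h subsetD[OF sub(1) that] by (rule bspec)
        show "\<exists>L. \<bar>L\<bar> \<le> 1 \<and> has_lap h x L" if "x \<in> ball m r" for x
          using lap subsetD[OF sub(2) that] by (rule bspec)
      qed
      \<comment> \<open>The opposite inequality follows by applying the mirror estimate to the
        reflected function, which obeys the same hypotheses.\<close>
      have **: "h (m - t *\<^sub>R b) - h (m + t *\<^sub>R b) \<le> C * t" if t: "0 \<le> t" "t \<le> r" for t
      proof -
        define \<sigma> where "\<sigma> x = x - (2 * ((x - m) \<bullet> b)) *\<^sub>R b" for x
        have bb: "b \<bullet> b = 1" using b by (simp add: inner_Basis)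
        have "(norm (\<sigma> x - m))\<^sup>2 = (norm (x - m))\<^sup>2" for x
          unfolding power2_norm_eq_inner
          by (simp add: \<sigma>_def inner_diff_left inner_diff_right bb inner_commute algebra_simps)
        then have "norm (\<sigma> x - m) = norm (x - m)" for x by (simp add: power2_eq_iff_nonneg)
        then have \<sigma>b: "\<sigma> x \<in> ball m r \<longleftrightarrow> x \<in> ball m r" "\<sigma> x \<in> cball m r \<longleftrightarrow> x \<in> cball m r" for x
          by (simp_all add: dist_norm norm_minus_commute)
        have "h (\<sigma> (m + t *\<^sub>R b)) - h (\<sigma> (m - t *\<^sub>R b)) \<le> C * t"
          unfolding C_def
        proof (rule difference_across_mirror[OF r b _ _ _ t])
          show "continuous_on (cball m r) (\<lambda>x. h (\<sigma> x))"
          proof (rule continuous_on_compose2[OF continuous_on_subset[OF cont sub(1)]])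
            show "continuous_on (cball m r) \<sigma>" unfolding \<sigma>_def[abs_def] by (intro continuous_intros)
          qed (auto simp: \<sigma>b(2) simp del: mem_cball)
          show "0 \<le> h (\<sigma> x) \<and> h (\<sigma> x) \<le> 2" if "x \<in> cball m r" for x
            using h subsetD[OF sub(1)] that \<sigma>b(2) by (simp del: mem_cball)
          show "\<exists>L. \<bar>L\<bar> \<le> 1 \<and> has_lap (\<lambda>x. h (\<sigma> x)) x L" if "x \<in> ball m r" for x
          proof -
            have "\<sigma> x \<in> ball p R" using subsetD[OF sub(2)] that \<sigma>b(1) by (simp del: mem_ball)
            then obtain L where "\<bar>L\<bar> \<le> 1" "has_lap h (\<sigma> x) L" using lap by blast
            then show ?thesis using has_lap_reflect[OF b, of h x m L] by (auto simp: \<sigma>_def)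
          qed
        qed
        moreover have "\<sigma> (m + t *\<^sub>R b) = m - t *\<^sub>R b" "\<sigma> (m - t *\<^sub>R b) = m + t *\<^sub>R b"
          by (auto simp: \<sigma>_def bb algebra_simps scaleR_add_self)
        ultimately show ?thesis by simp
      qed
      show ?thesis
        using *[of t] **[of t] *[of "- t"] **[of "- t"] t by (cases "t \<ge> 0") auto
    qed
    define v where "v = y - x"
    \<comment> \<open>Partial sums of the coordinate expansion are no longer than \<open>v\<close>,
      so the corners of the path stay within \<open>R / 4\<close> of \<open>x\<close>.\<close>
    have part: "norm (\<Sum>b\<in>F. (v \<bullet> b) *\<^sub>R b) \<le> norm v" if "F \<subseteq> Basis" for F
    proof -
      have "(norm (\<Sum>b\<in>F. (v \<bullet> b) *\<^sub>R b))\<^sup>2 = (\<Sum>b\<in>F. (v \<bullet> b)\<^sup>2)"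
      proof (subst norm_sum_Pythagorean)
        show "finite F" using that finite_subset[OF that finite_Basis] by simp
        show "pairwise (\<lambda>i j. orthogonal ((v \<bullet> i) *\<^sub>R i) ((v \<bullet> j) *\<^sub>R j)) F"
          using that by (auto simp: pairwise_def orthogonal_def subset_iff inner_not_same_Basis)
        show "(\<Sum>i\<in>F. (norm ((v \<bullet> i) *\<^sub>R i))\<^sup>2) = (\<Sum>b\<in>F. (v \<bullet> b)\<^sup>2)"
          using that by (intro sum.cong) (auto simp: subset_iff)
      qed
      also have "\<dots> \<le> (\<Sum>b\<in>Basis. (v \<bullet> b)\<^sup>2)" using that by (intro sum_mono2) auto
      also have "\<dots> = (norm v)\<^sup>2" by (rule sum_Basis_inner_square)
      finally show ?thesis by (simp add: power2_le_iff_abs_le)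
    qed
    have "\<bar>h (x + (\<Sum>b\<in>F. (v \<bullet> b) *\<^sub>R b)) - h x\<bar> \<le> C * norm v * card F" if "F \<subseteq> Basis" for F
      using finite_subset[OF that finite_Basis] that
    proof (induction F rule: finite_induct)
      case (insert c F)
      define z where "z = x + (\<Sum>b\<in>F. (v \<bullet> b) *\<^sub>R b)"
      define t where "t = (v \<bullet> c) / 2"
      have c: "c \<in> Basis" using insert by auto
      have "\<bar>v \<bullet> c\<bar> \<le> norm v" using Basis_le_norm[OF c] .
      then have t: "\<bar>t\<bar> \<le> R / 8" "\<bar>t\<bar> \<le> norm v" using y by (auto simp: t_def v_def)
      have zx: "norm (z - x) \<le> R / 4" using part[of F] insert y by (simp add: z_def v_def)
      have e: "x + (\<Sum>b\<in>insert c F. (v \<bullet> b) *\<^sub>R b) = (z + t *\<^sub>R c) + t *\<^sub>R c"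
        using insert(1,2) by (simp add: z_def t_def add_ac flip: scaleR_add_left)
      \<comment> \<open>The midpoint of the segment averages two corners, so it too is within
        \<open>R / 4\<close> of \<open>x\<close>, and within \<open>r = R / 2\<close> of
        \<open>p\<close>.\<close>
      have "(z + 2 *\<^sub>R t *\<^sub>R c) - x = (\<Sum>b\<in>insert c F. (v \<bullet> b) *\<^sub>R b)"
        unfolding scaleR_2 by (rule iffD2[OF diff_eq_eq]) (metis e add.commute add.assoc)
      then have "norm ((z + 2 *\<^sub>R t *\<^sub>R c) - x) \<le> R / 4"
        using part[OF insert.prems] y unfolding v_def by simp
      then have "norm ((z - x) + ((z + 2 *\<^sub>R t *\<^sub>R c) - x)) \<le> R / 4 + R / 4"
        using zx by (intro order_trans[OF norm_triangle_ineq]) auto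
      moreover have "(z - x) + ((z + 2 *\<^sub>R t *\<^sub>R c) - x) = 2 *\<^sub>R ((z + t *\<^sub>R c) - x)"
        by (simp add: scaleR_2 algebra_simps)
      ultimately have "norm ((z + t *\<^sub>R c) - x) \<le> R / 4" by simp
      then have "dist p (z + t *\<^sub>R c) \<le> r"
        using x dist_triangle[of p "z + t *\<^sub>R c" x] by (simp add: r_def dist_norm norm_minus_commute)
      then have "\<bar>h ((z + t *\<^sub>R c) + t *\<^sub>R c) - h ((z + t *\<^sub>R c) - t *\<^sub>R c)\<bar> \<le> C * \<bar>t\<bar>"
        using t R by (intro step c) (auto simp: r_def)
      also have "\<dots> \<le> C * norm v" using t C by simp
      finally have "\<bar>h (x + (\<Sum>b\<in>insert c F. (v \<bullet> b) *\<^sub>R b)) - h z\<bar> \<le> C * norm v" unfolding e by simp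
      moreover have "\<bar>h z - h x\<bar> \<le> C * norm v * card F" using insert unfolding z_def by auto
      ultimately show ?case using insert(1,2) by (simp add: algebra_simps)
    qed simp
    from this[of Basis] show "\<bar>h y - h x\<bar> \<le> C * DIM('a) * norm (y - x)"
      by (simp add: euclidean_representation v_def mult_ac)
  qed
qed

text \<open>The Gaussian barrier \<open>\<delta> * (exp (- K * (norm (y - q))\<^sup>2) - c)\<close>
  vanishes on the outer sphere, is at most \<open>\<delta>\<close> on the inner ball, and is
  strictly subharmonic between them. The constant does not depend on
  \<open>\<delta>\<close>.\<close>

lemma annulus_barrier:
  assumes r: "0 < r" "r < R"
  shows "\<exists>\<kappa>>0. \<forall>(q::'a::euclidean_space) h \<delta>. \<delta> > 0 \<longrightarrow>
    continuous_on (cball q R) h \<longrightarrow> (\<forall>x\<in>cball q R. 0 \<le> h x) \<longrightarrow>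
    (\<forall>x\<in>ball q R. \<exists>L\<le>\<kappa> * \<delta>. has_lap h x L) \<longrightarrow> (\<forall>x\<in>cball q r. \<delta> \<le> h x) \<longrightarrow>
    (\<forall>x\<in>cball q (R / 2). \<kappa> * \<delta> \<le> h x)"
proof -
  define n where "n = real DIM('a)"
  \<comment> \<open>Chosen so that \<open>4 * K * r\<^sup>2 = 2 * n + 2\<close>: outside the inner
    ball the Laplacian of the Gaussian is then at least \<open>2 * K\<close> times its
    value.\<close>
  define K where "K = (n + 1) / (2 * r\<^sup>2)"
  have K: "K > 0" using r by (simp add: K_def n_def add_nonneg_pos)
  have Kr: "4 * K * r\<^sup>2 = 2 * n + 2" using r by (simp add: K_def field_simps)
  define c where "c = exp (- K * R\<^sup>2)"
  define m where "m = exp (- K * (R / 2)\<^sup>2) - c"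
  have "(R / 2)\<^sup>2 < R\<^sup>2" using r by (simp add: power_divide)
  then have m: "m > 0" using K by (simp add: m_def c_def)
  have c0: "c > 0" by (simp add: c_def)
  \<comment> \<open>\<open>m\<close> is the least height of the barrier on the half ball, per unit
    of \<open>\<delta>\<close>; \<open>c * K\<close> is half the lower bound
    \<open>2 * c * K\<close> for its Laplacian on the annulus.\<close>
  define \<kappa> where "\<kappa> = Min {m, c * K, 1}"
  have \<kappa>: "\<kappa> > 0" "\<kappa> \<le> m" "\<kappa> \<le> c * K" "\<kappa> \<le> 1" using m K c0 by (auto simp: \<kappa>_def)
  show ?thesis
  proof (intro exI[of _ \<kappa>] conjI allI impI ballI \<kappa>(1))
    fix q x :: 'a and h and \<delta> :: real
    assume d: "\<delta> > 0" and cont: "continuous_on (cball q R) h" and h: "\<forall>x\<in>cball q R. 0 \<le> h x"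
      and lap: "\<forall>x\<in>ball q R. \<exists>L\<le>\<kappa> * \<delta>. has_lap h x L" and hd: "\<forall>x\<in>cball q r. \<delta> \<le> h x"
      and x: "x \<in> cball q (R / 2)"
    define \<beta> where "\<beta> y = \<delta> * (exp (- K * (norm (y - q))\<^sup>2) - c)" for y
    define \<Phi> where "\<Phi> y = h y - \<beta> y" for y
    have e1: "exp (- K * (norm (y - q))\<^sup>2) \<le> 1" for y using K by simp
    have \<beta>1: "\<beta> y \<le> \<delta>" for y
    proof -
      have "exp (- K * (norm (y - q))\<^sup>2) - c \<le> 1" using c0 e1[of y] by linarith
      then have "\<delta> * (exp (- K * (norm (y - q))\<^sup>2) - c) \<le> \<delta> * 1" using d by (intro mult_left_mono) auto
      then show ?thesis by (simp add: \<beta>_def)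
    qed
    have pos: "\<Phi> z \<ge> 0" if z: "z \<in> cball q R" for z
    proof (rule ccontr)
      assume neg: "\<not> \<Phi> z \<ge> 0"
      have "continuous_on (cball q R) \<Phi>"
        unfolding \<Phi>_def[abs_def] \<beta>_def by (intro continuous_intros cont)
      then obtain y where y: "y \<in> cball q R" "\<And>z. z \<in> cball q R \<Longrightarrow> \<Phi> y \<le> \<Phi> z"
        using continuous_attains_inf[of "cball q R" \<Phi>] z by (metis compact_cball empty_iff)
      have yneg: "\<Phi> y < 0" using y(2)[OF z] neg by simp
      have yr: "r < norm (y - q)"
      proof (rule ccontr)
        assume "\<not> r < norm (y - q)"
        then have "\<delta> \<le> h y" using hd by (simp add: dist_norm norm_minus_commute)
        then show False using \<beta>1[of y] yneg by (simp add: \<Phi>_def)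
      qed
      have "norm (y - q) \<noteq> R"
      proof
        assume "norm (y - q) = R"
        then have "\<beta> y = 0" by (simp add: \<beta>_def c_def)
        then show False using yneg bspec[OF h y(1)] by (simp add: \<Phi>_def)
      qed
      then have yR: "y \<in> ball q R" using y(1) by (simp add: dist_norm norm_minus_commute)
      then have "\<forall>\<^sub>F z in nhds y. z \<in> ball q R" by (intro eventually_nhds_in_open) auto
      then have min: "\<forall>\<^sub>F z in nhds y. \<Phi> y \<le> \<Phi> z" by (rule eventually_mono) (use y(2) in auto)
      obtain L where L: "L \<le> \<kappa> * \<delta>" "has_lap h y L" using lap yR by blast
      define E where "E = exp (- K * (norm (y - q))\<^sup>2)"
      have "has_lap \<Phi> y (L - \<delta> * (E * (4 * K\<^sup>2 * (norm (y - q))\<^sup>2 - 2 * K * DIM('a)) - 0))"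
        unfolding \<Phi>_def[abs_def] \<beta>_def E_def
        by (intro has_lap_diff has_lap_cmult has_lap_gaussian has_lap_const L)
      from has_lap_local_min[OF min this]
      have l: "\<delta> * (E * (4 * K\<^sup>2 * (norm (y - q))\<^sup>2 - 2 * K * n)) \<le> \<kappa> * \<delta>" using L by (simp add: n_def)
      have Ec: "c \<le> E" using K y(1) r by (auto simp: c_def E_def dist_norm norm_minus_commute intro!: power_mono)
      have "r\<^sup>2 \<le> (norm (y - q))\<^sup>2" using yr r by (intro power_mono) auto
      then have "4 * K * (norm (y - q))\<^sup>2 \<ge> 2 * n + 2" using K unfolding Kr[symmetric] by simp
      then have "K * 2 \<le> K * (4 * K * (norm (y - q))\<^sup>2 - 2 * n)" using K by (intro mult_left_mono) auto
      then have "c * (K * 2) \<le> E * (K * (4 * K * (norm (y - q))\<^sup>2 - 2 * n))"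
        using Ec c0 K by (intro mult_mono) auto
      also have "\<dots> = E * (4 * K\<^sup>2 * (norm (y - q))\<^sup>2 - 2 * K * n)" by (simp add: power2_eq_square algebra_simps)
      finally have "\<delta> * (c * (K * 2)) \<le> \<kappa> * \<delta>" using l d mult_left_mono[of _ _ \<delta>] by (meson less_imp_le order_trans)
      then have "c * (K * 2) \<le> \<kappa>" using d by (simp add: mult.commute[of \<delta>])
      then show False using \<kappa> c0 K mult_pos_pos[of c K] by linarith
    qed
    have xn: "norm (x - q) \<le> R / 2" using x by (simp add: dist_norm norm_minus_commute)
    then have "(norm (x - q))\<^sup>2 \<le> (R / 2)\<^sup>2" by (intro power_mono) auto
    then have "m \<le> exp (- K * (norm (x - q))\<^sup>2) - c" using K by (simp add: m_def)
    then have "\<delta> * m \<le> \<beta> x" unfolding \<beta>_def using d by (intro mult_left_mono) auto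
    moreover have "\<beta> x \<le> h x" using pos[of x] x r by (simp add: \<Phi>_def)
    moreover have "\<kappa> * \<delta> \<le> \<delta> * m" using \<kappa> d by (simp add: mult.commute)
    ultimately show "\<kappa> * \<delta> \<le> h x" by linarith
  qed
qed

text \<open>If \<open>h q > \<delta>\<close>, the Lipschitz bound keeps \<open>h\<close> above
  \<open>\<delta> / 2\<close> on a small ball about \<open>q\<close>. The barrier carries this
  positivity to the ball of radius \<open>R / 4\<close> about \<open>q\<close>, which contains
  \<open>p\<close>, so \<open>h p\<close> cannot be tiny.\<close>

lemma harnack:
  assumes R: "R > 0" and d: "\<delta> > 0"
  shows "\<exists>\<kappa>>0. \<forall>(p::'a::euclidean_space) h.
    continuous_on (cball p R) h \<longrightarrow> (\<forall>x\<in>cball p R. 0 \<le> h x \<and> h x \<le> 2) \<longrightarrow>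
    (\<forall>x\<in>ball p R. \<exists>L. \<bar>L\<bar> \<le> \<kappa> \<and> has_lap h x L) \<longrightarrow> h p \<le> \<kappa> \<longrightarrow>
    (\<forall>x\<in>cball p (R / 4). h x \<le> \<delta>)"
proof -
  obtain C where C: "C > 0" and lip: "\<And>p h x y. continuous_on (cball p R) h \<Longrightarrow>
      (\<forall>x\<in>cball p R. 0 \<le> h x \<and> h x \<le> 2) \<Longrightarrow>
      (\<forall>x\<in>ball p R. \<exists>L. \<bar>L\<bar> \<le> 1 \<and> has_lap h x L) \<Longrightarrow>
      x \<in> cball p (R / 4) \<Longrightarrow> norm (y - x) \<le> R / 4 \<Longrightarrow> \<bar>h y - h (x::'a)\<bar> \<le> C * norm (y - x)"
    using interior_lipschitz[OF R, where 'a = 'a] by metis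
  \<comment> \<open>Over distance \<open>r\<close> the Lipschitz bound loses at most
    \<open>\<delta> / 2\<close>.\<close>
  define r where "r = min (R / 4) (\<delta> / (2 * C))"
  have r: "0 < r" "r < R / 2" "r \<le> R / 4" "C * r \<le> \<delta> / 2"
    using R C d by (auto simp: r_def min_def field_simps)
  obtain k where k: "k > 0" and bar: "\<And>q h d. d > 0 \<Longrightarrow>
      continuous_on (cball q (R / 2)) h \<Longrightarrow> (\<forall>x\<in>cball q (R / 2). 0 \<le> h x) \<Longrightarrow>
      (\<forall>x\<in>ball q (R / 2). \<exists>L\<le>k * d. has_lap h x L) \<Longrightarrow> (\<forall>x\<in>cball q r. d \<le> h x) \<Longrightarrow>
      (\<forall>x\<in>cball (q::'a) (R / 2 / 2). k * d \<le> h x)"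
    using annulus_barrier[OF r(1,2), where 'a = 'a] by metis
  define \<kappa> where "\<kappa> = min 1 (k * \<delta> / 4)"
  have \<kappa>: "\<kappa> > 0" "\<kappa> \<le> 1" "\<kappa> < k * (\<delta> / 2)" using k d by (auto simp: \<kappa>_def min_def)
  show ?thesis
  proof (intro exI[of _ \<kappa>] conjI allI impI ballI \<kappa>(1))
    fix p q :: 'a and h
    assume cont: "continuous_on (cball p R) h" and h: "\<forall>x\<in>cball p R. 0 \<le> h x \<and> h x \<le> 2"
      and lap: "\<forall>x\<in>ball p R. \<exists>L. \<bar>L\<bar> \<le> \<kappa> \<and> has_lap h x L" and hp: "h p \<le> \<kappa>"
      and q: "q \<in> cball p (R / 4)"
    show "h q \<le> \<delta>"
    proof (rule ccontr)
      assume hq: "\<not> h q \<le> \<delta>"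
      have lap1: "\<forall>x\<in>ball p R. \<exists>L. \<bar>L\<bar> \<le> 1 \<and> has_lap h x L" using lap \<kappa>(2) order_trans by blast
      have near: "\<delta> / 2 \<le> h y" if "y \<in> cball q r" for y
      proof -
        have n: "norm (y - q) \<le> r" using that by (simp add: dist_norm norm_minus_commute)
        then have "\<bar>h y - h q\<bar> \<le> C * norm (y - q)" using r by (intro lip[OF cont h lap1 q]) auto
        also have "\<dots> \<le> C * r" using n C by simp
        finally show ?thesis using r hq by simp
      qed
      have sub: "cball q (R / 2) \<subseteq> cball p R" "ball q (R / 2) \<subseteq> ball p R"
      proof -
        have "dist q p \<le> R / 4" using q by (simp add: dist_commute)
        then have "dist q p + R / 2 \<le> R" using R by linarith
        then show "cball q (R / 2) \<subseteq> cball p R" "ball q (R / 2) \<subseteq> ball p R"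
          unfolding cball_subset_cball_iff ball_subset_ball_iff by blast+
      qed
      have l2: "\<exists>L\<le>k * (\<delta> / 2). has_lap h x L" if x: "x \<in> ball q (R / 2)" for x
      proof -
        obtain L where "\<bar>L\<bar> \<le> \<kappa>" "has_lap h x L" using lap x sub by blast
        then show ?thesis using \<kappa>(3) by (intro exI[of _ L]) auto
      qed
      have "k * (\<delta> / 2) \<le> h p"
        using bar[of "\<delta> / 2" q h] d h sub near l2 continuous_on_subset[OF cont sub(1)] q
        by (auto simp: dist_commute subset_iff)
      then show False using hp \<kappa> by linarith
    qed
  qed
qed


subsection \<open>A Hopf lemma for the Neumann condition\<close>

text \<open>The barrier \<open>exp (- K j y) - A |y - p|\<^sup>2\<close> is subharmonic for large \<open>K\<close>, has negative normal
  derivative on \<open>j = 0\<close>, and is nonpositive at distance \<open>s\<close> from \<open>p\<close> as long as \<open>- 1 / K \<le> j\<close>.\<close>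

lemma hopf_barrier:
  fixes c C s :: real
  assumes c: "c > 0" and C: "C > 0" and s: "s > 0"
  shows "\<exists>\<tau>>0. \<exists>\<theta>>0. \<forall>(p::'a::euclidean_space) j N d Q k \<delta>. \<delta> > 0 \<longrightarrow> compact Q \<longrightarrow> Q \<subseteq> cball p s \<longrightarrow>
    (\<forall>y\<in>Q. j y \<le> 0) \<longrightarrow> (\<forall>y\<in>cball p s. j y < 0 \<longrightarrow> y \<in> Q) \<longrightarrow>
    (\<forall>y\<in>cball p s. (j has_derivative (\<lambda>v. N y \<bullet> v)) (at y)) \<longrightarrow>
    (\<forall>y\<in>cball p s. \<forall>b\<in>Basis. D2 (\<lambda>t. j (y + t *\<^sub>R b)) (N y \<bullet> b) (d y b)) \<longrightarrow>
    (\<forall>y\<in>cball p s. \<bar>\<Sum>b\<in>Basis. d y b\<bar> \<le> C) \<longrightarrow> (\<forall>y\<in>cball p s. c \<le> norm (N y)) \<longrightarrow>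
    continuous_on Q k \<longrightarrow> (\<forall>y\<in>Q. 0 \<le> k y) \<longrightarrow>
    (\<forall>y\<in>Q. j y < 0 \<longrightarrow> k y < \<delta> \<longrightarrow> (\<exists>L\<le>\<theta> * \<delta>. has_lap k y L)) \<longrightarrow>
    (\<forall>y\<in>Q. j y = 0 \<longrightarrow> ((\<lambda>t. k (y + t *\<^sub>R N y)) has_real_derivative 0) (at 0)) \<longrightarrow>
    (\<forall>y\<in>Q. j y = - \<tau> \<longrightarrow> \<delta> \<le> k y) \<longrightarrow>
    (\<forall>y\<in>Q. - \<tau> \<le> j y \<longrightarrow> dist p y \<le> \<theta> \<longrightarrow> \<theta> * \<delta> \<le> k y)"
proof -
  define n where "n = real DIM('a)"
  have n: "n > 0" by (simp add: n_def)
  define E where "E = exp (1::real)"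
  have E: "E > 0" by (simp add: E_def)
  \<comment> \<open>The largest value of \<open>exp (- K * j y)\<close> with
    \<open>- 1 / K \<le> j y\<close> is \<open>E\<close>; at distance \<open>s\<close> the
    subtracted square equals it.\<close>
  define A where "A = E / s\<^sup>2"
  have A: "A > 0" "A * s\<^sup>2 = E" using E s by (auto simp: A_def)
  \<comment> \<open>The second summand lets the normal derivative of the exponential beat that of
    the square; the third makes the Laplacian of the barrier positive despite the bound
    \<open>C\<close> for that of \<open>j\<close>.\<close>
  define K where "K = 1 + 2 * A * s / c + (C + 2 * n * A + 1) / c\<^sup>2"
  have K1: "K \<ge> 1" using A s c C n by (auto simp: K_def intro!: add_nonneg_nonneg)
  have Kc: "K * c > 2 * A * s"
  proof -
    have "(2 * A * s / c) * c + c \<le> K * c"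
      using A s c C n by (simp add: K_def distrib_right)
    then show ?thesis using c by simp
  qed
  have Kc2: "K * c\<^sup>2 \<ge> C + 2 * n * A + 1"
  proof -
    have "((C + 2 * n * A + 1) / c\<^sup>2) * c\<^sup>2 \<le> K * c\<^sup>2"
      using A s c C n by (intro mult_right_mono) (auto simp: K_def)
    then show ?thesis using c by simp
  qed
  define \<tau> where "\<tau> = 1 / K"
  have \<tau>: "\<tau> > 0" "K * \<tau> = 1" using K1 by (auto simp: \<tau>_def)
  \<comment> \<open>\<open>1 / (2 * A)\<close> and 1 keep the subtracted square below
    \<open>1 / 2\<close> near \<open>p\<close>, leaving barrier height at least
    \<open>\<delta> / (2 * E)\<close>; \<open>1 / (2 * E)\<close> matches this height and is below
    the Laplacian of the barrier per unit of \<open>\<delta>\<close>.\<close>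
  define \<theta> where "\<theta> = Min {1 / (2 * E), 1 / (2 * A), 1}"
  have \<theta>: "\<theta> > 0" "\<theta> \<le> 1 / (2 * E)" "\<theta> \<le> 1 / (2 * A)" "\<theta> \<le> 1" using E A by (auto simp: \<theta>_def)
  show ?thesis
  proof (rule exI[of _ \<tau>], rule conjI[OF \<tau>(1)], rule exI[of _ \<theta>], rule conjI[OF \<theta>(1)],
      intro allI impI ballI)
    fix p x :: 'a and j N d Q k and \<delta> :: real
    assume \<delta>: "\<delta> > 0" and Q: "compact Q" "Q \<subseteq> cball p s"
      and j0: "\<forall>y\<in>Q. j y \<le> 0" and jQ: "\<forall>y\<in>cball p s. j y < 0 \<longrightarrow> y \<in> Q"
      and jd: "\<forall>y\<in>cball p s. (j has_derivative (\<lambda>v. N y \<bullet> v)) (at y)"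
      and j2: "\<forall>y\<in>cball p s. \<forall>b\<in>Basis. D2 (\<lambda>t. j (y + t *\<^sub>R b)) (N y \<bullet> b) (d y b)"
      and dC: "\<forall>y\<in>cball p s. \<bar>\<Sum>b\<in>Basis. d y b\<bar> \<le> C" and Nc: "\<forall>y\<in>cball p s. c \<le> norm (N y)"
      and kc: "continuous_on Q k" and k0: "\<forall>y\<in>Q. 0 \<le> k y"
      and lap: "\<forall>y\<in>Q. j y < 0 \<longrightarrow> k y < \<delta> \<longrightarrow> (\<exists>L\<le>\<theta> * \<delta>. has_lap k y L)"
      and neu: "\<forall>y\<in>Q. j y = 0 \<longrightarrow> ((\<lambda>t. k (y + t *\<^sub>R N y)) has_real_derivative 0) (at 0)"
      and k\<tau>: "\<forall>y\<in>Q. j y = - \<tau> \<longrightarrow> \<delta> \<le> k y"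
      and x: "x \<in> Q" "- \<tau> \<le> j x" "dist p x \<le> \<theta>"
    \<comment> \<open>The factor \<open>\<delta> / E\<close> makes the barrier at most
      \<open>\<delta>\<close> throughout the layer \<open>- \<tau> \<le> j y\<close>.\<close>
    define \<beta> where "\<beta> y = \<delta> / E * (exp (- K * j y) - A * (norm (y - p))\<^sup>2)" for y
    define \<Phi> where "\<Phi> y = k y - \<beta> y" for y
    define Q' where "Q' = {y \<in> Q. - \<tau> \<le> j y}"
    have jcont: "isCont j y" if "y \<in> cball p s" for y
      using has_derivative_continuous[OF bspec[OF jd that]] .
    have jcQ: "continuous_on Q j"
      using Q(2) by (intro continuous_at_imp_continuous_on) (auto intro: jcont)
    have eE: "exp (- K * j y) \<le> E" if "- \<tau> \<le> j y" for y
    proof -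
      have "K * (- \<tau>) \<le> K * j y" using that K1 by (intro mult_left_mono) auto
      then show ?thesis unfolding E_def using \<tau> by simp
    qed
    have \<beta>\<delta>: "\<beta> y \<le> \<delta>" if "- \<tau> \<le> j y" for y
    proof -
      have "0 \<le> A * (norm (y - p))\<^sup>2" using A by simp
      then have "exp (- K * j y) - A * (norm (y - p))\<^sup>2 \<le> E" using eE[OF that] by linarith
      then have "\<beta> y \<le> \<delta> / E * E" unfolding \<beta>_def using \<delta> E by (intro mult_left_mono) auto
      then show ?thesis using E by simp
    qed
    have pos: "\<Phi> x \<ge> 0"
    proof (rule ccontr)
      assume neg: "\<not> \<Phi> x \<ge> 0"
      have "compact Q'" unfolding Q'_def
        using continuous_closed_preimage[OF jcQ compact_imp_closed[OF Q(1)] closed_atLeast[of "- \<tau>"]] Q(1)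
        by (auto simp: Int_def vimage_def intro: compact_Int_closed[of Q, unfolded Int_def] dest: compact_Int_closed)
      moreover have "continuous_on Q' \<Phi>"
      proof -
        have "continuous_on Q \<Phi>" unfolding \<Phi>_def[abs_def] \<beta>_def using jcQ kc E by (intro continuous_intros) auto
        then show ?thesis by (rule continuous_on_subset) (auto simp: Q'_def)
      qed
      moreover have xQ': "x \<in> Q'" using x by (simp add: Q'_def)
      ultimately obtain y where y: "y \<in> Q'" "\<And>z. z \<in> Q' \<Longrightarrow> \<Phi> y \<le> \<Phi> z"
        using continuous_attains_inf[of Q' \<Phi>] by blast
      have yneg: "\<Phi> y < 0" using y(2)[OF xQ'] neg by simp
      have yQ: "y \<in> Q" "- \<tau> \<le> j y" using y(1) by (auto simp: Q'_def)
      have ycb: "y \<in> cball p s" using yQ Q by blast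
      have k\<beta>: "k y < \<beta> y" using yneg by (simp add: \<Phi>_def)
      \<comment> \<open>At a negative minimum \<open>k\<close> lies below \<open>\<delta>\<close>,
        which is why the Laplacian bound is assumed only there.\<close>
      then have k\<delta>: "k y < \<delta>" using \<beta>\<delta>[OF yQ(2)] by simp
      have "j y \<noteq> - \<tau>" using k\<tau> yQ k\<delta> by force
      then have j\<tau>: "- \<tau> < j y" using yQ by simp
      have "dist p y \<noteq> s"
      proof
        assume "dist p y = s"
        then have "A * (norm (y - p))\<^sup>2 = E" using A by (simp add: dist_norm norm_minus_commute)
        then have "\<beta> y \<le> 0" unfolding \<beta>_def using eE[OF yQ(2)] \<delta> E by (intro mult_nonneg_nonpos) auto
        then show False using k\<beta> bspec[OF k0 yQ(1)] by simp
      qed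
      then have ds: "dist p y < s" using ycb by simp
      define Ny where "Ny = N y"
      have Ny: "c \<le> norm Ny" using Nc ycb by (simp add: Ny_def)
      have near: "\<forall>\<^sub>F z in nhds y. z \<in> cball p s \<and> - \<tau> < j z"
      proof (intro eventually_conj)
        have "\<forall>\<^sub>F z in nhds y. z \<in> ball p s" using ds by (intro eventually_nhds_in_open) auto
        then show "\<forall>\<^sub>F z in nhds y. z \<in> cball p s" by (rule eventually_mono) auto
        have "(j \<longlongrightarrow> j y) (nhds y)" using jcont[OF ycb] by (simp add: continuous_at_imp_continuous_at_within isCont_def tendsto_at_iff_tendsto_nhds)
        then show "\<forall>\<^sub>F z in nhds y. - \<tau> < j z" using j\<tau> by (rule order_tendstoD)
      qed
      show False
      proof (cases "j y = 0")
        case False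
        then have jy: "j y < 0" using j0 yQ by force
        have "(j \<longlongrightarrow> j y) (nhds y)" using jcont[OF ycb] by (simp add: isCont_def tendsto_at_iff_tendsto_nhds)
        then have "\<forall>\<^sub>F z in nhds y. j z < 0" using jy by (rule order_tendstoD)
        with near have m: "\<forall>\<^sub>F z in nhds y. \<Phi> y \<le> \<Phi> z"
          by eventually_elim (rule y(2), use jQ in \<open>simp add: Q'_def\<close>)
        obtain L where L: "L \<le> \<theta> * \<delta>" "has_lap k y L" using lap yQ(1) jy k\<delta> by blast
        define e where "e = exp (- K * j y)"
        define S where "S = (\<Sum>b\<in>Basis. d y b)"
        have e1: "e \<ge> 1" using jy K1 by (simp add: e_def mult_nonneg_nonpos)
        have "has_lap (\<lambda>y. exp (- K * j y)) y (\<Sum>b\<in>Basis. exp (- K * j (y + 0 *\<^sub>R b)) * (K\<^sup>2 * (N y \<bullet> b)\<^sup>2 - K * d y b))"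
          by (rule has_lap_D2) (rule D2_exp, use j2 ycb in blast)
        also have "(\<Sum>b\<in>Basis. exp (- K * j (y + 0 *\<^sub>R b)) * (K\<^sup>2 * (N y \<bullet> b)\<^sup>2 - K * d y b))
          = e * (K\<^sup>2 * (norm Ny)\<^sup>2 - K * S)"
          by (simp add: e_def S_def Ny_def sum_subtractf flip: sum_distrib_left sum_Basis_inner_square)
        finally have l: "has_lap (\<lambda>y. exp (- K * j y)) y (e * (K\<^sup>2 * (norm Ny)\<^sup>2 - K * S))" .
        have "has_lap \<Phi> y (L - \<delta> / E * (e * (K\<^sup>2 * (norm Ny)\<^sup>2 - K * S) - A * (2 * DIM('a))))"
          unfolding \<Phi>_def[abs_def] \<beta>_def
          by (intro has_lap_diff has_lap_cmult l L has_lap_norm_square)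
        from has_lap_local_min[OF m this]
        have le: "\<delta> / E * (e * (K\<^sup>2 * (norm Ny)\<^sup>2 - K * S) - A * (2 * n)) \<le> \<theta> * \<delta>"
          using L(1) by (simp add: n_def)
        have "c\<^sup>2 \<le> (norm Ny)\<^sup>2" using Ny c by (intro power_mono) auto
        then have "K * c\<^sup>2 \<le> K * (norm Ny)\<^sup>2" using K1 by (intro mult_left_mono) auto
        moreover have "S \<le> C" using bspec[OF dC ycb] by (simp add: S_def)
        ultimately have t: "2 * n * A + 1 \<le> K * (norm Ny)\<^sup>2 - S" using Kc2 by linarith
        have nA: "0 \<le> n * A" using n A by simp
        have "1 * (2 * n * A + 1) \<le> K * (K * (norm Ny)\<^sup>2 - S)" using t K1 nA by (intro mult_mono) auto
        then have t2: "2 * n * A + 1 \<le> K\<^sup>2 * (norm Ny)\<^sup>2 - K * S" by (simp add: power2_eq_square algebra_simps)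
        have "1 * (2 * n * A + 1) \<le> e * (K\<^sup>2 * (norm Ny)\<^sup>2 - K * S)" using t2 e1 nA by (intro mult_mono) auto
        then have "1 \<le> e * (K\<^sup>2 * (norm Ny)\<^sup>2 - K * S) - A * (2 * n)" by (simp add: mult_ac)
        then have "\<delta> / E * 1 \<le> \<delta> / E * (e * (K\<^sup>2 * (norm Ny)\<^sup>2 - K * S) - A * (2 * n))"
          using \<delta> E by (intro mult_left_mono) auto
        then have "\<delta> / E \<le> \<theta> * \<delta>" using le by simp
        also have "\<dots> \<le> 1 / (2 * E) * \<delta>" using \<theta> \<delta> by (intro mult_right_mono) auto
        finally show False using \<delta> E by (simp add: field_simps)
      next
        case True
        \<comment> \<open>On the boundary \<open>k\<close> has normal derivative zero and the
          barrier a negative one, so \<open>\<Phi>\<close> strictly decreases along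
          \<open>- Ny\<close>. Since \<open>j\<close> decreases too, that step stays in the domain,
          against minimality.\<close>
        define m where "m t = \<Phi> (y + t *\<^sub>R Ny)" for t
        define D where "D = \<delta> / E * (K * (Ny \<bullet> Ny) + A * (2 * ((y - p) \<bullet> Ny)))"
        have line: "((\<lambda>t. y + t *\<^sub>R Ny) has_derivative (\<lambda>t. t *\<^sub>R Ny)) (at 0)"
          by (auto intro!: derivative_eq_intros)
        have "(j has_derivative (\<lambda>v. Ny \<bullet> v)) (at (y + 0 *\<^sub>R Ny))" using jd ycb by (simp add: Ny_def)
        from has_derivative_compose[OF line this]
        have jl: "((\<lambda>t. j (y + t *\<^sub>R Ny)) has_real_derivative Ny \<bullet> Ny) (at 0)"
          by (simp add: has_field_derivative_def mult_commute_abs)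
        have nl: "((\<lambda>t. (norm (y + t *\<^sub>R Ny - p))\<^sup>2) has_real_derivative 2 * ((y - p) \<bullet> Ny)) (at 0)"
        proof -
          have e: "(norm (y + t *\<^sub>R Ny - p))\<^sup>2 = (norm (y - p))\<^sup>2 + 2 * t * ((y - p) \<bullet> Ny) + t\<^sup>2 * (Ny \<bullet> Ny)" for t
            unfolding power2_norm_eq_inner
            by (simp add: inner_diff_left inner_diff_right inner_add_left inner_add_right
              power2_eq_square algebra_simps inner_commute)
          show ?thesis unfolding e by (auto intro!: derivative_eq_intros)
        qed
        have "((\<lambda>t. k (y + t *\<^sub>R Ny)) has_real_derivative 0) (at 0)" using neu yQ True by (simp add: Ny_def)
        moreover have "((\<lambda>t. exp (- K * j (y + t *\<^sub>R Ny))) has_real_derivative - K * (Ny \<bullet> Ny)) (at 0)"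
          using jl True by (auto intro!: derivative_eq_intros)
        ultimately have "(m has_real_derivative 0 - \<delta> / E * (- K * (Ny \<bullet> Ny) - A * (2 * ((y - p) \<bullet> Ny)))) (at 0)"
          unfolding m_def[abs_def] \<Phi>_def \<beta>_def by (intro DERIV_diff DERIV_cmult nl)
        moreover have "0 - \<delta> / E * (- K * (Ny \<bullet> Ny) - A * (2 * ((y - p) \<bullet> Ny))) = D"
          unfolding D_def by (simp add: algebra_simps)
        ultimately have md: "(m has_real_derivative D) (at 0)" by (simp only:)
        have NN: "Ny \<bullet> Ny = norm Ny * norm Ny" by (simp add: dot_square_norm power2_eq_square)
        have "\<bar>(y - p) \<bullet> Ny\<bar> \<le> norm (y - p) * norm Ny" by (rule Cauchy_Schwarz_ineq2)
        also have "\<dots> \<le> s * norm Ny" using ds by (intro mult_right_mono) (auto simp: dist_norm norm_minus_commute)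
        finally have "A * (2 * ((y - p) \<bullet> Ny)) \<ge> A * (2 * (- (s * norm Ny)))"
          using A by (intro mult_left_mono) auto
        moreover have "(2 * A * s) * norm Ny < (K * norm Ny) * norm Ny"
        proof (intro mult_strict_right_mono)
          have "K * c \<le> K * norm Ny" using Ny K1 by (intro mult_left_mono) auto
          then show "2 * A * s < K * norm Ny" using Kc by linarith
          show "0 < norm Ny" using Ny c by linarith
        qed
        ultimately have "0 < K * (Ny \<bullet> Ny) + A * (2 * ((y - p) \<bullet> Ny))" by (simp add: NN mult_ac)
        then have "D > 0" unfolding D_def using \<delta> E by simp
        from DERIV_pos_inc_left[OF md this]
        obtain d1 where d1: "d1 > 0" "\<And>h. 0 < h \<Longrightarrow> h < d1 \<Longrightarrow> m (0 - h) < m 0" by blast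
        have "Ny \<bullet> Ny > 0" using Ny c by auto
        from DERIV_pos_inc_left[OF jl this]
        obtain d2 where d2: "d2 > 0" "\<And>h. 0 < h \<Longrightarrow> h < d2 \<Longrightarrow> j (y + (0 - h) *\<^sub>R Ny) < j (y + 0 *\<^sub>R Ny)" by blast
        have "((\<lambda>t. y + t *\<^sub>R Ny) \<longlongrightarrow> y + 0 *\<^sub>R Ny) (nhds 0)"
          by (intro tendsto_add tendsto_scaleR filterlim_ident tendsto_const)
        then have "\<forall>\<^sub>F t in nhds 0. y + t *\<^sub>R Ny \<in> cball p s \<and> - \<tau> < j (y + t *\<^sub>R Ny)"
          using near by (auto dest: eventually_compose_filterlim)
        then obtain d3 where d3: "d3 > 0" "\<And>t. dist t 0 < d3 \<Longrightarrow> y + t *\<^sub>R Ny \<in> cball p s \<and> - \<tau> < j (y + t *\<^sub>R Ny)"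
          unfolding eventually_nhds_metric by blast
        define h where "h = Min {d1, d2, d3} / 2"
        have h: "0 < h" "h < d1" "h < d2" "h < d3" using d1(1) d2(1) d3(1) by (auto simp: h_def)
        have z: "y + (- h) *\<^sub>R Ny \<in> cball p s" "- \<tau> < j (y + (- h) *\<^sub>R Ny)" using d3(2)[of "- h"] h by auto
        have "j (y + (- h) *\<^sub>R Ny) < 0" using d2(2)[of h] h True by simp
        then have "y + (- h) *\<^sub>R Ny \<in> Q'" using jQ z by (auto simp: Q'_def)
        from y(2)[OF this] have "m 0 \<le> m (- h)" by (simp add: m_def)
        then show False using d1(2)[of h] h by simp
      qed
    qed
    have "(norm (x - p))\<^sup>2 \<le> \<theta>\<^sup>2" using x(3) by (intro power_mono) (auto simp: dist_norm norm_minus_commute)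
    also have "\<dots> \<le> \<theta> * 1" unfolding power2_eq_square using \<theta> by (intro mult_left_mono) auto
    also have "\<dots> \<le> 1 / (2 * A)" using \<theta> by simp
    finally have "A * (norm (x - p))\<^sup>2 \<le> A * (1 / (2 * A))" using A by (intro mult_left_mono) auto
    then have "A * (norm (x - p))\<^sup>2 \<le> 1 / 2" using A by simp
    moreover have "exp (- K * j x) \<ge> 1" using K1 j0 x(1) by (simp add: mult_nonneg_nonpos)
    ultimately have "1 / 2 \<le> exp (- K * j x) - A * (norm (x - p))\<^sup>2" by linarith
    then have "\<delta> / E * (1 / 2) \<le> \<beta> x" unfolding \<beta>_def using \<delta> E by (intro mult_left_mono) auto
    moreover have "\<theta> * \<delta> \<le> 1 / (2 * E) * \<delta>" using \<theta> \<delta> by (intro mult_right_mono) auto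
    ultimately show "\<theta> * \<delta> \<le> k x" using pos by (simp add: \<Phi>_def)
  qed
qed


subsection \<open>Shrinking domains near the pole\<close>

lemma dist_Pair_le: "dist (x, a) (y, b) \<le> dist x y + dist a b"
  by (simp add: dist_Pair_Pair sqrt_sum_squares_le_sum)

locale cap_domain = pole +
  fixes D :: "'a set"
  assumes D: "smooth_domain D" and D_cap: "D \<subseteq> {x \<in> sphere 0 1. x \<bullet> e > 0}"
begin

lemma D_open: obtains W where "open W" "D = sphere 0 1 \<inter> W"
  using D unfolding smooth_domain_def openin_open by blast

lemma closure_D: "x \<in> closure D \<Longrightarrow> norm x = 1 \<and> x \<bullet> e \<ge> 0"
proof -
  have "closure D \<subseteq> sphere 0 1 \<inter> {x. 0 \<le> x \<bullet> e}"
    using D_cap by (intro closure_minimal closed_Int closed_Collect_le continuous_intros) (auto simp: less_imp_le)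
  then show "x \<in> closure D \<Longrightarrow> norm x = 1 \<and> x \<bullet> e \<ge> 0" by auto
qed

text \<open>Unlike \<open>boundary_function\<close> it asks for no gradient at \<open>x\<close>.
  Nondegeneracy is tested on \<open>bnormal\<close> instead, which depends continuously on
  \<open>(y, a)\<close>.\<close>

definition local_boundary :: "'a set \<Rightarrow> ('a \<Rightarrow> real) \<Rightarrow> 'a \<Rightarrow> bool" where
  "local_boundary V \<rho> x \<longleftrightarrow> open V \<and> x \<in> V \<and> Ck_on 1 V \<rho> \<and> D \<inter> V = {x \<in> sphere 0 1 \<inter> V. \<rho> x < 0}"

definition bnormal :: "real \<Rightarrow> ('a \<Rightarrow> real) \<Rightarrow> 'a \<Rightarrow> 'a" where
  "bnormal a \<rho> y = (\<Sum>b\<in>Basis. frechet_derivative (\<lambda>y. \<rho> (bmap (y, a))) (at y) b *\<^sub>R b)"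

definition bdomain :: "real \<Rightarrow> 'a set" where
  "bdomain a = {y. (y, a) \<in> bdom \<and> bmap (y, a) \<in> D}"

definition bclosure :: "real \<Rightarrow> 'a set" where
  "bclosure a = {y. (y, a) \<in> bdom \<and> bmap (y, a) \<in> closure D}"

text \<open>The Neumann condition is imposed for every local defining function, because the Hopf
  barrier brings its own.\<close>

definition nonneg_neumann :: "real \<Rightarrow> ('a \<Rightarrow> real) \<Rightarrow> bool" where
  "nonneg_neumann a k \<longleftrightarrow> continuous_on (bclosure a) k \<and> (\<forall>y\<in>bclosure a. 0 \<le> k y) \<and>
     (\<forall>y\<in>bclosure a - bdomain a. \<forall>V \<rho>. local_boundary V \<rho> (bmap (y, a)) \<longrightarrow> bnormal a \<rho> y \<noteq> 0 \<longrightarrow>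
        ((\<lambda>t. k (y + t *\<^sub>R bnormal a \<rho> y)) has_real_derivative 0) (at 0))"

text \<open>The limit cylinder at \<open>a = 0\<close>, cut at height 1 to keep it bounded; the
  zeros to be excluded have representatives near height 0.\<close>

definition limit_core :: "'a set" where
  "limit_core = {y. (y, 0) \<in> bdom \<and> bmap (y, 0) \<in> D \<and> \<bar>y \<bullet> e\<bar> < 1}"

lemma boundary_function_le:
  assumes "open V" "continuous_on V \<rho>" "D \<inter> V = {x \<in> sphere 0 1 \<inter> V. \<rho> x < 0}" "x \<in> closure D" "x \<in> V"
  shows "\<rho> x \<le> (0::real)"
proof (rule ccontr)
  assume "\<not> \<rho> x \<le> 0"
  then have x: "x \<in> V \<inter> \<rho> -` {0<..}" using assms by auto
  have "open (V \<inter> \<rho> -` {0<..})" using continuous_open_preimage[OF assms(2,1)] by simp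
  then have "(V \<inter> \<rho> -` {0<..}) \<inter> D \<noteq> {}"
    using x assms(4) open_Int_closure_eq_empty by blast
  then show False using assms(3) by force
qed

text \<open>At \<open>a = 0\<close> the function is \<rho> in normal coordinates, independent of
  height. Composing a vanishing derivative with the smooth inverse coordinates would make the
  spherical gradient vanish as well.\<close>

lemma bmap_gradient_nonzero:
  assumes V: "open V" "Ck_on 1 V \<rho>" and p: "(p, 0) \<in> bdom" "bmap (p, 0) \<in> V"
    and g: "sphere_grad \<rho> (bmap (p, 0)) \<noteq> 0"
  shows "\<exists>b\<in>Basis. frechet_derivative (\<lambda>y. \<rho> (bmap (y, 0))) (at p) b \<noteq> 0"
proof (rule ccontr)
  assume *: "\<not> ?thesis"
  define x where "x = bmap (p, 0)"
  define S where "S = {q \<in> bdom. bmap q \<in> V}"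
  have S: "open S"
    using continuous_open_preimage[OF Ck_on_imp_continuous_on[OF Ck_on_bmap] open_bdom V(1)]
    by (simp add: S_def vimage_def Int_def)
  have J: "Ck_on 1 S (\<lambda>q. \<rho> (bmap q))"
    by (rule Ck_on_compose[OF S V(2) Ck_on_subset[OF Ck_on_bmap]]) (auto simp: S_def)
  have "((\<lambda>y. \<rho> (bmap (y, 0))) has_derivative
      (\<lambda>v. frechet_derivative (\<lambda>q. \<rho> (bmap q)) (at (p, 0)) (v, 0))) (at p)"
    using Ck_on_grad_slice[of 0 S "\<lambda>q. \<rho> (bmap q)" p 0] J p by (simp add: S_def)
  then have d: "((\<lambda>y. \<rho> (bmap (y, 0))) has_derivative frechet_derivative (\<lambda>y. \<rho> (bmap (y, 0))) (at p)) (at p)"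
    using frechet_derivative_at by metis
  have "frechet_derivative (\<lambda>y. \<rho> (bmap (y, 0))) (at p) = (\<lambda>v. 0)"
    using * by (intro linear_eq_stdbasis has_derivative_linear[OF d]) (auto simp: linear_zero)
  then have d0: "((\<lambda>y. \<rho> (bmap (y, 0))) has_derivative (\<lambda>v. 0)) (at p)" using d by simp
  have hp: "hproj p \<bullet> e = 0" "norm (hproj p) < pi" using norm_blog_pi[OF p(1)] by auto
  have x: "x = sexp (hproj p)" by (simp add: x_def bmap_def)
  then have xs: "x \<in> sldom" "slog x = hproj p" using sexp_sldom[OF hp] slog_sexp(1)[OF hp] by auto
  \<comment> \<open>The height of \<open>p\<close> is added so that \<open>l x = p\<close>; it is
    invisible to \<open>bmap\<close> at \<open>a = 0\<close>.\<close>
  define l where "l Y = slog Y + (p \<bullet> e) *\<^sub>R e" for Y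
  have lx: "l x = p" using hproj_decomp[of p] by (simp add: l_def xs add.commute)
  have "Ck_on 1 sldom l" unfolding l_def[abs_def] by (intro Ck_on_add open_sldom Ck_on_slog Ck_on_const)
  then have "(l has_derivative frechet_derivative l (at x)) (at x)"
    using Ck_on_has_derivative[of 0 sldom l x] xs by simp
  from has_derivative_compose[OF this, of "\<lambda>y. \<rho> (bmap (y, 0))" "\<lambda>v. 0"]
  have "((\<lambda>Y. \<rho> (bmap (l Y, 0))) has_derivative (\<lambda>v. 0)) (at x)" using d0 lx by simp
  then have "((\<lambda>Y. \<rho> (sgn Y)) has_derivative (\<lambda>v. 0)) (at x)"
  proof (rule has_derivative_transform_within_open[OF _ open_sldom xs(1)])
    fix Y assume Y: "Y \<in> sldom"
    have "hproj (l Y) = slog Y" by (simp add: l_def hproj_add hproj_scaleR hproj_orth slog_orth)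
    then show "\<rho> (bmap (l Y, 0)) = \<rho> (sgn Y)" using sexp_slog[OF Y] by (simp add: bmap_def)
  qed
  then have "frechet_derivative (\<lambda>Y. \<rho> (sgn Y)) (at x) = (\<lambda>v. 0)" using frechet_derivative_at by metis
  then show False using g by (simp add: sphere_grad_def flip: x_def)
qed

text \<open>The Hopf barrier for \<open>J (y, a) = \<rho> (bmap (y, a))\<close> with constants
  independent of \<open>a\<close>, thanks to joint smoothness. \<open>K\<close> is a compact
  interior layer, also independent of \<open>a\<close>, on which a lower bound of \<open>k\<close>
  has to be supplied.\<close>

lemma hopf_local:
  assumes p: "(p, 0) \<in> bdom" "bmap (p, 0) \<in> closure D - D" "\<bar>p \<bullet> e\<bar> < 1"
  shows "\<exists>\<theta>>0. \<exists>K. compact K \<and> K \<subseteq> limit_core \<and> (\<forall>a. 0 < a \<longrightarrow> a < \<theta> \<longrightarrow> K \<subseteq> bdomain a \<and>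
    (\<forall>y\<in>K. 1 / 2 < 1 + a * (y \<bullet> e)) \<and>
    (\<forall>k \<delta>. \<delta> > 0 \<longrightarrow> nonneg_neumann a k \<longrightarrow>
      (\<forall>y\<in>bdomain a. 1 / 2 < 1 + a * (y \<bullet> e) \<longrightarrow> k y < \<delta> \<longrightarrow> (\<exists>L\<le>\<theta> * \<delta>. has_lap k y L)) \<longrightarrow>
      (\<forall>y\<in>K. \<delta> \<le> k y) \<longrightarrow>
      (\<forall>y\<in>ball p \<theta>. y \<in> bclosure a \<longrightarrow> \<theta> * \<delta> \<le> k y)))"
proof -
  obtain V \<rho> where bf: "boundary_function D (bmap (p, 0)) V \<rho>" "smooth_on V \<rho>"
    using D p unfolding smooth_domain_def by blast
  have V: "open V" "bmap (p, 0) \<in> V" "Ck_on 1 V \<rho>" "sphere_grad \<rho> (bmap (p, 0)) \<noteq> 0"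
    and DV: "D \<inter> V = {x \<in> sphere 0 1 \<inter> V. \<rho> x < 0}"
    using bf(1) by (auto simp: boundary_function_def)
  have V2: "Ck_on 2 V \<rho>" using bf(2) by (simp add: smooth_on_def)
  have \<rho>c: "continuous_on V \<rho>" using Ck_on_imp_continuous_on[OF V(3)] .
  have lb: "local_boundary V \<rho> x" if "x \<in> V" for x using V DV that by (simp add: local_boundary_def)
  have inD: "x \<in> D \<longleftrightarrow> \<rho> x < 0" if "x \<in> V" "norm x = 1" for x using DV that by auto
  have cle: "\<rho> x \<le> 0" if "x \<in> closure D" "x \<in> V" for x
    using boundary_function_le[OF V(1) \<rho>c DV that] .
  define J where "J q = \<rho> (bmap q)" for q
  define S where "S = {q \<in> bdom. bmap q \<in> V}"
  have S: "open S"
    using continuous_open_preimage[OF Ck_on_imp_continuous_on[OF Ck_on_bmap] open_bdom V(1)]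
    by (simp add: S_def vimage_def Int_def)
  have pS: "(p, 0) \<in> S" using p V by (simp add: S_def)
  have J2: "Ck_on 2 S J" unfolding J_def[abs_def]
    by (rule Ck_on_compose[OF S V2 Ck_on_subset[OF Ck_on_bmap]]) (auto simp: S_def)
  then have J2': "Ck_on (Suc (Suc 0)) S J" by (simp add: numeral_2_eq_2)
  have Jc: "continuous_on S J" using Ck_on_imp_continuous_on[OF J2] .
  define N where "N q = (\<Sum>b\<in>Basis. frechet_derivative J (at q) (b, 0) *\<^sub>R b)" for q
  define dd where "dd q b = frechet_derivative (\<lambda>q'. frechet_derivative J (at q') (b, 0)) (at q) (b, 0)" for q b
  have Nb: "N q \<bullet> b = frechet_derivative J (at q) (b, 0)" if "b \<in> Basis" for q b
    using that by (simp add: N_def)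
  have slice: "((\<lambda>y. J (y, a)) has_derivative (\<lambda>v. N (y, a) \<bullet> v)) (at y)" if "(y, a) \<in> S" for y a
  proof -
    note d = Ck_on_grad_slice[OF J2' that]
    have "(\<lambda>v. frechet_derivative J (at (y, a)) (v, 0)) = (\<lambda>v. N (y, a) \<bullet> v)"
      by (intro linear_eq_stdbasis has_derivative_linear[OF d]) (auto simp: Nb bounded_linear.linear bounded_linear_inner_right)
    then show ?thesis using d by simp
  qed
  have bn: "bnormal a \<rho> y = N (y, a)" if "(y, a) \<in> S" for y a
  proof -
    have "frechet_derivative (\<lambda>y. J (y, a)) (at y) = (\<lambda>v. N (y, a) \<bullet> v)"
      using slice[OF that] frechet_derivative_at by metis
    then show ?thesis
      unfolding bnormal_def J_def[symmetric] by (simp add: euclidean_representation)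
  qed
  have Ncont: "continuous_on S N" unfolding N_def
    using Ck_on_imp_continuous_on[OF Ck_on_deriv[OF J2']] by (intro continuous_intros) blast
  define f where "f q = (\<Sum>b\<in>Basis. dd q b)" for q
  have fcont: "continuous_on S f" unfolding f_def dd_def
    using Ck_on_imp_continuous_on[OF Ck_on_deriv[OF Ck_on_deriv[OF J2']]] by (intro continuous_intros) blast
  have "N (p, 0) \<noteq> 0"
  proof -
    obtain b where b: "b \<in> Basis" "frechet_derivative (\<lambda>y. J (y, 0)) (at p) b \<noteq> 0"
      using bmap_gradient_nonzero[OF V(1,3) p(1) V(2,4)] by (auto simp: J_def)
    have "frechet_derivative (\<lambda>y. J (y, 0)) (at p) = (\<lambda>v. N (p, 0) \<bullet> v)"
      using slice[OF pS] frechet_derivative_at by metis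
    then show ?thesis using b by auto
  qed
  \<comment> \<open>Both bounds are strict at \<open>(p, 0)\<close>, hence persist on the open set
    \<open>G\<close>, and so on a box of points and parameters.\<close>
  define c where "c = norm (N (p, 0)) / 2"
  define C where "C = \<bar>f (p, 0)\<bar> + 1"
  have c: "c > 0" "c < norm (N (p, 0))" using \<open>N (p, 0) \<noteq> 0\<close> by (auto simp: c_def)
  have C: "C > 0" "\<bar>f (p, 0)\<bar> < C" by (auto simp: C_def)
  define G where "G = {q \<in> S. c < norm (N q) \<and> \<bar>f q\<bar> < C \<and> \<bar>fst q \<bullet> e\<bar> < 1 \<and> 1 / 2 < 1 + snd q * (fst q \<bullet> e)}"
  have "open G"
  proof -
    have "open (S \<inter> (\<lambda>q. norm (N q)) -` {c<..})"
      by (intro continuous_open_preimage continuous_intros Ncont S)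
    moreover have "open (S \<inter> (\<lambda>q. \<bar>f q\<bar>) -` {..<C})"
      by (intro continuous_open_preimage continuous_intros fcont S)
    moreover have "open {q::'a \<times> real. \<bar>fst q \<bullet> e\<bar> < 1}" "open {q::'a \<times> real. 1 / 2 < 1 + snd q * (fst q \<bullet> e)}"
      by (intro open_Collect_less continuous_intros)+
    moreover have "G = (S \<inter> (\<lambda>q. norm (N q)) -` {c<..}) \<inter> (S \<inter> (\<lambda>q. \<bar>f q\<bar>) -` {..<C})
      \<inter> {q. \<bar>fst q \<bullet> e\<bar> < 1} \<inter> {q. 1 / 2 < 1 + snd q * (fst q \<bullet> e)}" by (auto simp: G_def)
    ultimately show ?thesis by (simp add: open_Int)
  qed
  moreover have "(p, 0) \<in> G" using pS c C p by (simp add: G_def)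
  ultimately obtain r0 where r0: "r0 > 0" "ball (p, 0) r0 \<subseteq> G" using openE by blast
  define s where "s = r0 / 3"
  have s: "s > 0" using r0 by (simp add: s_def)
  have box: "(y, a) \<in> G" if "y \<in> cball p s" "\<bar>a\<bar> \<le> s" for y a
  proof -
    have "dist (p, 0) (y, a) \<le> dist p y + dist 0 a"
      by (rule dist_Pair_le)
    also have "\<dots> < r0" using that r0 s by (simp add: s_def)
    finally show ?thesis using r0 by auto
  qed
  then have boxS: "(y, a) \<in> S" if "y \<in> cball p s" "\<bar>a\<bar> \<le> s" for y a using that by (simp add: G_def)
  obtain \<tau> \<theta>0 where \<tau>: "\<tau> > 0" and \<theta>0: "\<theta>0 > 0" and
    hb: "\<forall>(p::'a) j N d Q k \<delta>. \<delta> > 0 \<longrightarrow> compact Q \<longrightarrow> Q \<subseteq> cball p s \<longrightarrow>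
    (\<forall>y\<in>Q. j y \<le> 0) \<longrightarrow> (\<forall>y\<in>cball p s. j y < 0 \<longrightarrow> y \<in> Q) \<longrightarrow>
    (\<forall>y\<in>cball p s. (j has_derivative (\<lambda>v. N y \<bullet> v)) (at y)) \<longrightarrow>
    (\<forall>y\<in>cball p s. \<forall>b\<in>Basis. D2 (\<lambda>t. j (y + t *\<^sub>R b)) (N y \<bullet> b) (d y b)) \<longrightarrow>
    (\<forall>y\<in>cball p s. \<bar>\<Sum>b\<in>Basis. d y b\<bar> \<le> C) \<longrightarrow> (\<forall>y\<in>cball p s. c \<le> norm (N y)) \<longrightarrow>
    continuous_on Q k \<longrightarrow> (\<forall>y\<in>Q. 0 \<le> k y) \<longrightarrow>
    (\<forall>y\<in>Q. j y < 0 \<longrightarrow> k y < \<delta> \<longrightarrow> (\<exists>L\<le>\<theta>0 * \<delta>. has_lap k y L)) \<longrightarrow>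
    (\<forall>y\<in>Q. j y = 0 \<longrightarrow> ((\<lambda>t. k (y + t *\<^sub>R N y)) has_real_derivative 0) (at 0)) \<longrightarrow>
    (\<forall>y\<in>Q. j y = - \<tau> \<longrightarrow> \<delta> \<le> k y) \<longrightarrow>
    (\<forall>y\<in>Q. - \<tau> \<le> j y \<longrightarrow> dist p y \<le> \<theta>0 \<longrightarrow> \<theta>0 * \<delta> \<le> k y)"
    using hopf_barrier[OF c(1) C(1) s, where 'a = 'a]
    by (elim exE conjE) (rule that[rotated 2], assumption+)
  have "compact (cball p s \<times> cball (0::real) s)" by (intro compact_Times) auto
  moreover have "cball p s \<times> cball (0::real) s \<subseteq> S" using boxS by auto
  ultimately have "uniformly_continuous_on (cball p s \<times> cball (0::real) s) J"
    using compact_uniformly_continuous continuous_on_subset[OF Jc] by blast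
  from uniformly_continuous_onE[OF this, of "\<tau> / 2"] \<tau>
  obtain d1 where d1: "d1 > 0" "\<And>q q'. q \<in> cball p s \<times> cball 0 s \<Longrightarrow> q' \<in> cball p s \<times> cball 0 s \<Longrightarrow>
      dist q' q < d1 \<Longrightarrow> dist (J q') (J q) < \<tau> / 2" by (metis half_gt_zero)
  have close: "\<bar>J (y, a) - J (y, 0)\<bar> < \<tau> / 2" if "y \<in> cball p s" "\<bar>a\<bar> \<le> s" "\<bar>a\<bar> < d1" for y a
    using d1(2)[of "(y, 0)" "(y, a)"] that s by (simp add: dist_Pair_Pair dist_real_def)
  have "isCont J (p, 0)" using Jc S pS continuous_on_eq_continuous_at by blast
  moreover have "J (p, 0) = 0"
    using cle[of "bmap (p, 0)"] inD[of "bmap (p, 0)"] p V by (force simp: J_def norm_bmap)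
  ultimately obtain r1 where r1: "r1 > 0" "\<And>q. dist q (p, 0) < r1 \<Longrightarrow> dist (J q) 0 < \<tau>"
    using \<tau> unfolding continuous_at_eps_delta by metis
  \<comment> \<open>Passing from 0 to \<open>a\<close> changes \<open>J\<close> by less than
    \<open>\<tau> / 2\<close>. The level \<open>- \<tau>\<close> of every \<open>J (y, a)\<close>
    with small \<open>a\<close> therefore lies in this layer, on which \<open>J (y, a)\<close> is
    still negative.\<close>
  define K where "K = {y \<in> cball p s. - (3 * \<tau> / 2) \<le> J (y, 0) \<and> J (y, 0) \<le> - (\<tau> / 2)}"
  \<comment> \<open>\<open>r1 / 2\<close>, because \<open>(x, a)\<close> is at distance below
    \<open>2 * \<theta>\<close> from \<open>(p, 0)\<close>.\<close>
  define \<theta> where "\<theta> = Min {\<theta>0, d1, s, r1 / 2}"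
  have \<theta>: "\<theta> > 0" "\<theta> \<le> \<theta>0" "\<theta> \<le> d1" "\<theta> \<le> s" "\<theta> \<le> r1 / 2" using \<theta>0 d1 s r1 by (auto simp: \<theta>_def)
  show ?thesis
  proof (intro exI[of _ \<theta>] exI[of _ K] conjI \<theta>(1))
    have c0: "continuous_on (cball p s) (\<lambda>y. J (y, 0))"
      by (rule continuous_on_compose2[OF Jc]) (use boxS s in \<open>auto intro!: continuous_intros\<close>)
    have "K = cball p s \<inter> (\<lambda>y. J (y, 0)) -` {- (3 * \<tau> / 2)..- (\<tau> / 2)}" by (auto simp: K_def)
    moreover have "closed (cball p s \<inter> (\<lambda>y. J (y, 0)) -` {- (3 * \<tau> / 2)..- (\<tau> / 2)})"
      by (rule continuous_closed_preimage[OF c0]) auto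
    ultimately show "compact K" by (metis Int_lower1 bounded_cball bounded_subset compact_eq_bounded_closed)
    show "K \<subseteq> limit_core"
    proof
      fix y assume y: "y \<in> K"
      then have "(y, 0) \<in> G" using box s by (simp add: K_def)
      moreover have "J (y, 0) < 0" using y \<tau> by (simp add: K_def)
      ultimately show "y \<in> limit_core" using inD[of "bmap (y, 0)"]
        by (auto simp: limit_core_def G_def S_def J_def norm_bmap)
    qed
    show "\<forall>a. 0 < a \<longrightarrow> a < \<theta> \<longrightarrow> K \<subseteq> bdomain a \<and> (\<forall>y\<in>K. 1 / 2 < 1 + a * (y \<bullet> e)) \<and>
    (\<forall>k \<delta>. \<delta> > 0 \<longrightarrow> nonneg_neumann a k \<longrightarrow>
      (\<forall>y\<in>bdomain a. 1 / 2 < 1 + a * (y \<bullet> e) \<longrightarrow> k y < \<delta> \<longrightarrow> (\<exists>L\<le>\<theta> * \<delta>. has_lap k y L)) \<longrightarrow>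
      (\<forall>y\<in>K. \<delta> \<le> k y) \<longrightarrow>
      (\<forall>y\<in>ball p \<theta>. y \<in> bclosure a \<longrightarrow> \<theta> * \<delta> \<le> k y))"
    proof (intro allI impI conjI ballI subsetI)
      fix a :: real and y assume a: "0 < a" "a < \<theta>" and y: "y \<in> K"
      have ycb: "y \<in> cball p s" using y by (simp add: K_def)
      have yG: "(y, a) \<in> G" using ycb a \<theta> by (intro box) auto
      then show "1 / 2 < 1 + a * (y \<bullet> e)" by (simp add: G_def)
      have "\<bar>J (y, a) - J (y, 0)\<bar> < \<tau> / 2" using a \<theta> by (intro close[OF ycb]) auto
      moreover have "J (y, 0) \<le> - (\<tau> / 2)" using y by (simp add: K_def)
      ultimately have "J (y, a) < 0" by linarith
      then show "y \<in> bdomain a" using yG inD[of "bmap (y, a)"]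
        by (auto simp: bdomain_def G_def S_def J_def norm_bmap)
    next
      fix a :: real and k \<delta> x
      assume a: "0 < a" "a < \<theta>" and \<delta>: "(0::real) < \<delta>" and nn: "nonneg_neumann a k"
        and lap: "\<forall>y\<in>bdomain a. 1 / 2 < 1 + a * (y \<bullet> e) \<longrightarrow> k y < \<delta> \<longrightarrow> (\<exists>L\<le>\<theta> * \<delta>. has_lap k y L)"
        and kK: "\<forall>y\<in>K. \<delta> \<le> k y" and x: "x \<in> ball p \<theta>" "x \<in> bclosure a"
      define Q where "Q = {y \<in> cball p s. bmap (y, a) \<in> closure D}"
      have as: "\<bar>a\<bar> \<le> s" "\<bar>a\<bar> < d1" using a \<theta> by auto
      have inG: "(y, a) \<in> G" if "y \<in> cball p s" for y using box[OF that as(1)] .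
      have inS: "(y, a) \<in> S" if "y \<in> cball p s" for y using boxS[OF that as(1)] .
      have inV: "(y, a) \<in> bdom" "bmap (y, a) \<in> V" if "y \<in> cball p s" for y
        using inS[OF that] by (auto simp: S_def)
      have Qb: "Q \<subseteq> bclosure a" using inV by (auto simp: Q_def bclosure_def)
      have dom: "y \<in> bdomain a" if "y \<in> Q" "J (y, a) < 0" for y
        using that inV[of y] inD[of "bmap (y, a)"] by (auto simp: Q_def bdomain_def J_def norm_bmap)
      have ndom: "y \<notin> bdomain a" if "y \<in> Q" "J (y, a) = 0" for y
        using that inV[of y] inD[of "bmap (y, a)"] by (auto simp: Q_def bdomain_def J_def norm_bmap)
      have "\<forall>y\<in>Q. - \<tau> \<le> J (y, a) \<longrightarrow> dist p y \<le> \<theta>0 \<longrightarrow> \<theta>0 * \<delta> \<le> k y"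
      proof (rule hb[THEN spec[of _ p], THEN spec[of _ "\<lambda>y. J (y, a)"], THEN spec[of _ "\<lambda>y. N (y, a)"],
            THEN spec[of _ "\<lambda>y b. dd (y, a) b"], THEN spec[of _ Q], THEN spec[of _ k],
            THEN spec[of _ \<delta>], THEN mp, OF \<delta>, THEN mp, THEN mp, THEN mp, THEN mp, THEN mp, THEN mp, THEN mp, THEN mp, THEN mp, THEN mp, THEN mp, THEN mp, THEN mp])
        have "continuous_on (cball p s) (\<lambda>y. bmap (y, a))"
          by (rule continuous_on_compose2[OF Ck_on_imp_continuous_on[OF Ck_on_bmap]])
            (use inV in \<open>auto intro!: continuous_intros\<close>)
        then have "closed (cball p s \<inter> (\<lambda>y. bmap (y, a)) -` closure D)"
          by (rule continuous_closed_preimage) auto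
        moreover have "Q = cball p s \<inter> (\<lambda>y. bmap (y, a)) -` closure D" by (auto simp: Q_def)
        ultimately show "compact Q" by (metis Int_lower1 bounded_cball bounded_subset compact_eq_bounded_closed)
        show "Q \<subseteq> cball p s" by (auto simp: Q_def)
        show "\<forall>y\<in>Q. J (y, a) \<le> 0" using cle inV by (auto simp: Q_def J_def)
        show "\<forall>y\<in>cball p s. J (y, a) < 0 \<longrightarrow> y \<in> Q"
        proof (intro ballI impI)
          fix y assume y: "y \<in> cball p s" "J (y, a) < 0"
          then have "bmap (y, a) \<in> D" using inV[OF y(1)] inD[of "bmap (y, a)"] by (simp add: J_def norm_bmap)
          then show "y \<in> Q" using y closure_subset by (auto simp: Q_def)
        qed
        show "\<forall>y\<in>cball p s. ((\<lambda>y. J (y, a)) has_derivative (\<lambda>v. N (y, a) \<bullet> v)) (at y)"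
          using slice inS by blast
        show "\<forall>y\<in>cball p s. \<forall>b\<in>Basis. D2 (\<lambda>t. J (y + t *\<^sub>R b, a)) (N (y, a) \<bullet> b) (dd (y, a) b)"
        proof (intro ballI)
          fix y b :: 'a assume "y \<in> cball p s" and b: "b \<in> Basis"
          from D2_Ck_on[OF J2 S inS[OF this(1)], of "(b, 0)"]
          show "D2 (\<lambda>t. J (y + t *\<^sub>R b, a)) (N (y, a) \<bullet> b) (dd (y, a) b)"
            by (simp add: Nb[OF b] dd_def)
        qed
        show "\<forall>y\<in>cball p s. \<bar>\<Sum>b\<in>Basis. dd (y, a) b\<bar> \<le> C" using inG by (auto simp: G_def f_def less_imp_le)
        show "\<forall>y\<in>cball p s. c \<le> norm (N (y, a))" using inG by (auto simp: G_def less_imp_le)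
        show "continuous_on Q k" "\<forall>y\<in>Q. 0 \<le> k y" using nn Qb continuous_on_subset
          by (auto simp: nonneg_neumann_def)
        show "\<forall>y\<in>Q. J (y, a) < 0 \<longrightarrow> k y < \<delta> \<longrightarrow> (\<exists>L\<le>\<theta>0 * \<delta>. has_lap k y L)"
        proof (intro ballI impI)
          fix y assume y: "y \<in> Q" "J (y, a) < 0" "k y < \<delta>"
          have "1 / 2 < 1 + a * (y \<bullet> e)" using inG[of y] y by (simp add: G_def Q_def)
          then obtain L where "L \<le> \<theta> * \<delta>" "has_lap k y L" using lap dom y by blast
          moreover have "\<theta> * \<delta> \<le> \<theta>0 * \<delta>" using \<theta> \<delta> by (intro mult_right_mono) auto
          ultimately show "\<exists>L\<le>\<theta>0 * \<delta>. has_lap k y L" by (intro exI[of _ L]) auto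
        qed
        show "\<forall>y\<in>Q. J (y, a) = 0 \<longrightarrow> ((\<lambda>t. k (y + t *\<^sub>R N (y, a))) has_real_derivative 0) (at 0)"
        proof (intro ballI impI)
          fix y assume y: "y \<in> Q" "J (y, a) = 0"
          then have ycb: "y \<in> cball p s" by (simp add: Q_def)
          have "N (y, a) \<noteq> 0" using inG[OF ycb] c(1) by (auto simp: G_def)
          moreover have "y \<in> bclosure a - bdomain a" using y Qb ndom by blast
          ultimately show "((\<lambda>t. k (y + t *\<^sub>R N (y, a))) has_real_derivative 0) (at 0)"
            using nn lb[OF inV(2)[OF ycb]] unfolding nonneg_neumann_def bn[OF inS[OF ycb], symmetric] by blast
        qed
        show "\<forall>y\<in>Q. J (y, a) = - \<tau> \<longrightarrow> \<delta> \<le> k y"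
        proof (intro ballI impI)
          fix y assume y: "y \<in> Q" "J (y, a) = - \<tau>"
          then have ycb: "y \<in> cball p s" by (simp add: Q_def)
          have "- (3 * \<tau> / 2) \<le> J (y, 0)" "J (y, 0) \<le> - (\<tau> / 2)"
            using close[OF ycb as] y(2) by linarith+
          then have "y \<in> K" using ycb by (simp add: K_def)
          then show "\<delta> \<le> k y" using kK by blast
        qed
      qed
      moreover have "x \<in> Q" using x \<theta> by (simp add: Q_def bclosure_def)
      moreover have "- \<tau> \<le> J (x, a)"
      proof -
        have "dist (x, a) (p, 0) \<le> dist x p + dist a 0" by (rule dist_Pair_le)
        also have "\<dots> < r1" using x a \<theta> by (simp add: dist_commute)
        finally show ?thesis using r1(2)[of "(x, a)"] by (auto simp: dist_real_def abs_less_iff)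
      qed
      ultimately have "\<theta>0 * \<delta> \<le> k x" using x \<theta> by auto
      moreover have "\<theta> * \<delta> \<le> \<theta>0 * \<delta>" using \<theta> \<delta> by (intro mult_right_mono) auto
      ultimately show "\<theta> * \<delta> \<le> k x" by linarith
    qed
  qed
qed

end


subsection \<open>Propagation of smallness\<close>

text \<open>A Lebesgue number argument in which one number is both the radius and the parameter of
  \<open>P\<close>. Covering by balls of half the radius leaves the other half for
  \<open>y'\<close>.\<close>

lemma compact_uniform_radius:
  fixes K :: "'a::metric_space set"
  assumes "compact K" and "\<And>y. y \<in> K \<Longrightarrow> \<exists>\<kappa>>0. \<forall>y'\<in>ball y \<kappa>. P \<kappa> y'"
    and mono: "\<And>\<kappa> \<kappa>' y. P \<kappa> y \<Longrightarrow> 0 < \<kappa>' \<Longrightarrow> \<kappa>' \<le> \<kappa> \<Longrightarrow> P \<kappa>' y"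
  shows "\<exists>\<kappa>>0::real. \<forall>y\<in>K. \<forall>y'\<in>ball y \<kappa>. P \<kappa> y'"
proof -
  obtain k where k: "\<And>y. y \<in> K \<Longrightarrow> k y > 0" "\<And>y y'. y \<in> K \<Longrightarrow> y' \<in> ball y (k y) \<Longrightarrow> P (k y) y'"
    using assms(2) by metis
  have "K \<subseteq> (\<Union>y\<in>K. ball y (k y / 2))" using k(1) by force
  then obtain F where F: "F \<subseteq> K" "finite F" "K \<subseteq> (\<Union>y\<in>F. ball y (k y / 2))"
    using compactE_image[OF assms(1), of K "\<lambda>y. ball y (k y / 2)"] by auto
  define \<kappa> where "\<kappa> = Min (insert 1 ((\<lambda>y. k y / 2) ` F))"
  have \<kappa>: "\<kappa> > 0" using F k(1) by (auto simp: \<kappa>_def)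
  have \<kappa>F: "\<kappa> \<le> k y / 2" if "y \<in> F" for y unfolding \<kappa>_def using F that by (intro Min_le) auto
  show ?thesis
  proof (intro exI[of _ \<kappa>] conjI ballI \<kappa>)
    fix y y' assume y: "y \<in> K" "y' \<in> ball y \<kappa>"
    then obtain c where c: "c \<in> F" "y \<in> ball c (k c / 2)" using F by blast
    then have cK: "c \<in> K" using F by blast
    have "dist c y' < k c" using dist_triangle[of c y' y] y c \<kappa>F[OF c(1)] by simp
    then have "P (k c) y'" using k(2)[OF cK] by simp
    then show "P \<kappa> y'" using mono[OF _ \<kappa>] \<kappa>F[OF c(1)] k(1)[OF cK] by simp
  qed
qed

context cap_domain
begin

text \<open>The Laplacian is bounded only away from the vertex \<open>e + a *\<^sub>R y = 0\<close>
  of the cone. The upper bound 2 is the one in \<open>harnack\<close>.\<close>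

definition almost_harmonic :: "real \<Rightarrow> real \<Rightarrow> ('a \<Rightarrow> real) \<Rightarrow> bool" where
  "almost_harmonic a \<kappa> k \<longleftrightarrow> nonneg_neumann a k \<and> (\<forall>y\<in>bclosure a. k y \<le> 2) \<and>
     (\<forall>y\<in>bdomain a. 1 / 2 < 1 + a * (y \<bullet> e) \<longrightarrow> (\<exists>L. \<bar>L\<bar> \<le> \<kappa> \<and> has_lap k y L))"

text \<open>A single \<open>\<kappa>\<close> bounds the parameter, the Laplacian and the value at
  \<open>y\<close>; this makes the property monotone in \<open>\<kappa>\<close> and fit for
  compactness arguments.\<close>

definition smallness_reaches :: "'a \<Rightarrow> real \<Rightarrow> real \<Rightarrow> 'a \<Rightarrow> bool" where
  "smallness_reaches p \<delta> \<kappa> y \<longleftrightarrow>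
     (\<forall>a k. 0 < a \<longrightarrow> a < \<kappa> \<longrightarrow> almost_harmonic a \<kappa> k \<longrightarrow> y \<in> bclosure a \<longrightarrow> k y \<le> \<kappa> \<longrightarrow> k p \<le> \<delta>)"

text \<open>The closure of the domain in normal coordinates: a compact cross-section of the limit
  cylinder, boundary included.\<close>

definition limit_slice :: "'a set" where
  "limit_slice = {z. z \<bullet> e = 0 \<and> norm z \<le> pi / 2 \<and> sexp z \<in> closure D}"

lemma almost_harmonic_mono: "almost_harmonic a \<kappa> k \<Longrightarrow> \<kappa> \<le> \<kappa>' \<Longrightarrow> almost_harmonic a \<kappa>' k"
  unfolding almost_harmonic_def by (meson order_trans)

lemma smallness_reaches_mono:
  assumes "smallness_reaches p \<delta> \<kappa> y" "\<kappa>' \<le> \<kappa>"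
  shows "smallness_reaches p \<delta> \<kappa>' y"
  unfolding smallness_reaches_def
proof (intro allI impI)
  fix a k assume "0 < a" "a < \<kappa>'" "almost_harmonic a \<kappa>' k" "y \<in> bclosure a" "k y \<le> \<kappa>'"
  then have "0 < a" "a < \<kappa>" "almost_harmonic a \<kappa> k" "y \<in> bclosure a" "k y \<le> \<kappa>"
    using assms(2) almost_harmonic_mono by auto
  then show "k p \<le> \<delta>" using assms(1) unfolding smallness_reaches_def by blast
qed

lemma bdomain_subset_bclosure: "bdomain a \<subseteq> bclosure a"
  using closure_subset by (auto simp: bdomain_def bclosure_def)

text \<open>\<open>D\<close> is open only relative to the sphere, which suffices since
  \<open>bmap\<close> takes values there.\<close>

lemma open_preimage_D: "open {q \<in> bdom. bmap q \<in> D}"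
proof -
  obtain W where W: "open W" "D = sphere 0 1 \<inter> W" using D_open .
  have "open (bdom \<inter> bmap -` W)"
    by (rule continuous_open_preimage[OF Ck_on_imp_continuous_on[OF Ck_on_bmap] open_bdom W(1)])
  moreover have "{q \<in> bdom. bmap q \<in> D} = bdom \<inter> bmap -` W" using W norm_bmap by auto
  ultimately show ?thesis by simp
qed

lemma open_bdomain: "open (bdomain a)"
proof -
  have "open ((\<lambda>y. (y, a)) -` {q \<in> bdom. bmap q \<in> D})"
    by (rule open_vimage[OF open_preimage_D]) (intro continuous_intros)
  then show ?thesis by (simp add: bdomain_def vimage_def)
qed

lemma limit_core_nbhd:
  assumes "y \<in> limit_core"
  shows "\<exists>r>0. \<forall>y'\<in>ball y r. \<forall>a. \<bar>a\<bar> < r \<longrightarrow> y' \<in> bdomain a \<and> 1 / 2 < 1 + a * (y' \<bullet> e)"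
proof -
  define G where "G = {q \<in> bdom. bmap q \<in> D} \<inter> {q. 1 / 2 < 1 + snd q * (fst q \<bullet> e)}"
  have "open G" unfolding G_def
    by (intro open_Int open_preimage_D open_Collect_less continuous_intros)
  moreover have "(y, 0) \<in> G" using assms by (simp add: G_def limit_core_def)
  ultimately obtain r where r: "r > 0" "ball (y, 0) r \<subseteq> G" using openE by blast
  show ?thesis
  proof (intro exI[of _ "r / 2"] conjI ballI allI impI)
    fix y' a assume y: "y' \<in> ball y (r / 2)" and a: "\<bar>a\<bar> < r / 2"
    have "dist (y, 0) (y', a) \<le> dist y y' + dist 0 a"
      by (rule dist_Pair_le)
    then have "dist (y, 0) (y', a) < r" using y a by simp
    then have "(y', a) \<in> G" using subsetD[OF r(2)] by simp
    then show "y' \<in> bdomain a" "1 / 2 < 1 + a * (y' \<bullet> e)" by (auto simp: G_def bdomain_def)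
  qed (use r in simp)
qed

text \<open>The radius is fixed before \<open>\<delta>\<close>. This order allows the estimate to be
  chained with ever smaller thresholds.\<close>

lemma core_harnack:
  assumes "y1 \<in> limit_core"
  shows "\<exists>r>0. \<forall>\<delta>>0. \<exists>\<kappa>>0. \<forall>a k y y'. 0 < a \<longrightarrow> a < \<kappa> \<longrightarrow> almost_harmonic a \<kappa> k \<longrightarrow>
    y \<in> ball y1 r \<longrightarrow> y' \<in> ball y1 r \<longrightarrow> k y \<le> \<kappa> \<longrightarrow> y' \<in> bclosure a \<and> k y' \<le> \<delta>"
proof -
  obtain r1 where r1: "r1 > 0" and nb: "\<And>y a. y \<in> ball y1 r1 \<Longrightarrow> \<bar>a\<bar> < r1 \<Longrightarrow> y \<in> bdomain a \<and> 1 / 2 < 1 + a * (y \<bullet> e)"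
    using limit_core_nbhd[OF assms] by blast
  define R where "R = r1 / 2"
  have R: "R > 0" using r1 by (simp add: R_def)
  show ?thesis
  proof (rule exI[of _ "R / 8"], rule conjI, use R in simp, intro allI impI)
    fix \<delta> :: real assume \<delta>: "\<delta> > 0"
    obtain \<kappa>0 where \<kappa>0: "\<kappa>0 > 0" and ha: "\<And>(p::'a) h x.
        continuous_on (cball p R) h \<Longrightarrow> (\<forall>x\<in>cball p R. 0 \<le> h x \<and> h x \<le> 2) \<Longrightarrow>
        (\<forall>x\<in>ball p R. \<exists>L. \<bar>L\<bar> \<le> \<kappa>0 \<and> has_lap h x L) \<Longrightarrow> h p \<le> \<kappa>0 \<Longrightarrow>
        x \<in> cball p (R / 4) \<Longrightarrow> h x \<le> \<delta>"
      using harnack[OF R \<delta>, where 'a = 'a] by metis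
    define \<kappa> where "\<kappa> = min \<kappa>0 r1"
    have \<kappa>: "\<kappa> > 0" "\<kappa> \<le> \<kappa>0" "\<kappa> \<le> r1" using \<kappa>0 r1 by (auto simp: \<kappa>_def)
    show "\<exists>\<kappa>>0. \<forall>a k y y'. 0 < a \<longrightarrow> a < \<kappa> \<longrightarrow> almost_harmonic a \<kappa> k \<longrightarrow>
      y \<in> ball y1 (R / 8) \<longrightarrow> y' \<in> ball y1 (R / 8) \<longrightarrow> k y \<le> \<kappa> \<longrightarrow> y' \<in> bclosure a \<and> k y' \<le> \<delta>"
    proof (rule exI[of _ \<kappa>], intro conjI \<kappa>(1) allI impI)
      fix a k y y'
      assume a: "0 < a" "a < \<kappa>" and k: "almost_harmonic a \<kappa> k"
        and y: "y \<in> ball y1 (R / 8)" and y': "y' \<in> ball y1 (R / 8)" and ky: "k y \<le> \<kappa>"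
      have ar: "\<bar>a\<bar> < r1" using a \<kappa> by simp
      have near: "x \<in> bdomain a" "1 / 2 < 1 + a * (x \<bullet> e)" if "x \<in> cball y R" for x
      proof -
        have "dist y1 x < r1" using dist_triangle[of y1 x y] y that R by (simp add: R_def)
        then show "x \<in> bdomain a" "1 / 2 < 1 + a * (x \<bullet> e)" using nb[of x a] ar by auto
      qed
      then have sub: "cball y R \<subseteq> bclosure a" using bdomain_subset_bclosure by blast
      have d: "dist y1 y' < r1" using y' R by (simp add: R_def)
      then show "y' \<in> bclosure a" using nb[of y' a] ar bdomain_subset_bclosure by auto
      show "k y' \<le> \<delta>"
      proof (rule ha)
        have "continuous_on (bclosure a) k" using k by (simp add: almost_harmonic_def nonneg_neumann_def)
        then show "continuous_on (cball y R) k" using sub by (rule continuous_on_subset)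
        show "\<forall>x\<in>cball y R. 0 \<le> k x \<and> k x \<le> 2"
        proof
          fix x assume "x \<in> cball y R"
          then have "x \<in> bclosure a" using sub by (rule subsetD[rotated])
          then show "0 \<le> k x \<and> k x \<le> 2" using k by (simp add: almost_harmonic_def nonneg_neumann_def)
        qed
        show "\<forall>x\<in>ball y R. \<exists>L. \<bar>L\<bar> \<le> \<kappa>0 \<and> has_lap k x L"
        proof
          fix x assume "x \<in> ball y R"
          then have "x \<in> cball y R" by simp
          then obtain L where "\<bar>L\<bar> \<le> \<kappa>" "has_lap k x L"
            using near[of x] k unfolding almost_harmonic_def by blast
          then show "\<exists>L. \<bar>L\<bar> \<le> \<kappa>0 \<and> has_lap k x L" using \<kappa> by (intro exI[of _ L]) auto
        qed
        show "k y \<le> \<kappa>0" using ky \<kappa> by simp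
        show "y' \<in> cball y (R / 4)" using dist_triangle2[of y y' y1] y y' by (simp add: dist_commute)
      qed
    qed
  qed
qed

lemma D_sexp:
  assumes "x \<in> D"
  obtains z where "z \<bullet> e = 0" "norm z < pi / 2" "x = sexp z"
proof -
  have x: "norm x = 1" "x \<bullet> e > 0" using assms D_cap by auto
  show ?thesis by (rule sphere_eq_sexp[of x]) (use x that in auto)
qed

text \<open>The cylinder is the image of the product of \<open>D\<close> and an interval under
  normal coordinates plus height.\<close>

lemma connected_limit_core: "connected limit_core"
proof -
  define f where "f = (\<lambda>(x, s). slog x + s *\<^sub>R e)"
  have sl: "D \<subseteq> sldom"
  proof
    fix x assume "x \<in> D"
    then obtain z where z: "z \<bullet> e = 0" "norm z < pi / 2" "x = sexp z" by (rule D_sexp)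
    then show "x \<in> sldom" using sexp_sldom[of z] pi_gt_zero by simp
  qed
  have "continuous_on (D \<times> {-1<..<1}) f"
    unfolding f_def case_prod_beta
    by (intro continuous_intros continuous_on_compose2[OF Ck_on_imp_continuous_on[OF Ck_on_slog]])
      (use sl in auto)
  moreover have "connected (D \<times> {-1<..<1::real})"
    using D by (intro connected_Times) (auto simp: smooth_domain_def)
  ultimately have "connected (f ` (D \<times> {-1<..<1}))" by (rule connected_continuous_image)
  moreover have "f ` (D \<times> {-1<..<1}) = limit_core"
  proof
    show "f ` (D \<times> {-1<..<1}) \<subseteq> limit_core"
    proof clarify
      fix x and s :: real assume x: "x \<in> D" and s: "s \<in> {-1<..<1}"
      obtain z where z: "z \<bullet> e = 0" "norm z < pi / 2" "x = sexp z" using D_sexp[OF x] .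
      then have "slog x = z" using slog_sexp(1)[of z] pi_gt_zero by simp
      moreover have "hproj (z + s *\<^sub>R e) = z" using z by (simp add: hproj_add hproj_scaleR hproj_orth)
      moreover have "norm z < 5 / 2" using z pi_less_4 by simp
      ultimately show "f (x, s) \<in> limit_core"
        using x s z by (simp add: f_def limit_core_def bdom_def bmap_def inner_add_left abs_less_iff)
    qed
    show "limit_core \<subseteq> f ` (D \<times> {-1<..<1})"
    proof
      fix y assume y: "y \<in> limit_core"
      then have "norm (hproj y) < pi" using norm_blog_pi[of y 0] by (simp add: limit_core_def)
      then have "slog (bmap (y, 0)) = hproj y" by (simp add: bmap_def slog_sexp)
      then have "f (bmap (y, 0), y \<bullet> e) = y" using hproj_decomp[of y] by (simp add: f_def add.commute)
      then show "y \<in> f ` (D \<times> {-1<..<1})"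
        using y by (intro image_eqI[of _ _ "(bmap (y, 0), y \<bullet> e)"]) (auto simp: limit_core_def)
    qed
  qed
  ultimately show ?thesis by simp
qed

text \<open>Connectedness replaces a Harnack chain: the property holds at \<open>p\<close>, and
  within a Harnack ball it passes from any point to any other.\<close>

lemma core_smallness:
  assumes p: "p \<in> limit_core" and y: "y \<in> limit_core" and \<delta>: "\<delta> > 0"
  shows "\<exists>\<kappa>>0. \<forall>y'\<in>ball y \<kappa>. smallness_reaches p \<delta> \<kappa> y'"
proof -
  define good where "good y \<longleftrightarrow> (\<exists>\<kappa>>0. \<forall>y'\<in>ball y \<kappa>. smallness_reaches p \<delta> \<kappa> y')" for y
  have "good p"
  proof -
    obtain r where r: "r > 0" and h: "\<And>\<delta>. \<delta> > 0 \<Longrightarrow> \<exists>\<kappa>>0. \<forall>a k y y'. 0 < a \<longrightarrow> a < \<kappa> \<longrightarrow> almost_harmonic a \<kappa> k \<longrightarrow>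
      y \<in> ball p r \<longrightarrow> y' \<in> ball p r \<longrightarrow> k y \<le> \<kappa> \<longrightarrow> y' \<in> bclosure a \<and> k y' \<le> \<delta>"
      using core_harnack[OF p] by blast
    obtain \<kappa> where \<kappa>: "\<kappa> > 0" and h1: "\<And>a k y y'. 0 < a \<Longrightarrow> a < \<kappa> \<Longrightarrow> almost_harmonic a \<kappa> k \<Longrightarrow>
      y \<in> ball p r \<Longrightarrow> y' \<in> ball p r \<Longrightarrow> k y \<le> \<kappa> \<Longrightarrow> y' \<in> bclosure a \<and> k y' \<le> \<delta>"
      using h[OF \<delta>] by metis
    have "smallness_reaches p \<delta> (min \<kappa> r) y'" if "y' \<in> ball p (min \<kappa> r)" for y'
    proof -
      have "smallness_reaches p \<delta> \<kappa> y'" unfolding smallness_reaches_def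
        using h1[of _ _ y' p] that r by auto
      then show ?thesis by (rule smallness_reaches_mono) simp
    qed
    then show ?thesis using \<kappa> r unfolding good_def by (intro exI[of _ "min \<kappa> r"]) auto
  qed
  moreover have "\<exists>T. openin (top_of_set limit_core) T \<and> y1 \<in> T \<and> (\<forall>y\<in>T. \<forall>z\<in>T. good y \<longrightarrow> good z)"
    if y1: "y1 \<in> limit_core" for y1
  proof -
    obtain r where r: "r > 0" and h: "\<And>\<delta>. \<delta> > 0 \<Longrightarrow> \<exists>\<kappa>>0. \<forall>a k y y'. 0 < a \<longrightarrow> a < \<kappa> \<longrightarrow> almost_harmonic a \<kappa> k \<longrightarrow>
      y \<in> ball y1 r \<longrightarrow> y' \<in> ball y1 r \<longrightarrow> k y \<le> \<kappa> \<longrightarrow> y' \<in> bclosure a \<and> k y' \<le> \<delta>"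
      using core_harnack[OF y1] by blast
    have "good z" if "y \<in> ball y1 r" "z \<in> ball y1 r" "good y" for y z
    proof -
      obtain \<kappa>1 where \<kappa>1: "\<kappa>1 > 0" "\<And>y'. y' \<in> ball y \<kappa>1 \<Longrightarrow> smallness_reaches p \<delta> \<kappa>1 y'"
        using \<open>good y\<close> unfolding good_def by blast
      have s1: "smallness_reaches p \<delta> \<kappa>1 y" using \<kappa>1 by simp
      \<comment> \<open>The threshold \<open>\<kappa>1\<close> that already suffices at
        \<open>y\<close> becomes the target of the next Harnack step.\<close>
      obtain \<kappa>2 where \<kappa>2: "\<kappa>2 > 0" and h1: "\<And>a k y y'. 0 < a \<Longrightarrow> a < \<kappa>2 \<Longrightarrow> almost_harmonic a \<kappa>2 k \<Longrightarrow>
        y \<in> ball y1 r \<Longrightarrow> y' \<in> ball y1 r \<Longrightarrow> k y \<le> \<kappa>2 \<Longrightarrow> y' \<in> bclosure a \<and> k y' \<le> \<kappa>1"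
        using h[OF \<kappa>1(1)] by metis
      define \<kappa> where "\<kappa> = Min {\<kappa>1, \<kappa>2, r - dist y1 z}"
      have \<kappa>: "\<kappa> > 0" "\<kappa> \<le> \<kappa>1" "\<kappa> \<le> \<kappa>2" "\<kappa> \<le> r - dist y1 z" using \<kappa>1 \<kappa>2 that by (auto simp: \<kappa>_def)
      have "smallness_reaches p \<delta> \<kappa> y'" if y': "y' \<in> ball z \<kappa>" for y'
        unfolding smallness_reaches_def
      proof (intro allI impI)
        fix a k assume a: "0 < a" "a < \<kappa>" and k: "almost_harmonic a \<kappa> k" and ky: "k y' \<le> \<kappa>"
        have "y' \<in> ball y1 r" using y' \<kappa>(4) dist_triangle[of y1 y' z] by simp
        moreover have "a < \<kappa>2" "almost_harmonic a \<kappa>2 k" "k y' \<le> \<kappa>2"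
          using a \<kappa> ky almost_harmonic_mono[OF k] by auto
        ultimately have "y \<in> bclosure a \<and> k y \<le> \<kappa>1" using h1[OF a(1)] \<open>y \<in> ball y1 r\<close> by blast
        moreover have "a < \<kappa>1" "almost_harmonic a \<kappa>1 k" using a \<kappa> almost_harmonic_mono[OF k] by auto
        ultimately show "k p \<le> \<delta>" using s1 a(1) unfolding smallness_reaches_def by blast
      qed
      then show ?thesis unfolding good_def using \<kappa>(1) by blast
    qed
    then show ?thesis using r y1
      by (intro exI[of _ "limit_core \<inter> ball y1 r"]) (auto intro: openin_open_Int simp del: mem_ball)
  qed
  ultimately have "good y" using connected_induction_simple[OF connected_limit_core, of p y good] p y by blast
  then show ?thesis by (simp add: good_def)
qed

lemma compact_limit_slice: "compact limit_slice"
proof -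
  have "closed {z. sexp z \<in> closure D}"
    using continuous_closed_preimage[OF Ck_on_imp_continuous_on[OF Ck_on_sexp] closed_UNIV closed_closure]
    by (simp add: vimage_def)
  then have "closed ({z. z \<bullet> e = 0} \<inter> cball 0 (pi / 2) \<inter> {z. sexp z \<in> closure D})"
    by (intro closed_Int closed_Collect_eq continuous_intros) auto
  moreover have "limit_slice = {z. z \<bullet> e = 0} \<inter> cball 0 (pi / 2) \<inter> {z. sexp z \<in> closure D}"
    by (auto simp: limit_slice_def)
  ultimately show ?thesis
    by (auto simp: compact_eq_bounded_closed intro: bounded_subset[OF bounded_cball[of 0 "pi / 2"]])
qed

lemma limit_slice_cases:
  assumes "z \<in> limit_slice"
  shows "(z, 0) \<in> bdom" "bmap (z, 0) \<in> closure D" "\<bar>z \<bullet> e\<bar> < 1" "z \<in> limit_core \<or> bmap (z, 0) \<in> closure D - D"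
proof -
  have z: "z \<bullet> e = 0" "norm z \<le> pi / 2" "sexp z \<in> closure D" using assms by (auto simp: limit_slice_def)
  then have "norm z < 5 / 2" using pi_less_4 by simp
  then show "(z, 0) \<in> bdom" "bmap (z, 0) \<in> closure D" "\<bar>z \<bullet> e\<bar> < 1" using z
    by (auto simp: bdom_def hproj_orth bmap_def)
  then show "z \<in> limit_core \<or> bmap (z, 0) \<in> closure D - D" by (auto simp: limit_core_def)
qed

lemma hopf_slice:
  assumes z: "z \<in> limit_slice" "z \<notin> limit_core"
  obtains \<theta> K where "\<theta> > 0" "compact K" "K \<subseteq> limit_core"
    "\<And>a. 0 < a \<Longrightarrow> a < \<theta> \<Longrightarrow> K \<subseteq> bdomain a"
    "\<And>a y. 0 < a \<Longrightarrow> a < \<theta> \<Longrightarrow> y \<in> K \<Longrightarrow> 1 / 2 < 1 + a * (y \<bullet> e)"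
    "\<And>a k \<delta> y. 0 < a \<Longrightarrow> a < \<theta> \<Longrightarrow> \<delta> > 0 \<Longrightarrow> nonneg_neumann a k \<Longrightarrow>
      (\<forall>y\<in>bdomain a. 1 / 2 < 1 + a * (y \<bullet> e) \<longrightarrow> k y < \<delta> \<longrightarrow> (\<exists>L\<le>\<theta> * \<delta>. has_lap k y L)) \<Longrightarrow>
      (\<forall>y\<in>K. \<delta> \<le> k y) \<Longrightarrow> y \<in> ball z \<theta> \<Longrightarrow> y \<in> bclosure a \<Longrightarrow> \<theta> * \<delta> \<le> k y"
proof -
  have b: "bmap (z, 0) \<in> closure D - D" using limit_slice_cases(4)[OF z(1)] z(2) by blast
  obtain \<theta> K where \<theta>: "\<theta> > 0" and K: "compact K" "K \<subseteq> limit_core"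
    and all: "\<forall>a. 0 < a \<longrightarrow> a < \<theta> \<longrightarrow> K \<subseteq> bdomain a \<and> (\<forall>y\<in>K. 1 / 2 < 1 + a * (y \<bullet> e)) \<and>
    (\<forall>k \<delta>. \<delta> > 0 \<longrightarrow> nonneg_neumann a k \<longrightarrow>
      (\<forall>y\<in>bdomain a. 1 / 2 < 1 + a * (y \<bullet> e) \<longrightarrow> k y < \<delta> \<longrightarrow> (\<exists>L\<le>\<theta> * \<delta>. has_lap k y L)) \<longrightarrow>
      (\<forall>y\<in>K. \<delta> \<le> k y) \<longrightarrow> (\<forall>y\<in>ball z \<theta>. y \<in> bclosure a \<longrightarrow> \<theta> * \<delta> \<le> k y))"
    using hopf_local[OF limit_slice_cases(1)[OF z(1)] b limit_slice_cases(3)[OF z(1)]]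
    by (elim exE conjE) (rule that[rotated 3], assumption+)
  note a3 = all[THEN spec, THEN mp, THEN mp]
  show ?thesis
  proof (rule that[OF \<theta> K])
    show "K \<subseteq> bdomain a" if "0 < a" "a < \<theta>" for a using a3[OF that] by (rule conjunct1)
    show "1 / 2 < 1 + a * (y \<bullet> e)" if "0 < a" "a < \<theta>" "y \<in> K" for a y
      using a3[OF that(1,2), THEN conjunct2, THEN conjunct1] that(3) by (rule bspec)
    show "\<theta> * \<delta> \<le> k y" if "0 < a" "a < \<theta>" "\<delta> > 0" "nonneg_neumann a k"
      "\<forall>y\<in>bdomain a. 1 / 2 < 1 + a * (y \<bullet> e) \<longrightarrow> k y < \<delta> \<longrightarrow> (\<exists>L\<le>\<theta> * \<delta>. has_lap k y L)"
      "\<forall>y\<in>K. \<delta> \<le> k y" "y \<in> ball z \<theta>" "y \<in> bclosure a" for a k \<delta> y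
      by (rule a3[OF that(1,2), THEN conjunct2, THEN conjunct2, THEN spec, THEN spec, THEN mp, THEN mp,
            THEN mp, THEN mp, OF that(3-6), THEN bspec, THEN mp, OF that(7,8)])
  qed
qed

text \<open>Near a boundary point there are two cases. Either \<open>k\<close> is small somewhere on
  the interior layer \<open>K\<close>, whose points reach \<open>p\<close>, or it is at least
  \<open>\<kappa>1\<close> on all of \<open>K\<close>, and then the Hopf lemma contradicts smallness
  at \<open>y'\<close>.\<close>

lemma slice_smallness:
  assumes p: "p \<in> limit_core" and z: "z \<in> limit_slice" and \<delta>: "\<delta> > 0"
  shows "\<exists>\<kappa>>0. \<forall>y'\<in>ball z \<kappa>. smallness_reaches p \<delta> \<kappa> y'"
proof (cases "z \<in> limit_core")
  case True
  then show ?thesis using core_smallness p \<delta> by blast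
next
  case False
  show ?thesis
  proof (rule hopf_slice[OF z False])
    fix \<theta> :: real and K
    assume \<theta>: "\<theta> > 0" and K: "compact K" "K \<subseteq> limit_core"
      and Ka: "\<And>a. 0 < a \<Longrightarrow> a < \<theta> \<Longrightarrow> K \<subseteq> bdomain a"
      and Kw: "\<And>a y. 0 < a \<Longrightarrow> a < \<theta> \<Longrightarrow> y \<in> K \<Longrightarrow> 1 / 2 < 1 + a * (y \<bullet> e)"
      and hopf: "\<And>a k \<delta> y. 0 < a \<Longrightarrow> a < \<theta> \<Longrightarrow> \<delta> > 0 \<Longrightarrow> nonneg_neumann a k \<Longrightarrow>
        (\<forall>y\<in>bdomain a. 1 / 2 < 1 + a * (y \<bullet> e) \<longrightarrow> k y < \<delta> \<longrightarrow> (\<exists>L\<le>\<theta> * \<delta>. has_lap k y L)) \<Longrightarrow>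
        (\<forall>y\<in>K. \<delta> \<le> k y) \<Longrightarrow> y \<in> ball z \<theta> \<Longrightarrow> y \<in> bclosure a \<Longrightarrow> \<theta> * \<delta> \<le> k y"
    have "\<exists>\<kappa>>0. \<forall>y\<in>K. \<forall>y'\<in>ball y \<kappa>. smallness_reaches p \<delta> \<kappa> y'"
    proof (rule compact_uniform_radius[OF K(1)])
      show "\<exists>\<kappa>>0. \<forall>y'\<in>ball y \<kappa>. smallness_reaches p \<delta> \<kappa> y'" if "y \<in> K" for y
        using core_smallness[OF p _ \<delta>] that K(2) by blast
    qed (rule smallness_reaches_mono)
    then obtain \<kappa>1 where \<kappa>1: "\<kappa>1 > 0" "\<And>y. y \<in> K \<Longrightarrow> smallness_reaches p \<delta> \<kappa>1 y"
      by (metis centre_in_ball)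
    \<comment> \<open>Half of \<open>\<theta> * \<kappa>1\<close>, to lie strictly below the Hopf
      lower bound.\<close>
    define \<kappa> where "\<kappa> = Min {\<kappa>1, \<theta>, \<theta> * \<kappa>1 / 2}"
    have \<kappa>: "\<kappa> > 0" "\<kappa> \<le> \<kappa>1" "\<kappa> \<le> \<theta>" "\<kappa> \<le> \<theta> * \<kappa>1 / 2" using \<kappa>1(1) \<theta> by (auto simp: \<kappa>_def)
    have tk: "\<theta> * \<kappa>1 > 0" using \<theta> \<kappa>1(1) by simp
    have "smallness_reaches p \<delta> \<kappa> y'" if y': "y' \<in> ball z \<kappa>" for y'
      unfolding smallness_reaches_def
    proof (intro allI impI)
      fix a k assume a: "0 < a" "a < \<kappa>" and k: "almost_harmonic a \<kappa> k" and yc: "y' \<in> bclosure a" and ky: "k y' \<le> \<kappa>"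
      have a\<theta>: "a < \<theta>" using a \<kappa> by simp
      show "k p \<le> \<delta>"
      proof (cases "\<exists>y\<in>K. k y < \<kappa>1")
        case True
        then obtain y where y: "y \<in> K" "k y < \<kappa>1" by blast
        have "y \<in> bclosure a" using Ka[OF a(1) a\<theta>] y bdomain_subset_bclosure by blast
        moreover have "a < \<kappa>1" "almost_harmonic a \<kappa>1 k" using a \<kappa> almost_harmonic_mono[OF k] by auto
        ultimately show ?thesis using \<kappa>1(2)[OF y(1)] y(2) a(1) unfolding smallness_reaches_def by auto
      next
        case False
        have "\<theta> * \<kappa>1 \<le> k y'"
        proof (rule hopf[OF a(1) a\<theta> \<kappa>1(1)])
          show "nonneg_neumann a k" using k by (simp add: almost_harmonic_def)
          show "\<forall>y\<in>bdomain a. 1 / 2 < 1 + a * (y \<bullet> e) \<longrightarrow> k y < \<kappa>1 \<longrightarrow> (\<exists>L\<le>\<theta> * \<kappa>1. has_lap k y L)"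
          proof (intro ballI impI)
            fix y assume "y \<in> bdomain a" "1 / 2 < 1 + a * (y \<bullet> e)"
            then obtain L where "\<bar>L\<bar> \<le> \<kappa>" "has_lap k y L" using k unfolding almost_harmonic_def by blast
            then show "\<exists>L\<le>\<theta> * \<kappa>1. has_lap k y L" using \<kappa>(4) tk by (intro exI[of _ L]) auto
          qed
          show "\<forall>y\<in>K. \<kappa>1 \<le> k y" using False by force
          show "y' \<in> ball z \<theta>" using y' \<kappa>(3) by simp
        qed (rule yc)
        then show ?thesis using ky \<kappa>(4) tk by linarith
      qed
  qed
  then show ?thesis using \<kappa>(1) by blast
  qed
qed

lemma unblog_bclosure:
  assumes "z \<in> limit_slice" "0 < a" "a < 1 / 100"
  shows "unblog a z \<in> bclosure a" "dist z (unblog a z) \<le> 4 * a"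
  using assms unblog[of z a] by (auto simp: limit_slice_def bclosure_def bmap_def dist_commute)

text \<open>The representative \<open>unblog a z\<close> is within \<open>4 * a\<close> of the
  compact slice, so it falls under the uniform radius there.\<close>

lemma propagation:
  assumes p: "p \<in> limit_core" and \<delta>: "\<delta> > 0"
  shows "\<exists>\<kappa>>0. \<forall>a k z. 0 < a \<longrightarrow> a < \<kappa> \<longrightarrow> almost_harmonic a \<kappa> k \<longrightarrow> z \<in> limit_slice \<longrightarrow>
    k (unblog a z) = 0 \<longrightarrow> k p \<le> \<delta>"
proof -
  have "\<exists>\<kappa>>0. \<forall>y\<in>limit_slice. \<forall>y'\<in>ball y \<kappa>. smallness_reaches p \<delta> \<kappa> y'"
    by (rule compact_uniform_radius[OF compact_limit_slice]) (use slice_smallness p \<delta> smallness_reaches_mono in blast)+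
  then obtain \<kappa>1 where \<kappa>1: "\<kappa>1 > 0" "\<And>y y'. y \<in> limit_slice \<Longrightarrow> y' \<in> ball y \<kappa>1 \<Longrightarrow> smallness_reaches p \<delta> \<kappa>1 y'"
    by blast
  define \<kappa> where "\<kappa> = min (\<kappa>1 / 8) (1 / 100)"
  have \<kappa>: "\<kappa> > 0" "\<kappa> \<le> \<kappa>1 / 8" "\<kappa> \<le> 1 / 100" using \<kappa>1 by (auto simp: \<kappa>_def)
  show ?thesis
  proof (intro exI[of _ \<kappa>] conjI allI impI \<kappa>(1))
    fix a k z assume a: "0 < a" "a < \<kappa>" and k: "almost_harmonic a \<kappa> k" and z: "z \<in> limit_slice"
      and kz: "k (unblog a z) = 0"
    have u: "unblog a z \<in> bclosure a" "dist z (unblog a z) \<le> 4 * a" using unblog_bclosure[OF z] a \<kappa> by auto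
    then have "unblog a z \<in> ball z \<kappa>1" using a \<kappa> by simp
    then have s: "smallness_reaches p \<delta> \<kappa>1 (unblog a z)" using \<kappa>1(2)[OF z] by blast
    have "a < \<kappa>1" "almost_harmonic a \<kappa>1 k" "k (unblog a z) \<le> \<kappa>1"
      using a \<kappa> \<kappa>1(1) kz almost_harmonic_mono[OF k, of \<kappa>1] by auto
    then show "k p \<le> \<delta>" using s u(1) a(1) unfolding smallness_reaches_def by blast
  qed
qed

section \<open>Strong maximum principle up to the boundary\<close>

text \<open>The sign of the Laplacian matters only near possible zeros. The threshold admits
  \<open>1 - u\<close> for a negative eigenvalue, where the sign is known only below 1.\<close>

definition strictly_superharmonic :: "real \<Rightarrow> ('a \<Rightarrow> real) \<Rightarrow> bool" where
  "strictly_superharmonic a k \<longleftrightarrow> nonneg_neumann a k \<and>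
     (\<forall>y\<in>bdomain a. 1 / 2 < 1 + a * (y \<bullet> e) \<longrightarrow> k y < 1 / 2 \<longrightarrow> (\<exists>L<0. has_lap k y L))"

lemma strictly_superharmonic_interior:
  assumes k: "strictly_superharmonic a k" and y: "y \<in> bdomain a" "1 / 2 < 1 + a * (y \<bullet> e)"
  shows "k y > 0"
proof (rule ccontr)
  have k0: "0 \<le> k x" if "x \<in> bdomain a" for x
    using k that bdomain_subset_bclosure unfolding strictly_superharmonic_def nonneg_neumann_def by blast
  assume "\<not> k y > 0"
  then have ky: "k y = 0" using k0[OF y(1)] by simp
  then obtain L where L: "L < 0" "has_lap k y L" using k y unfolding strictly_superharmonic_def by force
  have "\<forall>\<^sub>F x in nhds y. x \<in> bdomain a" using open_bdomain y(1) by (rule eventually_nhds_in_open)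
  then have "\<forall>\<^sub>F x in nhds y. k y \<le> k x" by (rule eventually_mono) (use k0 ky in simp)
  from has_lap_local_min[OF this L(2)] L(1) show False by simp
qed

text \<open>Inside, a zero would be a minimum with negative Laplacian. At the boundary the Hopf
  lemma applies with a \<open>\<delta>\<close> depending on \<open>k\<close>: admissible, since its
  \<theta> and \<open>K\<close> do not depend on \<open>\<delta>\<close>.\<close>

lemma strictly_superharmonic_nonzero:
  "\<exists>\<kappa>>0. \<forall>a k z. 0 < a \<longrightarrow> a < \<kappa> \<longrightarrow> strictly_superharmonic a k \<longrightarrow> z \<in> limit_slice \<longrightarrow>
    k (unblog a z) \<noteq> 0"
proof -
  define P where "P \<kappa> y \<longleftrightarrow> (\<forall>a k. 0 < a \<longrightarrow> a < \<kappa> \<longrightarrow> strictly_superharmonic a k \<longrightarrow> y \<in> bclosure a \<longrightarrow> k y \<noteq> 0)"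
    for \<kappa> y
  have "\<exists>\<kappa>>0. \<forall>y\<in>limit_slice. \<forall>y'\<in>ball y \<kappa>. P \<kappa> y'"
  proof (rule compact_uniform_radius[OF compact_limit_slice])
    show "P \<kappa>' y" if "P \<kappa> y" "0 < \<kappa>'" "\<kappa>' \<le> \<kappa>" for \<kappa> \<kappa>' y using that by (auto simp: P_def)
    fix z assume z: "z \<in> limit_slice"
    show "\<exists>\<kappa>>0. \<forall>y'\<in>ball z \<kappa>. P \<kappa> y'"
    proof (cases "z \<in> limit_core")
      case True
      then obtain r where r: "r > 0" "\<And>y a. y \<in> ball z r \<Longrightarrow> \<bar>a\<bar> < r \<Longrightarrow> y \<in> bdomain a \<and> 1 / 2 < 1 + a * (y \<bullet> e)"
        using limit_core_nbhd by blast
      have "P r y'" if "y' \<in> ball z r" for y'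
        unfolding P_def using strictly_superharmonic_interior[of _ _ y'] r(2)[OF that] by force
      then show ?thesis using r(1) by blast
    next
      case False
      show ?thesis
      proof (rule hopf_slice[OF z False])
        fix \<theta> :: real and K
        assume \<theta>: "\<theta> > 0" and K: "compact K" "K \<subseteq> limit_core"
          and Ka: "\<And>a. 0 < a \<Longrightarrow> a < \<theta> \<Longrightarrow> K \<subseteq> bdomain a"
          and Kw: "\<And>a y. 0 < a \<Longrightarrow> a < \<theta> \<Longrightarrow> y \<in> K \<Longrightarrow> 1 / 2 < 1 + a * (y \<bullet> e)"
          and hopf: "\<And>a k \<delta> y. 0 < a \<Longrightarrow> a < \<theta> \<Longrightarrow> \<delta> > 0 \<Longrightarrow> nonneg_neumann a k \<Longrightarrow>
            (\<forall>y\<in>bdomain a. 1 / 2 < 1 + a * (y \<bullet> e) \<longrightarrow> k y < \<delta> \<longrightarrow> (\<exists>L\<le>\<theta> * \<delta>. has_lap k y L)) \<Longrightarrow>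
            (\<forall>y\<in>K. \<delta> \<le> k y) \<Longrightarrow> y \<in> ball z \<theta> \<Longrightarrow> y \<in> bclosure a \<Longrightarrow> \<theta> * \<delta> \<le> k y"
        have "P \<theta> y'" if y': "y' \<in> ball z \<theta>" for y'
          unfolding P_def
        proof (intro allI impI)
          fix a k assume a: "0 < a" "a < \<theta>" and k: "strictly_superharmonic a k" and yc: "y' \<in> bclosure a"
          have nn: "nonneg_neumann a k" using k by (simp add: strictly_superharmonic_def)
          have kpos: "k y > 0" if "y \<in> K" for y
            using strictly_superharmonic_interior[OF k] Ka[OF a] Kw[OF a that] that by blast
          \<comment> \<open>Compactness of \<open>K\<close> gives a positive lower bound; any
            positive number serves if \<open>K\<close> is empty.\<close>
          obtain m where m: "m > 0" "\<And>y. y \<in> K \<Longrightarrow> m \<le> k y"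
          proof (cases "K = {}")
            case True
            then show ?thesis using that[of 1] by simp
          next
            case False
            have "continuous_on K k" using nn Ka[OF a] bdomain_subset_bclosure
              unfolding nonneg_neumann_def by (meson continuous_on_subset order_trans)
            from continuous_attains_inf[OF K(1) False this]
            obtain y where "y \<in> K" "\<And>z. z \<in> K \<Longrightarrow> k y \<le> k z" by blast
            then show ?thesis using that[of "k y"] kpos by blast
          qed
          define \<delta> where "\<delta> = min m (1 / 2)"
          have \<delta>: "\<delta> > 0" "\<delta> \<le> m" "\<delta> \<le> 1 / 2" using m by (auto simp: \<delta>_def)
          have "\<theta> * \<delta> > 0" using \<theta> \<delta> by simp
          have "\<theta> * \<delta> \<le> k y'"
          proof (rule hopf[OF a \<delta>(1) nn _ _ y' yc])
            show "\<forall>y\<in>bdomain a. 1 / 2 < 1 + a * (y \<bullet> e) \<longrightarrow> k y < \<delta> \<longrightarrow> (\<exists>L\<le>\<theta> * \<delta>. has_lap k y L)"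
            proof (intro ballI impI)
              fix y assume "y \<in> bdomain a" "1 / 2 < 1 + a * (y \<bullet> e)" "k y < \<delta>"
              then obtain L where "L < 0" "has_lap k y L"
                using k \<delta>(3) unfolding strictly_superharmonic_def by (meson less_le_trans)
              then show "\<exists>L\<le>\<theta> * \<delta>. has_lap k y L" using \<open>\<theta> * \<delta> > 0\<close> by (intro exI[of _ L]) auto
            qed
            show "\<forall>y\<in>K. \<delta> \<le> k y" using m(2) \<delta>(2) by force
          qed
          then show "k y' \<noteq> 0" using \<open>\<theta> * \<delta> > 0\<close> by simp
      qed
      then show ?thesis using \<theta> by blast
      qed
    qed
  qed
  then obtain \<kappa>1 where \<kappa>1: "\<kappa>1 > 0" "\<And>y y'. y \<in> limit_slice \<Longrightarrow> y' \<in> ball y \<kappa>1 \<Longrightarrow> P \<kappa>1 y'"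
    by blast
  define \<kappa> where "\<kappa> = min (\<kappa>1 / 8) (1 / 100)"
  have \<kappa>: "\<kappa> > 0" "\<kappa> \<le> \<kappa>1 / 8" "\<kappa> \<le> 1 / 100" using \<kappa>1 by (auto simp: \<kappa>_def)
  show ?thesis
  proof (intro exI[of _ \<kappa>] conjI allI impI \<kappa>(1))
    fix a k z assume a: "0 < a" "a < \<kappa>" and k: "strictly_superharmonic a k" and z: "z \<in> limit_slice"
    have u: "unblog a z \<in> bclosure a" "dist z (unblog a z) \<le> 4 * a" using unblog_bclosure[OF z] a \<kappa> by auto
    then have "unblog a z \<in> ball z \<kappa>1" using a \<kappa> by simp
    then have "P \<kappa>1 (unblog a z)" using \<kappa>1(2)[OF z] by blast
    then show "k (unblog a z) \<noteq> 0" using a \<kappa> k u(1) unfolding P_def by auto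
  qed
qed

end


subsection \<open>Neumann eigenfunctions of the shrinking domains\<close>

lemma sgn_sgn: "sgn (sgn Y) = sgn (Y::'a::real_normed_vector)"
proof (cases "Y = 0")
  case False
  then show ?thesis using norm_sgn[of Y] sgn_div_norm[of "sgn Y"] by simp
qed simp

lemma sphere_grad_inner:
  assumes "Ck_on 1 S (\<lambda>y. f (sgn y))" "x \<in> S"
  shows "((\<lambda>y. f (sgn y)) has_derivative (\<lambda>v. sphere_grad f x \<bullet> v)) (at x)"
proof -
  have d: "((\<lambda>y. f (sgn y)) has_derivative frechet_derivative (\<lambda>y. f (sgn y)) (at x)) (at x)"
    using Ck_on_has_derivative[of 0 S _ x] assms by simp
  have "frechet_derivative (\<lambda>y. f (sgn y)) (at x) = (\<lambda>v. sphere_grad f x \<bullet> v)"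
    by (intro linear_eq_stdbasis has_derivative_linear[OF d])
      (auto simp: sphere_grad_def bounded_linear.linear bounded_linear_inner_right)
  then show ?thesis using d by simp
qed

context cap_domain
begin

section \<open>The dilated domains and their boundary functions\<close>

abbreviation shrunk :: "real \<Rightarrow> 'a set" where
  "shrunk a \<equiv> polar_dilation e a ` D"

text \<open>Agrees with \<open>polar_dilation\<close> on \<open>D\<close>, but as a composition of
  smooth maps it is continuous on the whole closure.\<close>

definition dilate :: "real \<Rightarrow> 'a \<Rightarrow> 'a" where
  "dilate a x = sexp (a *\<^sub>R slog x)"

lemma closure_D_sexp:
  assumes "x \<in> closure D"
  obtains z where "z \<in> limit_slice" "x = sexp z" "slog x = z"
proof -
  have x: "norm x = 1" "x \<bullet> e \<ge> 0" using closure_D[OF assms] by auto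
  from sphere_eq_sexp[OF this]
  obtain z where z: "z \<bullet> e = 0" "norm z \<le> pi / 2" "x = sexp z" by blast
  moreover have "norm z < pi" using z(2) pi_gt_zero by linarith
  ultimately show ?thesis using that[of z] assms slog_sexp(1)[of z] by (simp add: limit_slice_def)
qed

lemma limit_slice_norm: "z \<in> limit_slice \<Longrightarrow> z \<bullet> e = 0 \<and> norm z < pi"
  by (auto simp: limit_slice_def) (use pi_gt_zero in linarith)

lemma polar_dilation_eq_dilate:
  assumes "x \<in> D" shows "polar_dilation e a x = dilate a x"
proof -
  have "x \<in> closure D" using assms closure_subset by blast
  then obtain z where z: "z \<in> limit_slice" "x = sexp z" "slog x = z" by (rule closure_D_sexp)
  then show ?thesis using limit_slice_norm[OF z(1)] polar_dilation_sexp[of z a] by (simp add: dilate_def)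
qed

lemma continuous_on_dilate: "continuous_on (closure D) (dilate a)"
proof -
  have sl: "closure D \<subseteq> sldom"
  proof
    fix x assume "x \<in> closure D"
    then obtain z where z: "z \<in> limit_slice" "x = sexp z" "slog x = z" by (rule closure_D_sexp)
    then show "x \<in> sldom" using limit_slice_norm[OF z(1)] sexp_sldom[of z] by simp
  qed
  have "continuous_on (closure D) slog"
    using continuous_on_subset[OF Ck_on_imp_continuous_on[OF Ck_on_slog] sl] .
  then have "continuous_on (closure D) (\<lambda>x. a *\<^sub>R slog x)" by (intro continuous_intros)
  then show ?thesis unfolding dilate_def[abs_def]
    by (rule continuous_on_compose2[OF Ck_on_imp_continuous_on[OF Ck_on_sexp]]) auto
qed

lemma shrunk_eq: "shrunk a = dilate a ` D"
  by (intro image_cong polar_dilation_eq_dilate) auto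

lemma compact_closure_D: "compact (closure D)"
proof -
  have "closure D \<subseteq> sphere 0 1" using closure_D by auto
  then show ?thesis by (meson bounded_sphere bounded_subset closed_closure compact_eq_bounded_closed)
qed

text \<open>The image of the compact closure is closed, so dilating commutes with taking
  closures.\<close>

lemma closure_shrunk: "closure (shrunk a) = dilate a ` closure D"
proof
  have "compact (dilate a ` closure D)"
    by (rule compact_continuous_image[OF continuous_on_dilate compact_closure_D])
  then show "closure (shrunk a) \<subseteq> dilate a ` closure D"
    unfolding shrunk_eq by (intro closure_minimal compact_imp_closed image_mono closure_subset)
  show "dilate a ` closure D \<subseteq> closure (shrunk a)"
    unfolding shrunk_eq
    by (rule image_closure_subset[OF continuous_on_dilate closed_closure closure_subset])
qed

lemma compact_closure_shrunk: "compact (closure (shrunk a))"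
  unfolding closure_shrunk by (rule compact_continuous_image[OF continuous_on_dilate compact_closure_D])

lemma connected_closure_shrunk: "connected (closure (shrunk a))"
  unfolding closure_shrunk
  by (rule connected_continuous_image[OF continuous_on_dilate connected_imp_connected_closure])
    (use D in \<open>simp add: smooth_domain_def\<close>)

lemma closure_shrunk_unblog:
  assumes "x \<in> closure (shrunk a)" "a > 0"
  obtains z where "z \<in> limit_slice" "x = sgn (e + a *\<^sub>R unblog a z)"
proof -
  obtain x' where x': "x' \<in> closure D" "x = dilate a x'" using assms(1) unfolding closure_shrunk by blast
  obtain z where z: "z \<in> limit_slice" "x' = sexp z" "slog x' = z" using x'(1) by (rule closure_D_sexp)
  have n: "norm (sexp (a *\<^sub>R z)) = 1" using limit_slice_norm[OF z(1)] by (intro norm_sexp) simp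
  have "sgn (e + a *\<^sub>R unblog a z) = sgn (sexp (a *\<^sub>R z))" using assms(2) by (simp add: unblog_ray)
  also have "\<dots> = sexp (a *\<^sub>R z)" using n by (simp add: sgn_div_norm)
  finally have "x = sgn (e + a *\<^sub>R unblog a z)" unfolding x'(2) dilate_def z(3) by (rule sym)
  then show ?thesis by (rule that[OF z(1)])
qed

lemma ray_eq_dilate:
  assumes "(y, a) \<in> bdom" "a > 0"
  shows "sgn (e + a *\<^sub>R y) = dilate a (bmap (y, a))"
proof -
  have "slog (bmap (y, a)) = blog (y, a)"
    unfolding bmap_def using assms by (intro slog_sexp norm_blog_pi) auto
  then show ?thesis using sgn_ray[OF assms(1)] by (simp add: dilate_def)
qed

lemma ray_mem_shrunk:
  assumes y: "(y, a) \<in> bdom" and a: "a > 0"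
  shows "sgn (e + a *\<^sub>R y) \<in> shrunk a \<longleftrightarrow> bmap (y, a) \<in> D"
proof
  assume "bmap (y, a) \<in> D"
  then show "sgn (e + a *\<^sub>R y) \<in> shrunk a" unfolding shrunk_eq ray_eq_dilate[OF assms] by (rule imageI)
next
  assume "sgn (e + a *\<^sub>R y) \<in> shrunk a"
  then obtain x where x: "x \<in> D" "sgn (e + a *\<^sub>R y) = dilate a x" unfolding shrunk_eq by blast
  have "x \<in> closure D" using x closure_subset by blast
  then obtain z where z: "z \<in> limit_slice" "x = sexp z" "slog x = z" by (rule closure_D_sexp)
  \<comment> \<open>Two normal coordinates of the same point; both have norm below
    \<open>pi\<close>, where \<open>slog\<close> is a left inverse of \<open>sexp\<close>.\<close>
  have eq: "sexp (a *\<^sub>R blog (y, a)) = sexp (a *\<^sub>R z)"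
    using x(2) unfolding sgn_ray[OF assms(1)] dilate_def z(3) .
  have "\<bar>a\<bar> < 1 / 100" using y by (simp add: bdom_def)
  then have a1: "a < 1" by linarith
  have n: "norm (a *\<^sub>R v) < pi" if "norm v < pi" for v :: 'a
  proof -
    have "a * norm v \<le> 1 * norm v" using a a1 by (intro mult_right_mono) auto
    then show ?thesis using that a by simp
  qed
  have nb: "norm (a *\<^sub>R blog (y, a)) < pi" using a by (intro n norm_blog_pi[OF y]) simp
  have nz: "(a *\<^sub>R z) \<bullet> e = 0" "norm (a *\<^sub>R z) < pi" using n[of z] limit_slice_norm[OF z(1)] by auto
  have "a *\<^sub>R blog (y, a) = slog (sexp (a *\<^sub>R blog (y, a)))"
    by (rule slog_sexp(1)[OF _ nb, symmetric]) simp
  also have "\<dots> = slog (sexp (a *\<^sub>R z))" by (simp only: eq)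
  also have "\<dots> = a *\<^sub>R z" by (rule slog_sexp(1)[OF nz])
  finally have "blog (y, a) = z" using a by simp
  then show "bmap (y, a) \<in> D" using x(1) unfolding bmap_def z(2) by simp
qed

lemma ray_mem_closure_shrunk:
  assumes "y \<in> bclosure a" "a > 0"
  shows "sgn (e + a *\<^sub>R y) \<in> closure (shrunk a)"
proof -
  have "(y, a) \<in> bdom" "bmap (y, a) \<in> closure D" using assms(1) by (auto simp: bclosure_def)
  then show ?thesis unfolding closure_shrunk ray_eq_dilate[OF \<open>(y, a) \<in> bdom\<close> assms(2)] by (intro imageI)
qed

text \<open>Dividing \<open>e + a *\<^sub>R y'\<close> by \<open>t\<close> gives a point affine in
  \<open>y'\<close> on the same ray. For functions constant along rays the blow-up is thus an affine
  change of variables with factor \<open>a / t\<close>.\<close>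

lemma ray_line:
  assumes "(y, a) \<in> bdom"
  defines "t \<equiv> norm (e + a *\<^sub>R y)"
  shows "t > 0" "sgn (sgn (e + a *\<^sub>R y) + (a / t) *\<^sub>R (y' - y)) = sgn (e + a *\<^sub>R y')"
proof -
  show t: "t > 0" using ray_nonzero[OF assms(1)] by (simp add: t_def)
  have "sgn (e + a *\<^sub>R y) + (a / t) *\<^sub>R (y' - y) = (1 / t) *\<^sub>R (e + a *\<^sub>R y')"
    using t by (simp add: sgn_div_norm t_def[symmetric] algebra_simps divide_inverse)
  then show "sgn (sgn (e + a *\<^sub>R y) + (a / t) *\<^sub>R (y' - y)) = sgn (e + a *\<^sub>R y')"
    using t by (simp add: sgn_scaleR)
qed

text \<open>A defining function of \<open>D\<close> is carried to the dilated domain, and by the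
  affine factor its spherical gradient is parallel to \<open>bnormal\<close>. Its class
  \<open>C\<^sup>1\<close> is enough for \<open>outward_unit_normal\<close>, so the Neumann
  condition applies to it.\<close>

lemma transported_boundary_function:
  assumes y: "y \<in> bclosure a - bdomain a" and a: "a > 0"
    and lb: "local_boundary V \<rho> (bmap (y, a))" and n: "bnormal a \<rho> y \<noteq> 0"
  shows "\<exists>V' \<rho>' c. boundary_function (shrunk a) (sgn (e + a *\<^sub>R y)) V' \<rho>' \<and>
    bnormal a \<rho> y = c *\<^sub>R sphere_grad \<rho>' (sgn (e + a *\<^sub>R y))"
proof -
  have V: "open V" "bmap (y, a) \<in> V" "Ck_on 1 V \<rho>" "D \<inter> V = {x \<in> sphere 0 1 \<inter> V. \<rho> x < 0}"
    using lb unfolding local_boundary_def by blast+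
  have yb: "(y, a) \<in> bdom" using y by (simp add: bclosure_def)
  define x where "x = sgn (e + a *\<^sub>R y)"
  define t where "t = norm (e + a *\<^sub>R y)"
  have t: "t > 0" using ray_line(1)[OF yb] by (simp add: t_def)
  have nx: "norm x = 1" using ray_nonzero[OF yb] by (simp add: x_def norm_sgn)
  \<comment> \<open>The blown-up representative of the ray through \<open>Y\<close>, with
    \<open>e + a *\<^sub>R m Y = sgn Y\<close>; it makes \<open>\<rho>'\<close> constant along
    rays.\<close>
  define m where "m Y = (1 / a) *\<^sub>R (sgn Y - e)" for Y
  define \<rho>' where "\<rho>' Y = \<rho> (bmap (m Y, a))" for Y
  have \<rho>sgn: "(\<lambda>Y. \<rho>' (sgn Y)) = \<rho>'" by (intro ext) (simp add: \<rho>'_def m_def sgn_sgn)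
  have \<rho>ray: "(m (e + a *\<^sub>R y'), a) \<in> bdom" "bmap (m (e + a *\<^sub>R y'), a) = bmap (y', a)"
    if "(y', a) \<in> bdom" for y'
  proof -
    have "m (e + a *\<^sub>R y') = (1 / a) *\<^sub>R ((1 / norm (e + a *\<^sub>R y')) *\<^sub>R (e + a *\<^sub>R y') - e)"
      by (simp add: m_def sgn_div_norm divide_inverse)
    then show "(m (e + a *\<^sub>R y'), a) \<in> bdom" "bmap (m (e + a *\<^sub>R y'), a) = bmap (y', a)"
      using bdom_ray[OF that a, of "1 / norm (e + a *\<^sub>R y')"] ray_nonzero[OF that] by (simp_all add: bmap_def)
  qed
  define S where "S = bdom \<inter> bmap -` V"
  have S: "open S" unfolding S_def
    by (rule continuous_open_preimage[OF Ck_on_imp_continuous_on[OF Ck_on_bmap] open_bdom V(1)])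
  define V' where "V' = - {0} \<inter> (\<lambda>Y. (m Y, a)) -` S"
  have o1: "open (- {0::'a})" by (simp add: open_Compl)
  have mk: "Ck_on 1 (- {0}) (\<lambda>Y. (m Y, a))"
  proof -
    have mm: "Ck_on 1 (- {0}) m" unfolding m_def[abs_def]
      by (intro Ck_on_scaleR Ck_on_diff o1 Ck_on_const Ck_on_sgn)
    have bl: "bounded_linear (\<lambda>u::'a. (u, 0::real))"
      by (intro bounded_linear_Pair bounded_linear_ident bounded_linear_zero)
    have m0: "Ck_on 1 (- {0}) (\<lambda>Y. (m Y, 0::real))"
      by (rule Ck_on_compose[OF o1 Ck_on_bounded_linear[OF bl, of 1 UNIV] mm UNIV_I])
    have eq: "(\<lambda>Y. (m Y, 0) + (0, a)) = (\<lambda>Y. (m Y, a))" by (intro ext) simp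
    show ?thesis
      using Ck_on_add[OF o1 m0 Ck_on_const[of 1 "- {0}" "(0::'a, a)"]] unfolding eq .
  qed
  have V'o: "open V'" unfolding V'_def
    by (rule continuous_open_preimage[OF Ck_on_imp_continuous_on[OF mk] o1 S])
  have "Ck_on 1 S (\<lambda>q. \<rho> (bmap q))"
    by (rule Ck_on_compose[OF S V(3) Ck_on_subset[OF Ck_on_bmap]]) (auto simp: S_def)
  then have \<rho>k: "Ck_on 1 V' \<rho>'" unfolding \<rho>'_def[abs_def]
    by (rule Ck_on_compose[OF V'o _ Ck_on_subset[OF mk]]) (auto simp: V'_def)
  have mx: "m x = m (e + a *\<^sub>R y)" by (simp add: m_def x_def sgn_sgn)
  have xV: "x \<in> V'" using \<rho>ray[OF yb] V(2) nx by (auto simp: V'_def S_def mx)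
  have "Ck_on 1 V' (\<lambda>Y. \<rho>' (sgn Y))" unfolding \<rho>sgn by (rule \<rho>k)
  from sphere_grad_inner[OF this xV]
  have "(\<rho>' has_derivative (\<lambda>v. sphere_grad \<rho>' x \<bullet> v)) (at (x + (a / t) *\<^sub>R (y - y)))"
    unfolding \<rho>sgn by simp
  moreover have "((\<lambda>y'. x + (a / t) *\<^sub>R (y' - y)) has_derivative (\<lambda>v. (a / t) *\<^sub>R v)) (at y)"
    by (auto intro!: derivative_eq_intros)
  ultimately have d: "((\<lambda>y'. \<rho>' (x + (a / t) *\<^sub>R (y' - y))) has_derivative
      (\<lambda>v. sphere_grad \<rho>' x \<bullet> ((a / t) *\<^sub>R v))) (at y)"
    using has_derivative_compose by blast
  have ob: "open {y'. (y', a) \<in> bdom}"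
    using open_vimage[OF open_bdom, of "\<lambda>y'. (y', a)"] by (simp add: vimage_def continuous_intros)
  have "((\<lambda>y'. \<rho> (bmap (y', a))) has_derivative (\<lambda>v. sphere_grad \<rho>' x \<bullet> ((a / t) *\<^sub>R v))) (at y)"
  proof (rule has_derivative_transform_within_open[OF d ob])
    show "y \<in> {y'. (y', a) \<in> bdom}" using yb by simp
    fix y' assume "y' \<in> {y'. (y', a) \<in> bdom}"
    then have y': "(y', a) \<in> bdom" by simp
    have "m (x + (a / t) *\<^sub>R (y' - y)) = m (e + a *\<^sub>R y')"
      using ray_line(2)[OF yb, of y'] by (simp add: m_def x_def t_def)
    then show "\<rho>' (x + (a / t) *\<^sub>R (y' - y)) = \<rho> (bmap (y', a))"
      using \<rho>ray[OF y'] by (simp add: \<rho>'_def)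
  qed
  then have fd: "frechet_derivative (\<lambda>y'. \<rho> (bmap (y', a))) (at y) = (\<lambda>v. (a / t) * (sphere_grad \<rho>' x \<bullet> v))"
    using frechet_derivative_at by fastforce
  have "bnormal a \<rho> y = (\<Sum>b\<in>Basis. (a / t) *\<^sub>R ((sphere_grad \<rho>' x \<bullet> b) *\<^sub>R b))"
    unfolding bnormal_def fd by simp
  also have "\<dots> = (a / t) *\<^sub>R sphere_grad \<rho>' x"
    unfolding scaleR_right.sum[symmetric] by (simp only: euclidean_representation)
  finally have bn: "bnormal a \<rho> y = (a / t) *\<^sub>R sphere_grad \<rho>' x" .
  have iff: "Y \<in> shrunk a \<longleftrightarrow> \<rho>' Y < 0" if Y: "norm Y = 1" "Y \<in> V'" for Y
  proof -
    have sY: "sgn Y = Y" using Y by (simp add: sgn_div_norm)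
    have mY: "(m Y, a) \<in> bdom" "bmap (m Y, a) \<in> V" using Y by (auto simp: V'_def S_def)
    have "e + a *\<^sub>R m Y = Y" using a by (simp add: m_def sY)
    then have "Y \<in> shrunk a \<longleftrightarrow> bmap (m Y, a) \<in> D" using ray_mem_shrunk[OF mY(1) a] sY by simp
    also have "\<dots> \<longleftrightarrow> bmap (m Y, a) \<in> D \<inter> V" using mY(2) by simp
    also have "\<dots> \<longleftrightarrow> \<rho>' Y < 0" unfolding V(4) using mY(2) norm_bmap by (simp add: \<rho>'_def)
    finally show ?thesis .
  qed
  have n1: "norm Y = 1" if Y: "Y \<in> shrunk a" for Y
  proof -
    obtain x where "Y = dilate a x" using Y unfolding shrunk_eq by blast
    then have "Y = sexp (a *\<^sub>R slog x)" by (simp only: dilate_def)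
    then show ?thesis using norm_sexp[of "a *\<^sub>R slog x"] by (simp add: slog_orth)
  qed
  have "shrunk a \<inter> V' = {x \<in> sphere 0 1 \<inter> V'. \<rho>' x < 0}"
  proof (intro set_eqI iffI)
    fix Y assume Y: "Y \<in> shrunk a \<inter> V'"
    then have "norm Y = 1" using n1 by blast
    then show "Y \<in> {x \<in> sphere 0 1 \<inter> V'. \<rho>' x < 0}" using Y iff[of Y] by simp
  next
    fix Y assume Y: "Y \<in> {x \<in> sphere 0 1 \<inter> V'. \<rho>' x < 0}"
    then have "norm Y = 1" "Y \<in> V'" "\<rho>' Y < 0" by auto
    then show "Y \<in> shrunk a \<inter> V'" using iff[of Y] by blast
  qed
  moreover have "sphere_grad \<rho>' x \<noteq> 0" using n bn by auto
  ultimately have "boundary_function (shrunk a) x V' \<rho>'"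
    unfolding boundary_function_def using V'o xV \<rho>k by blast
  then show ?thesis
    by (intro exI[of _ V'] exI[of _ \<rho>'] exI[of _ "a / t"] conjI) (simp_all only: bn x_def[symmetric])
qed

text \<open>The Neumann problem for \<open>u\<close> in terms of \<open>y \<mapsto> u (sgn (e + a y))\<close>; in this form it is linear in
  \<open>u\<close> for trivial reasons.\<close>

definition blown_solution :: "real \<Rightarrow> real \<Rightarrow> ('a \<Rightarrow> real) \<Rightarrow> bool" where
  "blown_solution a \<mu> u \<longleftrightarrow> continuous_on (closure (shrunk a)) u \<and>
     (\<forall>y\<in>bdomain a. has_lap (\<lambda>y. u (sgn (e + a *\<^sub>R y))) y
        (- (a / norm (e + a *\<^sub>R y))\<^sup>2 * (\<mu> * u (sgn (e + a *\<^sub>R y))))) \<and>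
     (\<forall>y\<in>bclosure a - bdomain a. \<forall>V \<rho>. local_boundary V \<rho> (bmap (y, a)) \<longrightarrow> bnormal a \<rho> y \<noteq> 0 \<longrightarrow>
        ((\<lambda>t. u (sgn (e + a *\<^sub>R (y + t *\<^sub>R bnormal a \<rho> y)))) has_real_derivative 0) (at 0))"

lemma blown_solution_continuous: "blown_solution a \<mu> u \<Longrightarrow> continuous_on (closure (shrunk a)) u"
  and blown_solution_lap: "blown_solution a \<mu> u \<Longrightarrow> y \<in> bdomain a \<Longrightarrow>
    has_lap (\<lambda>y. u (sgn (e + a *\<^sub>R y))) y (- (a / norm (e + a *\<^sub>R y))\<^sup>2 * (\<mu> * u (sgn (e + a *\<^sub>R y))))"
  and blown_solution_normal: "blown_solution a \<mu> u \<Longrightarrow> y \<in> bclosure a - bdomain a \<Longrightarrow>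
    local_boundary V \<rho> (bmap (y, a)) \<Longrightarrow> bnormal a \<rho> y \<noteq> 0 \<Longrightarrow>
    ((\<lambda>t. u (sgn (e + a *\<^sub>R (y + t *\<^sub>R bnormal a \<rho> y)))) has_real_derivative 0) (at 0)"
  unfolding blown_solution_def by (elim conjE, assumption, elim conjE, erule (1) bspec, elim conjE, drule (1) bspec, blast)

text \<open>The radially constant extension has the spherical Laplacian as its Euclidean one at unit
  vectors. The affine form of the blow-up turns it into the stated multiple, and its differential
  vanishes on \<open>bnormal\<close> by parallelism.\<close>

lemma eigenfunction_blown_solution:
  assumes u: "neumann_eigenfunction (shrunk a) \<mu> u" and a: "a > 0"
  shows "blown_solution a \<mu> u"
proof -
  obtain V where V: "open V" "closure (shrunk a) \<subseteq> V" "Ck_on 2 V u"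
    and eq: "\<And>x. x \<in> shrunk a \<Longrightarrow> - sphere_laplacian u x = \<mu> * u x"
    and neu: "\<And>p \<nu>. p \<in> closure (shrunk a) - shrunk a \<Longrightarrow> outward_unit_normal (shrunk a) p \<nu> \<Longrightarrow>
      sphere_grad u p \<bullet> \<nu> = 0"
    using u unfolding neumann_eigenfunction_def by blast
  define F where "F Y = u (sgn Y)" for Y
  define S where "S = - {0} \<inter> sgn -` V"
  have o1: "open (- {0::'a})" by (simp add: open_Compl)
  have S: "open S" unfolding S_def
    by (rule continuous_open_preimage[OF Ck_on_imp_continuous_on[OF Ck_on_sgn] o1 V(1)])
  have F2: "Ck_on 2 S F" unfolding F_def[abs_def]
    by (rule Ck_on_compose[OF S V(3) Ck_on_subset[OF Ck_on_sgn]]) (auto simp: S_def)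
  have F1: "Ck_on 1 S (\<lambda>y. u (sgn y))" using Ck_on_le[OF F2, of 1] by (simp add: F_def[abs_def])
  have inS: "sgn (e + a *\<^sub>R y) \<in> S" if "y \<in> bclosure a" for y
    using ray_mem_closure_shrunk[OF that a] V(2) ray_nonzero[of y a] that
    by (auto simp: S_def sgn_sgn bclosure_def sgn_zero_iff)
  have Fline: "u (sgn (e + a *\<^sub>R y')) = F (sgn (e + a *\<^sub>R y) + (a / norm (e + a *\<^sub>R y)) *\<^sub>R (y' - y))"
    if "(y, a) \<in> bdom" for y y'
    using ray_line(2)[OF that, of y'] by (simp add: F_def)
  show ?thesis unfolding blown_solution_def
  proof (intro conjI ballI allI impI)
    show "continuous_on (closure (shrunk a)) u"
      using continuous_on_subset[OF Ck_on_imp_continuous_on[OF V(3)] V(2)] .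
  next
    fix y assume y: "y \<in> bdomain a"
    then have yb: "(y, a) \<in> bdom" by (simp add: bdomain_def)
    define x where "x = sgn (e + a *\<^sub>R y)"
    have "y \<in> bclosure a" using y bdomain_subset_bclosure by blast
    then have xS: "x \<in> S" using inS by (simp add: x_def)
    have "has_lap F x (sphere_laplacian u x)"
      unfolding sphere_laplacian_def F_def[symmetric]
      by (rule has_lap_D2) (rule D2_Ck_on[OF F2 S xS])
    moreover have "sphere_laplacian u x = - (\<mu> * u x)"
      using eq[of x] ray_mem_shrunk[OF yb a] y by (simp add: x_def bdomain_def)
    ultimately have "has_lap F x (- (\<mu> * u x))" by simp
    from has_lap_affine[OF this, of "a / norm (e + a *\<^sub>R y)" y]
    have "has_lap (\<lambda>y'. F (x + (a / norm (e + a *\<^sub>R y)) *\<^sub>R (y' - y))) y ((a / norm (e + a *\<^sub>R y))\<^sup>2 * - (\<mu> * u x))"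
      using a ray_nonzero[OF yb] by simp
    then show "has_lap (\<lambda>y. u (sgn (e + a *\<^sub>R y))) y
        (- (a / norm (e + a *\<^sub>R y))\<^sup>2 * (\<mu> * u (sgn (e + a *\<^sub>R y))))"
      using Fline[OF yb] by (simp add: x_def)
  next
    fix y V1 \<rho>
    assume y: "y \<in> bclosure a - bdomain a" and lb: "local_boundary V1 \<rho> (bmap (y, a))" and n: "bnormal a \<rho> y \<noteq> 0"
    have yb: "(y, a) \<in> bdom" using y by (simp add: bclosure_def)
    define x where "x = sgn (e + a *\<^sub>R y)"
    define c where "c = a / norm (e + a *\<^sub>R y)"
    define N where "N = bnormal a \<rho> y"
    have xS: "x \<in> S" using inS y by (simp add: x_def)
    obtain V' \<rho>' c' where bf: "boundary_function (shrunk a) x V' \<rho>'" and N: "N = c' *\<^sub>R sphere_grad \<rho>' x"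
      using transported_boundary_function[OF y a lb n] by (auto simp: x_def N_def)
    have "x \<in> closure (shrunk a) - shrunk a"
      using y ray_mem_closure_shrunk[OF _ a] ray_mem_shrunk[OF yb a] by (auto simp: x_def bdomain_def bclosure_def)
    moreover have "outward_unit_normal (shrunk a) x (sgn (sphere_grad \<rho>' x))"
      using bf unfolding outward_unit_normal_def by blast
    ultimately have "sphere_grad u x \<bullet> sgn (sphere_grad \<rho>' x) = 0" by (rule neu)
    then have "sphere_grad u x \<bullet> sphere_grad \<rho>' x = 0" by (auto simp: sgn_div_norm)
    then have z: "sphere_grad u x \<bullet> N = 0" by (simp add: N)
    have "(F has_derivative (\<lambda>v. sphere_grad u x \<bullet> v)) (at (x + (0 * c) *\<^sub>R N))"
      using sphere_grad_inner[OF F1 xS] by (simp add: F_def[abs_def])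
    moreover have "((\<lambda>t. x + (t * c) *\<^sub>R N) has_derivative (\<lambda>t. (t * c) *\<^sub>R N)) (at 0)"
      by (auto intro!: derivative_eq_intros)
    ultimately have "((\<lambda>t. F (x + (t * c) *\<^sub>R N)) has_derivative (\<lambda>t. sphere_grad u x \<bullet> ((t * c) *\<^sub>R N))) (at 0)"
      using has_derivative_compose[where f = "\<lambda>t. x + (t * c) *\<^sub>R N" and g = F and x = 0 and s = UNIV] by blast
    then have "((\<lambda>t. F (x + (t * c) *\<^sub>R N)) has_real_derivative 0) (at 0)"
      using z by (simp add: has_field_derivative_def lambda_zero)
    moreover have "u (sgn (e + a *\<^sub>R (y + t *\<^sub>R N))) = F (x + (t * c) *\<^sub>R N)" for t
      using Fline[OF yb, of "y + t *\<^sub>R N"] by (simp add: x_def c_def mult.commute)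
    ultimately show "((\<lambda>t. u (sgn (e + a *\<^sub>R (y + t *\<^sub>R bnormal a \<rho> y)))) has_real_derivative 0) (at 0)"
      by (simp add: N_def)
  qed
qed

lemma blown_solution_combination:
  assumes u: "blown_solution a \<mu> u" and v: "blown_solution a \<mu> v"
  shows "blown_solution a \<mu> (\<lambda>x. c * u x + d * v x)"
  unfolding blown_solution_def
proof (intro conjI ballI allI impI)
  show "continuous_on (closure (shrunk a)) (\<lambda>x. c * u x + d * v x)"
    by (intro continuous_intros blown_solution_continuous[OF u] blown_solution_continuous[OF v])
next
  fix y assume "y \<in> bdomain a"
  then have "has_lap (\<lambda>y. c * u (sgn (e + a *\<^sub>R y)) + d * v (sgn (e + a *\<^sub>R y))) y
     (c * (- (a / norm (e + a *\<^sub>R y))\<^sup>2 * (\<mu> * u (sgn (e + a *\<^sub>R y)))) +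
      d * (- (a / norm (e + a *\<^sub>R y))\<^sup>2 * (\<mu> * v (sgn (e + a *\<^sub>R y)))))"
    by (intro has_lap_add has_lap_cmult blown_solution_lap[OF u] blown_solution_lap[OF v])
  then show "has_lap (\<lambda>y. c * u (sgn (e + a *\<^sub>R y)) + d * v (sgn (e + a *\<^sub>R y))) y
     (- (a / norm (e + a *\<^sub>R y))\<^sup>2 * (\<mu> * (c * u (sgn (e + a *\<^sub>R y)) + d * v (sgn (e + a *\<^sub>R y)))))"
    by (rule back_subst[of "has_lap _ _"]) (simp add: algebra_simps)
next
  fix y V \<rho>
  assume y: "y \<in> bclosure a - bdomain a" "local_boundary V \<rho> (bmap (y, a))" "bnormal a \<rho> y \<noteq> 0"
  have "((\<lambda>t. c * u (sgn (e + a *\<^sub>R (y + t *\<^sub>R bnormal a \<rho> y))) + d * v (sgn (e + a *\<^sub>R (y + t *\<^sub>R bnormal a \<rho> y))))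
      has_real_derivative c * 0 + d * 0) (at 0)"
    by (intro DERIV_add DERIV_cmult blown_solution_normal[OF u y] blown_solution_normal[OF v y])
  then show "((\<lambda>t. c * u (sgn (e + a *\<^sub>R (y + t *\<^sub>R bnormal a \<rho> y))) + d * v (sgn (e + a *\<^sub>R (y + t *\<^sub>R bnormal a \<rho> y))))
      has_real_derivative 0) (at 0)" by simp
qed

text \<open>The constant \<open>A\<close> is harmonic, hence the equation holds for
  \<open>k - A\<close>.\<close>

lemma blown_solution_affine:
  assumes u: "blown_solution a \<mu> u" and a: "a > 0" and nn: "\<forall>x\<in>closure (shrunk a). 0 \<le> A + B * u x"
  defines "k \<equiv> \<lambda>y. A + B * u (sgn (e + a *\<^sub>R y))"
  shows "nonneg_neumann a k"
    and "\<And>y. y \<in> bdomain a \<Longrightarrow> has_lap k y (- (a / norm (e + a *\<^sub>R y))\<^sup>2 * (\<mu> * (k y - A)))"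
proof -
  show "nonneg_neumann a k" unfolding nonneg_neumann_def
  proof (intro conjI ballI allI impI)
    have c: "continuous_on (bclosure a) (\<lambda>y. sgn (e + a *\<^sub>R y))"
      by (intro continuous_intros) (use ray_nonzero in \<open>auto simp: bclosure_def\<close>)
    have "(\<lambda>y. sgn (e + a *\<^sub>R y)) ` bclosure a \<subseteq> closure (shrunk a)"
      using ray_mem_closure_shrunk[OF _ a] by (rule image_subsetI)
    from continuous_on_compose2[OF blown_solution_continuous[OF u] c this]
    have "continuous_on (bclosure a) (\<lambda>y. u (sgn (e + a *\<^sub>R y)))" .
    then show "continuous_on (bclosure a) k" unfolding k_def by (intro continuous_intros)
    show "0 \<le> k y" if "y \<in> bclosure a" for y
      unfolding k_def by (rule bspec[OF nn ray_mem_closure_shrunk[OF that a]])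
    fix y V \<rho>
    assume y: "y \<in> bclosure a - bdomain a" "local_boundary V \<rho> (bmap (y, a))" "bnormal a \<rho> y \<noteq> 0"
    note blown_solution_normal[OF u y]
    from DERIV_add[OF DERIV_const[of A] DERIV_cmult[OF this, of B]]
    show "((\<lambda>t. k (y + t *\<^sub>R bnormal a \<rho> y)) has_real_derivative 0) (at 0)" by (simp add: k_def)
  qed
  fix y assume y: "y \<in> bdomain a"
  note blown_solution_lap[OF u y]
  from has_lap_add[OF has_lap_const[of A] has_lap_cmult[OF this, of B]]
  show "has_lap k y (- (a / norm (e + a *\<^sub>R y))\<^sup>2 * (\<mu> * (k y - A)))"
    unfolding k_def by (rule back_subst[of "has_lap _ _"]) (simp add: mult_ac)
qed

lemma shrunk_attains_inf:
  fixes f :: "'a \<Rightarrow> real"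
  assumes f: "continuous_on (closure (shrunk a)) f" and x: "x \<in> closure (shrunk a)"
  obtains x0 where "x0 \<in> closure (shrunk a)" "\<forall>x\<in>closure (shrunk a). f x0 \<le> f x"
proof -
  have ne: "closure (shrunk a) \<noteq> {}" using x by (metis empty_iff)
  obtain x0 where x0: "x0 \<in> closure (shrunk a)" "\<forall>y\<in>closure (shrunk a). f x0 \<le> f y"
    using continuous_attains_inf[OF compact_closure_shrunk ne f] by (rule bexE)
  show ?thesis by (rule that[OF x0])
qed

text \<open>Dividing by the value at a maximum point of \<open>\<bar>u\<bar>\<close>, sign included,
  makes the extremum \<open>+1\<close>, so that \<open>1 - B * u x\<close> is nonnegative and has a
  zero.\<close>

lemma normalised_extremum:
  assumes u: "blown_solution a \<mu> u" and x: "x \<in> closure (shrunk a)" "u x \<noteq> 0"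
  obtains B x0 where "B \<noteq> 0" "x0 \<in> closure (shrunk a)" "B * u x0 = 1" "\<forall>x\<in>closure (shrunk a). \<bar>B * u x\<bar> \<le> 1"
proof -
  have c: "continuous_on (closure (shrunk a)) (\<lambda>x. - \<bar>u x\<bar>)"
    by (intro continuous_intros blown_solution_continuous[OF u])
  obtain x0 where x0': "x0 \<in> closure (shrunk a)" "\<forall>x\<in>closure (shrunk a). - \<bar>u x0\<bar> \<le> - \<bar>u x\<bar>"
    using shrunk_attains_inf[OF c x(1)] .
  note x0 = x0'(1) bspec[OF x0'(2)]
  have "u x0 \<noteq> 0" using x0(2)[OF x(1)] x(2) by auto
  show ?thesis
  proof (rule that[of "1 / u x0" x0])
    show "1 / u x0 \<noteq> 0" "1 / u x0 * u x0 = 1" using \<open>u x0 \<noteq> 0\<close> by simp_all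
    show "\<forall>x\<in>closure (shrunk a). \<bar>1 / u x0 * u x\<bar> \<le> 1"
    proof
      fix x assume "x \<in> closure (shrunk a)"
      then show "\<bar>1 / u x0 * u x\<bar> \<le> 1" using x0(2)[of x] \<open>u x0 \<noteq> 0\<close> by (simp add: divide_le_eq_1)
    qed
  qed (rule x0(1))
qed

lemma limit_core_nonempty: "limit_core \<noteq> {}"
proof -
  obtain x where x: "x \<in> D" using D unfolding smooth_domain_def by blast
  then have "x \<in> closure D" using closure_subset by blast
  then obtain z where z: "z \<in> limit_slice" "x = sexp z" "slog x = z" by (rule closure_D_sexp)
  have "bmap (z, 0) = x" unfolding z(2) using limit_slice_norm[OF z(1)] by (simp add: bmap_def hproj_orth)
  then have "z \<in> limit_core"
    unfolding limit_core_def using limit_slice_cases(1,3)[OF z(1)] x by simp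
  then show ?thesis by blast
qed

section \<open>Bounded eigenvalues and divergence\<close>

lemma small_eigenvalues_simple:
  "\<exists>\<kappa>>0. \<forall>a \<mu>0 \<mu>1 u v. 0 < a \<longrightarrow> a < \<kappa> \<longrightarrow> \<mu>0 \<le> M \<longrightarrow> \<mu>1 \<le> M \<longrightarrow>
    blown_solution a \<mu>0 u \<longrightarrow> blown_solution a \<mu>1 v \<longrightarrow> (\<exists>x\<in>shrunk a. u x \<noteq> 0) \<longrightarrow> (\<exists>x\<in>shrunk a. v x \<noteq> 0) \<longrightarrow>
    (\<exists>c d. (c \<noteq> 0 \<or> d \<noteq> 0) \<and> (\<forall>x\<in>shrunk a. c * u x + d * v x = 0))"
proof -
  obtain p where p: "p \<in> limit_core" using limit_core_nonempty by blast
  have "(1::real) / 4 > 0" by simp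
  from propagation[OF p this]
  obtain \<kappa>1 where \<kappa>1: "\<kappa>1 > 0" and reach: "\<And>a k z. 0 < a \<Longrightarrow> a < \<kappa>1 \<Longrightarrow> almost_harmonic a \<kappa>1 k \<Longrightarrow>
      z \<in> limit_slice \<Longrightarrow> k (unblog a z) = 0 \<Longrightarrow> k p \<le> 1 / 4" by blast
  obtain \<kappa>2 where \<kappa>2: "\<kappa>2 > 0" and strict: "\<And>a k z. 0 < a \<Longrightarrow> a < \<kappa>2 \<Longrightarrow> strictly_superharmonic a k \<Longrightarrow>
      z \<in> limit_slice \<Longrightarrow> k (unblog a z) \<noteq> 0" using strictly_superharmonic_nonzero by blast
  \<comment> \<open>\<open>M\<close> may be negative or zero; a positive bound is needed to divide
    by.\<close>
  define M' where "M' = \<bar>M\<bar> + 1"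
  \<comment> \<open>Where \<open>norm (e + a *\<^sub>R y) \<ge> 1 / 2\<close> and
    \<open>a < 1\<close>, the factor \<open>(a / norm (e + a *\<^sub>R y))\<^sup>2\<close> is at
    most \<open>4 * a\<close>; the Laplacian is then at most
    \<open>4 * a * M' \<le> \<kappa>1\<close>.\<close>
  define \<kappa> where "\<kappa> = Min {\<kappa>1, \<kappa>2, 1, \<kappa>1 / (4 * M')}"
  have M': "M' > 0" "M \<le> M'" by (auto simp: M'_def)
  have \<kappa>: "\<kappa> > 0" "\<kappa> \<le> \<kappa>1" "\<kappa> \<le> \<kappa>2" "\<kappa> \<le> 1" "\<kappa> \<le> \<kappa>1 / (4 * M')"
    using \<kappa>1 \<kappa>2 M' by (auto simp: \<kappa>_def)
  have tpos: "(a / norm (e + a *\<^sub>R y))\<^sup>2 > 0" if "y \<in> bdomain a" "a > 0" for y a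
    using that ray_nonzero[of y a] by (auto simp: bdomain_def)
  \<comment> \<open>Only an upper bound on the eigenvalue is assumed. A negative one would make
    \<open>1 - B * u x\<close> strictly superharmonic near its zero at \<open>x0\<close>.\<close>
  have nonneg: "\<mu> \<ge> 0" if a: "0 < a" "a < \<kappa>" and u: "blown_solution a \<mu> u" "x \<in> closure (shrunk a)" "u x \<noteq> 0" for a \<mu> u x
  proof (rule ccontr)
    assume neg: "\<not> \<mu> \<ge> 0"
    obtain B x0 where "B \<noteq> 0" and B': "x0 \<in> closure (shrunk a)" "B * u x0 = 1" "\<forall>x\<in>closure (shrunk a). \<bar>B * u x\<bar> \<le> 1"
      using normalised_extremum[OF u] .
    note B = B'(1,2) bspec[OF B'(3)]
    define k where "k y = 1 + (- B) * u (sgn (e + a *\<^sub>R y))" for y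
    have "\<forall>x\<in>closure (shrunk a). 0 \<le> 1 + (- B) * u x"
    proof
      fix x assume "x \<in> closure (shrunk a)"
      then show "0 \<le> 1 + (- B) * u x" using B(3)[of x] by (simp add: abs_le_iff)
    qed
    note af = blown_solution_affine[OF u(1) a(1) this, folded k_def]
    have ss: "strictly_superharmonic a k" unfolding strictly_superharmonic_def
    proof (intro conjI ballI impI)
      show "nonneg_neumann a k" by (rule af(1))
      fix y assume y: "y \<in> bdomain a" "k y < 1 / 2"
      have "\<mu> * (k y - 1) > 0" using y neg by (intro mult_neg_neg) auto
      then have "- (a / norm (e + a *\<^sub>R y))\<^sup>2 * (\<mu> * (k y - 1)) < 0"
        using tpos[OF y(1) a(1)] by (intro mult_neg_pos) auto
      then show "\<exists>L<0. has_lap k y L" using af(2)[OF y(1)] by blast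
    qed
    obtain z where z: "z \<in> limit_slice" "x0 = sgn (e + a *\<^sub>R unblog a z)"
      using closure_shrunk_unblog[OF B(1) a(1)] .
    have "k (unblog a z) \<noteq> 0"
      by (rule strict[OF a(1) _ ss z(1)]) (use a(2) \<kappa>(3) in simp)
    then show False using B(2) z(2) by (simp add: k_def)
  qed
  have nozero: "u x \<noteq> 0" if a: "0 < a" "a < \<kappa>" and \<mu>: "0 \<le> \<mu>" "\<mu> \<le> M"
    and u: "blown_solution a \<mu> u" "y \<in> closure (shrunk a)" "u y \<noteq> 0" and x: "x \<in> closure (shrunk a)" for a \<mu> u y x
  proof
    assume ux: "u x = 0"
    obtain B x0 where "B \<noteq> 0" and B': "x0 \<in> closure (shrunk a)" "B * u x0 = 1" "\<forall>x\<in>closure (shrunk a). \<bar>B * u x\<bar> \<le> 1"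
      using normalised_extremum[OF u] .
    note B = B'(1,2) bspec[OF B'(3)]
    \<comment> \<open>Applied to \<open>1 - B * u x\<close> and to \<open>B * u x\<close> minus its
      minimum. At \<open>p\<close> both would be at most \<open>1 / 4\<close>, yet their sum is 1
      minus the minimum, at least 1 if \<open>u\<close> has a zero.\<close>
    have key: "A + C * u (sgn (e + a *\<^sub>R p)) \<le> 1 / 4"
      if C: "C = B \<or> C = - B" and A: "\<And>x. x \<in> closure (shrunk a) \<Longrightarrow> 0 \<le> A + C * u x \<and> A + C * u x \<le> 2"
        and z: "x' \<in> closure (shrunk a)" "A + C * u x' = 0" for A C x'
    proof -
      define k where "k y = A + C * u (sgn (e + a *\<^sub>R y))" for y
      have "\<forall>x\<in>closure (shrunk a). 0 \<le> A + C * u x"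
      proof
        fix x assume "x \<in> closure (shrunk a)"
        then show "0 \<le> A + C * u x" using A[of x] by simp
      qed
      note af = blown_solution_affine[OF u(1) a(1) this, folded k_def]
      have "almost_harmonic a \<kappa>1 k" unfolding almost_harmonic_def
      proof (intro conjI ballI impI)
        show "nonneg_neumann a k" by (rule af(1))
        show "k y \<le> 2" if "y \<in> bclosure a" for y
          using A[OF ray_mem_closure_shrunk[OF that a(1)]] by (simp add: k_def)
        fix y assume y: "y \<in> bdomain a" "1 / 2 < 1 + a * (y \<bullet> e)"
        have yc: "y \<in> bclosure a" using y bdomain_subset_bclosure by blast
        have "\<bar>(e + a *\<^sub>R y) \<bullet> e\<bar> \<le> norm (e + a *\<^sub>R y) * norm e" by (rule Cauchy_Schwarz_ineq2)
        then have "1 / 2 \<le> norm (e + a *\<^sub>R y)" using y norm_e by (simp add: inner_add_left)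
        then have "a / norm (e + a *\<^sub>R y) \<le> a / (1 / 2)" using a by (intro divide_left_mono) auto
        then have "(a / norm (e + a *\<^sub>R y))\<^sup>2 \<le> (2 * a)\<^sup>2" using a by (intro power_mono) auto
        also have "\<dots> \<le> 4 * a * 1" using a \<kappa> by (simp add: power2_eq_square)
        finally have q: "(a / norm (e + a *\<^sub>R y))\<^sup>2 \<le> 4 * a" by simp
        have "\<bar>C * u (sgn (e + a *\<^sub>R y))\<bar> \<le> 1" using B(3)[OF ray_mem_closure_shrunk[OF yc a(1)]] C by auto
        then have k1: "\<bar>k y - A\<bar> \<le> 1" by (simp add: k_def)
        have mk: "\<bar>\<mu> * (k y - A)\<bar> \<le> M' * 1" unfolding abs_mult using \<mu> M' k1 by (intro mult_mono) auto
        have "\<bar>- (a / norm (e + a *\<^sub>R y))\<^sup>2 * (\<mu> * (k y - A))\<bar>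
          = (a / norm (e + a *\<^sub>R y))\<^sup>2 * \<bar>\<mu> * (k y - A)\<bar>" by (simp add: abs_mult)
        also have "\<dots> \<le> (4 * a) * (M' * 1)" using a by (intro mult_mono q mk) auto
        also have "\<dots> = a * (4 * M')" by simp
        also have "\<dots> \<le> \<kappa> * (4 * M')" using a(2) M' by (intro mult_right_mono) auto
        also have "\<dots> \<le> \<kappa>1" using \<kappa>(5) M' by (simp add: pos_le_divide_eq)
        finally show "\<exists>L. \<bar>L\<bar> \<le> \<kappa>1 \<and> has_lap k y L" using af(2)[OF y(1)] by blast
      qed
      moreover obtain z' where "z' \<in> limit_slice" "x' = sgn (e + a *\<^sub>R unblog a z')"
        using closure_shrunk_unblog[OF z(1) a(1)] .
      ultimately show ?thesis using reach[OF a(1), of k z'] a(2) \<kappa>(2) z(2) by (simp add: k_def)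
    qed
    have h: "0 \<le> 1 + (- B) * u x \<and> 1 + (- B) * u x \<le> 2" if "x \<in> closure (shrunk a)" for x
      using B(3)[OF that] by (simp add: abs_le_iff)
    have 1: "1 + (- B) * u (sgn (e + a *\<^sub>R p)) \<le> 1 / 4"
      using key[of "- B" 1 x0] h B(1,2) by auto
    have "continuous_on (closure (shrunk a)) (\<lambda>x. B * u x)"
      by (intro continuous_intros blown_solution_continuous[OF u(1)])
    from shrunk_attains_inf[OF this x]
    obtain x2 where x2': "x2 \<in> closure (shrunk a)" "\<forall>x\<in>closure (shrunk a). B * u x2 \<le> B * u x" .
    note x2 = x2'(1) bspec[OF x2'(2)]
    have x20: "B * u x2 \<le> 0" "-1 \<le> B * u x2" using x2(2)[OF x] ux B(3)[OF x2(1)] by auto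
    have "0 \<le> - B * u x2 + B * u x \<and> - B * u x2 + B * u x \<le> 2" if "x \<in> closure (shrunk a)" for x
      using x2(2)[OF that] B(3)[OF that] x20 by (simp add: abs_le_iff)
    then have "- B * u x2 + B * u (sgn (e + a *\<^sub>R p)) \<le> 1 / 4"
      using key[of B "- B * u x2" x2] x2(1) by simp
    then show False using 1 x20 by simp
  qed
  \<comment> \<open>Without zeros \<open>u\<close> has one sign on the connected closure;
    \<open>s\<close> normalises it to be positive.\<close>
  have sgnu: "\<exists>s. s \<noteq> 0 \<and> (\<forall>x\<in>closure (shrunk a). s * u x > (0::real))"
    if u: "continuous_on (closure (shrunk a)) u" "\<forall>x\<in>closure (shrunk a). u x \<noteq> 0" for a u
  proof -
    have c: "connected (u ` closure (shrunk a))"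
      by (rule connected_continuous_image[OF u(1) connected_closure_shrunk])
    have "\<not> (u x < 0 \<and> 0 < u y)" if "x \<in> closure (shrunk a)" "y \<in> closure (shrunk a)" for x y
    proof
      assume "u x < 0 \<and> 0 < u y"
      then have "0 \<in> u ` closure (shrunk a)"
        using connectedD_interval[OF c imageI[OF that(1)] imageI[OF that(2)], of 0] by simp
      then show False using u(2) by force
    qed
    then have sgn_eq: "\<not> u x < 0 \<or> \<not> 0 < u y" if "x \<in> closure (shrunk a)" "y \<in> closure (shrunk a)" for x y
      using that by blast
    show ?thesis
    proof (cases "\<exists>x\<in>closure (shrunk a). u x < 0")
      case True
      then have "u y < 0" if "y \<in> closure (shrunk a)" for y
        using sgn_eq[OF _ that] bspec[OF u(2) that] by force
      then show ?thesis by (intro exI[of _ "-1"]) auto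
    next
      case False
      then show ?thesis using u(2) by (intro exI[of _ 1]) force
    qed
  qed
  \<comment> \<open>For a positive eigenvalue the positive function \<open>s * u x\<close> has
    negative Laplacian everywhere. Subtracting its minimum gives a strictly superharmonic function
    with a zero.\<close>
  have zero: "\<mu> = 0" if a: "0 < a" "a < \<kappa>" and \<mu>: "\<mu> \<le> M"
    and u: "blown_solution a \<mu> u" "y \<in> closure (shrunk a)" "u y \<noteq> 0" for a \<mu> u y
  proof (rule ccontr)
    assume "\<mu> \<noteq> 0"
    then have \<mu>0: "\<mu> > 0" using nonneg[OF a u] by simp
    have uc: "continuous_on (closure (shrunk a)) u" by (rule blown_solution_continuous[OF u(1)])
    have "\<forall>x\<in>closure (shrunk a). u x \<noteq> 0"
      by (rule ballI) (rule nozero[OF a less_imp_le[OF \<mu>0] \<mu> u])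
    from sgnu[OF uc this] obtain s where "s \<noteq> 0" and s': "\<forall>x\<in>closure (shrunk a). s * u x > 0"
      by (elim exE conjE) (rule that, assumption+)
    note s = bspec[OF s']
    have "continuous_on (closure (shrunk a)) (\<lambda>x. s * u x)" using uc by (intro continuous_intros)
    from shrunk_attains_inf[OF this u(2)]
    obtain x0 where x0': "x0 \<in> closure (shrunk a)" "\<forall>x\<in>closure (shrunk a). s * u x0 \<le> s * u x" .
    note x0 = x0'(1) bspec[OF x0'(2)]
    define k where "k y = - (s * u x0) + s * u (sgn (e + a *\<^sub>R y))" for y
    have "\<forall>x\<in>closure (shrunk a). 0 \<le> - (s * u x0) + s * u x"
    proof
      fix x assume "x \<in> closure (shrunk a)"
      then show "0 \<le> - (s * u x0) + s * u x" using x0(2)[of x] by simp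
    qed
    note af = blown_solution_affine[OF u(1) a(1) this, folded k_def]
    have ss: "strictly_superharmonic a k" unfolding strictly_superharmonic_def
    proof (intro conjI ballI impI)
      show "nonneg_neumann a k" by (rule af(1))
      fix y assume y: "y \<in> bdomain a"
      then have "y \<in> bclosure a" using bdomain_subset_bclosure by blast
      then have "0 < s * u (sgn (e + a *\<^sub>R y))" using s[OF ray_mem_closure_shrunk[OF _ a(1)]] by blast
      then have "\<mu> * (k y - (- (s * u x0))) > 0" using \<mu>0 by (simp add: k_def)
      then have "- (a / norm (e + a *\<^sub>R y))\<^sup>2 * (\<mu> * (k y - (- (s * u x0)))) < 0"
        using tpos[OF y a(1)] by (intro mult_neg_pos) auto
      then show "\<exists>L<0. has_lap k y L" using af(2)[OF y] by blast
    qed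
    obtain z where z: "z \<in> limit_slice" "x0 = sgn (e + a *\<^sub>R unblog a z)"
      using closure_shrunk_unblog[OF x0(1) a(1)] .
    have "k (unblog a z) \<noteq> 0"
      by (rule strict[OF a(1) _ ss z(1)]) (use a(2) \<kappa>(3) in simp)
    then show False using z(2) by (simp add: k_def)
  qed
  show ?thesis
  proof (rule exI[of _ \<kappa>], intro conjI \<kappa>(1) allI impI)
    fix a \<mu>0 \<mu>1 and u v :: "'a \<Rightarrow> real"
    assume a: "0 < a" "a < \<kappa>" and \<mu>: "\<mu>0 \<le> M" "\<mu>1 \<le> M" and u: "blown_solution a \<mu>0 u" and v: "blown_solution a \<mu>1 v"
      and ux: "\<exists>x\<in>shrunk a. u x \<noteq> 0" and vx: "\<exists>x\<in>shrunk a. v x \<noteq> 0"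
    obtain x1 where x1: "x1 \<in> shrunk a" "u x1 \<noteq> 0" using ux by (rule bexE)
    obtain x2 where x2: "x2 \<in> shrunk a" "v x2 \<noteq> 0" using vx by (rule bexE)
    have sub: "x \<in> closure (shrunk a)" if "x \<in> shrunk a" for x using subsetD[OF closure_subset that] .
    have z: "\<mu>0 = 0" "\<mu>1 = 0"
      using zero[OF a \<mu>(1) u sub[OF x1(1)] x1(2)] zero[OF a \<mu>(2) v sub[OF x2(1)] x2(2)] by auto
    have M: "0 \<le> M" using \<mu> z by simp
    \<comment> \<open>Both eigenvalues are 0, so \<open>w\<close> solves the same equation; it
      vanishes at \<open>x1\<close>, and a nontrivial solution has no zero.\<close>
    define w where "w x = v x1 * u x + (- u x1) * v x" for x
    have w: "blown_solution a 0 w" unfolding w_def[abs_def]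
      using u v z by (intro blown_solution_combination) auto
    have "w x1 = 0" by (simp add: w_def)
    then have "w x = 0" if "x \<in> shrunk a" for x
      using nozero[OF a order_refl M w sub[OF that] _ sub[OF x1(1)]] by blast
    then show "\<exists>c d. (c \<noteq> 0 \<or> d \<noteq> 0) \<and> (\<forall>x\<in>shrunk a. c * u x + d * v x = 0)"
      using x1(2) by (intro exI[of _ "v x1"] exI[of _ "- u x1"]) (auto simp: w_def)
  qed
qed

text \<open>For \<open>j \<ge> 1\<close> any admissible family contains two independent
  eigenfunctions, at indices 0 and 1. The bound \<open>r + 1\<close> yields the strict inequality
  after passing to the infimum.\<close>

lemma eigenvalue_tendsto:
  assumes j: "j \<ge> 1"
  shows "((\<lambda>a. neumann_eigenvalue (shrunk a) j) \<longlongrightarrow> \<infinity>) (at_right 0)"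
proof (rule tendsto_PInfty[THEN iffD2], rule allI)
  fix r :: real
  obtain \<kappa> where \<kappa>: "\<kappa> > 0" and ind: "\<forall>a \<mu>0 \<mu>1 u v. 0 < a \<longrightarrow> a < \<kappa> \<longrightarrow> \<mu>0 \<le> r + 1 \<longrightarrow> \<mu>1 \<le> r + 1 \<longrightarrow>
    blown_solution a \<mu>0 u \<longrightarrow> blown_solution a \<mu>1 v \<longrightarrow> (\<exists>x\<in>shrunk a. u x \<noteq> 0) \<longrightarrow> (\<exists>x\<in>shrunk a. v x \<noteq> 0) \<longrightarrow>
    (\<exists>c d. (c \<noteq> 0 \<or> d \<noteq> 0) \<and> (\<forall>x\<in>shrunk a. c * u x + d * v x = 0))"
    using small_eigenvalues_simple[of "r + 1"]
    by (elim exE conjE) (rule that[rotated], assumption+)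
  have "ereal r < neumann_eigenvalue (shrunk a) j" if a: "0 < a" "a < \<kappa>" for a
  proof -
    have "r + 1 \<le> \<mu>" if m: "\<forall>i\<le>j. m i \<le> \<mu> \<and> neumann_eigenfunction (shrunk a) (m i) (u i)"
      and li: "lin_indep_on (shrunk a) {..j} u" for \<mu> m u
    proof (rule ccontr)
      assume "\<not> r + 1 \<le> \<mu>"
      then have le: "m 0 \<le> r + 1" "m 1 \<le> r + 1" using m j by (auto intro: order_trans[of _ \<mu>])
      have ef: "neumann_eigenfunction (shrunk a) (m 0) (u 0)" "neumann_eigenfunction (shrunk a) (m 1) (u 1)"
        using m j by auto
      then have nz: "\<exists>x\<in>shrunk a. u 0 x \<noteq> 0" "\<exists>x\<in>shrunk a. u 1 x \<noteq> 0"
        unfolding neumann_eigenfunction_def by blast+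
      obtain c d where cd: "c \<noteq> 0 \<or> d \<noteq> 0" "\<And>x. x \<in> shrunk a \<Longrightarrow> c * u 0 x + d * u 1 x = 0"
        using ind[rule_format, OF a le eigenfunction_blown_solution[OF ef(1) a(1)] eigenfunction_blown_solution[OF ef(2) a(1)] nz]
        by blast
      \<comment> \<open>The relation between two eigenfunctions, padded with zeros to contradict
        independence of the whole family.\<close>
      define f where "f i = (if i = 0 then c else if i = 1 then d else 0)" for i :: nat
      have "(\<Sum>i\<in>{..j}. f i * u i x) = (\<Sum>i\<in>{0, 1}. f i * u i x)" for x
        using j by (intro sum.mono_neutral_right) (auto simp: f_def)
      then have "\<forall>x\<in>shrunk a. (\<Sum>i\<in>{..j}. f i * u i x) = 0" using cd(2) by (simp add: f_def)
      then have "\<forall>i\<in>{..j}. f i = 0" using li unfolding lin_indep_on_def by blast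
      then have "f 0 = 0" "f 1 = 0" using j by auto
      then show False using cd(1) by (simp add: f_def)
    qed
    then have "ereal (r + 1) \<le> neumann_eigenvalue (shrunk a) j"
      unfolding neumann_eigenvalue_def by (intro Inf_greatest) auto
    moreover have "ereal r < ereal (r + 1)" by simp
    ultimately show ?thesis by (rule less_le_trans[rotated])
  qed
  then show "\<forall>\<^sub>F a in at_right 0. ereal r < neumann_eigenvalue (shrunk a) j"
    using \<kappa> unfolding eventually_at_right[OF zero_less_one] by blast
qed

end

theorem proposition2p1:
  fixes D :: "(real ^ 'n) set" and k :: 'n and j :: nat
  assumes "CARD('n) \<ge> 3"
    and "smooth_domain D"
    and "D \<subseteq> {x \<in> sphere 0 1. x $ k > 0}"
    and "j \<ge> 1"
  shows "((\<lambda>\<alpha>. neumann_eigenvalue (polar_dilation (axis k 1) \<alpha> ` D) j) \<longlongrightarrow> \<infinity>) (at_right 0)"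
proof -
  \<comment> \<open>The pole is the coordinate vector of \<open>k\<close>, so the inner product with
    it is the coordinate \<open>x $ k\<close>.\<close>
  interpret cap_domain "axis k 1 :: real ^ 'n" D
    by unfold_locales (use assms(2,3) in \<open>auto simp: inner_axis\<close>)
  show ?thesis using eigenvalue_tendsto[OF assms(4)] .
qed

end
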